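(* Let $(H,\mathcal{R})$ be a triangular Hopf algebra, $\mathcal{A}$ a braided commutative left $H$-module algebra, $\mathcal{F}$ a Drinfel'd twist on $H$ and $\mathbf{g}$ an equivariant metric on $\mathcal{A}$. Then the twisted equivariant metric $\mathbf{g}_\mathcal{F}$, defined by $$\mathbf{g}_\mathcal{F}(X,Y)=\mathbf{g}(\mathcal{F}_1^{-1}\rhd X,\mathcal{F}_2^{-1}\rhd Y)\quad\text{for all }X,Y\in\mathfrak{X}^1_\mathcal{R}(\mathcal{A}),$$ is an equivariant metric with respect to $\mathcal{R}_\mathcal{F}$ on $\mathcal{A}_\mathcal{F}$ (under the identification $\mathfrak{X}^1_\mathcal{R}(\mathcal{A})_\mathcal{F}\cong\mathfrak{X}^1_{\mathcal{R}_\mathcal{F}}(\mathcal{A}_\mathcal{F})$, $X\mapsto X^\mathcal{F}$). Moreover, assuming that $\mathbf{g}$ and $\mathbf{g}_\mathcal{F}$ are non-degenerate, twisting the equivariant Levi-Civita covariant derivative $\nabla^\mathcal{R}$ with respect to $\mathbf{g}$, i.e. forming $\nabla^\mathcal{F}_XY=\nabla^\mathcal{R}_{\mathcal{F}_1^{-1}\rhd X}(\mathcal{F}_2^{-1}\rhd Y)$, leads to the equivariant Levi-Civita covariant derivative with respect to $\mathbf{g}_\mathcal{F}$.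
   Context: **Hopf algebras.** $\Bbbk$ is a commutative ring, $\otimes=\otimes_\Bbbk$, algebras are unital associative $\Bbbk$-algebras. A Hopf algebra $H$ has coproduct $\Delta(\xi)=\xi_{(1)}\otimes\xi_{(2)}$, counit $\epsilon$ and bijective antipode $S$. A triangular Hopf algebra $(H,\mathcal{R})$ is a Hopf algebra with an invertible $\mathcal{R}=\mathcal{R}_1\otimes\mathcal{R}_2\in H\otimes H$ (sums suppressed) such that $\mathcal{R}^{-1}=\mathcal{R}_{21}$, $\xi_{(2)}\otimes\xi_{(1)}=\mathcal{R}\Delta(\xi)\mathcal{R}^{-1}$, $(\Delta\otimes\mathrm{id})(\mathcal{R})=\mathcal{R}_{13}\mathcal{R}_{23}$, $(\mathrm{id}\otimes\Delta)(\mathcal{R})=\mathcal{R}_{13}\mathcal{R}_{12}$. Write $\mathcal{R}^{-1}=\mathcal{R}_1^{-1}\otimes\mathcal{R}_2^{-1}$. **Modules.** A left $H$-module algebra $\mathcal{A}$ satisfies $\xi\rhd(ab)=(\xi_{(1)}\rhd a)(\xi_{(2)}\rhd b)$, $\xi\rhd1=\epsilon(\xi)1$; it is braided commutative if $ba=(\mathcal{R}_1^{-1}\rhd a)(\mathcal{R}_2^{-1}\rhd b)$. **Braided vector fields.** $\mathfrak{X}^1_\mathcal{R}(\mathcal{A})=\mathrm{Der}_\mathcal{R}(\mathcal{A})$ is the set of braided derivations: $\Bbbk$-linear $X\colon\mathcal{A}\to\mathcal{A}$ with $X(ab)=X(a)b+(\mathcal{R}_1^{-1}\rhd a)((\mathcal{R}_2^{-1}\rhd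 X)(b))$, where $H$ acts by the adjoint action $(\xi\rhd X)(a)=\xi_{(1)}\rhd(X(S(\xi_{(2)})\rhd a))$. It is an $\mathcal{A}$-bimodule with $(a\cdot X)(b)=a\,X(b)$ and $X\cdot a=(\mathcal{R}_1^{-1}\rhd a)\cdot(\mathcal{R}_2^{-1}\rhd X)$. Put $[X,Y]_\mathcal{R}=XY-(\mathcal{R}_1^{-1}\rhd Y)(\mathcal{R}_2^{-1}\rhd X)$ and $\mathscr{L}^\mathcal{R}_Xa=X(a)$. **Equivariant covariant derivative on $\mathcal{A}$.** A $\Bbbk$-linear map $\nabla^\mathcal{R}\colon\mathfrak{X}^1_\mathcal{R}(\mathcal{A})\otimes\mathfrak{X}^1_\mathcal{R}(\mathcal{A})\to\mathfrak{X}^1_\mathcal{R}(\mathcal{A})$ with $\xi\rhd(\nabla^\mathcal{R}_XY)=\nabla^\mathcal{R}_{\xi_{(1)}\rhd X}(\xi_{(2)}\rhd Y)$, $\nabla^\mathcal{R}_{a\cdot X}Y=a\cdot(\nabla^\mathcal{R}_XY)$ and $\nabla^\mathcal{R}_X(a\cdot Y)=(\mathscr{L}^\mathcal{R}_Xa)\cdot Y+(\mathcal{R}_1^{-1}\rhd a)\cdot(\nabla^\mathcal{R}_{\mathcal{R}_2^{-1}\rhd X}Y)$. It is torsion-free if $\nabla^\mathcal{R}_XY-\nabla^\mathcal{R}_{\mathcal{R}_1^{-1}\rhd Y}(\mathcal{R}_2^{-1}\rhd X)-[X,Y]_\mathcal{R}=0$ for all $X,Y$. **Equivariant metric.** A $\Bbbk$-linear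 map $\mathbf{g}\colon\mathfrak{X}^1_\mathcal{R}(\mathcal{A})\otimes_\mathcal{A}\mathfrak{X}^1_\mathcal{R}(\mathcal{A})\to\mathcal{A}$ which is left $\mathcal{A}$-linear in the first argument, $H$-equivariant ($\xi\rhd\mathbf{g}(X,Y)=\mathbf{g}(\xi_{(1)}\rhd X,\xi_{(2)}\rhd Y)$) and braided symmetric ($\mathbf{g}(Y,X)=\mathbf{g}(\mathcal{R}_1^{-1}\rhd X,\mathcal{R}_2^{-1}\rhd Y)$). It is non-degenerate if $\mathbf{g}(X,Y)=0$ for all $Y$ implies $X=0$. $\nabla^\mathcal{R}$ is metric with respect to $\mathbf{g}$ if $\mathscr{L}^\mathcal{R}_X(\mathbf{g}(Y,Z))=\mathbf{g}(\nabla^\mathcal{R}_XY,Z)+\mathbf{g}(\mathcal{R}_1^{-1}\rhd Y,\nabla^\mathcal{R}_{\mathcal{R}_2^{-1}\rhd X}Z)$ for all $X,Y,Z$. For non-degenerate $\mathbf{g}$, the equivariant Levi-Civita covariant derivative is the unique torsion-free equivariant covariant derivative on $\mathcal{A}$ which is metric with respect to $\mathbf{g}$. **Twists.** A (Drinfel'd) twist on $H$ is an invertible $\mathcal{F}=\mathcal{F}_1\otimes\mathcal{F}_2\in H\otimes H$ with $(\mathcal{F}\otimes1)(\Delta\otimes\mathrm{id})(\mathcal{F})=(1\otimes\mathcal{F})(\mathrm{id}\otimes\Delta)(\mathcal{F})$ and $(\epsilon\otimes\mathrm{id})(\mathcal{F})=1=(\mathrm{id}\otimes\epsilon)(\mathcal{F})$;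 write $\mathcal{F}^{-1}=\mathcal{F}_1^{-1}\otimes\mathcal{F}_2^{-1}$. $H_\mathcal{F}$ is the algebra $H$ with counit $\epsilon$, coproduct $\Delta_\mathcal{F}(\xi)=\mathcal{F}\Delta(\xi)\mathcal{F}^{-1}$, antipode $S_\mathcal{F}(\xi)=\beta S(\xi)\beta^{-1}$, $\beta=\mathcal{F}_1S(\mathcal{F}_2)$; it is triangular with $\mathcal{R}_\mathcal{F}=\mathcal{F}_{21}\mathcal{R}\mathcal{F}^{-1}$. $\mathcal{A}_\mathcal{F}$ is $\mathcal{A}$ with the same action and product $a\cdot_\mathcal{F}b=(\mathcal{F}_1^{-1}\rhd a)(\mathcal{F}_2^{-1}\rhd b)$, a braided commutative left $H_\mathcal{F}$-module algebra. $\mathfrak{X}^1_\mathcal{R}(\mathcal{A})_\mathcal{F}$ is the $H$-module $\mathfrak{X}^1_\mathcal{R}(\mathcal{A})$ with $a\cdot_\mathcal{F}X=(\mathcal{F}_1^{-1}\rhd a)\cdot(\mathcal{F}_2^{-1}\rhd X)$, $X\cdot_\mathcal{F}a=(\mathcal{F}_1^{-1}\rhd X)\cdot(\mathcal{F}_2^{-1}\rhd a)$. It is identified with $\mathfrak{X}^1_{\mathcal{R}_\mathcal{F}}(\mathcal{A}_\mathcal{F})$ via the isomorphism $X\mapsto X^\mathcal{F}$, $X^\mathcal{F}(a)=(\mathcal{F}_1^{-1}\rhd X)(\mathcal{F}_2^{-1}\rhd a)$. All notions for $(\mathcal{A}_\mathcal{F},\mathcal{R}_\mathcal{F})$ are those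 above with $(H,\mathcal{R},\mathcal{A})$ replaced by $(H_\mathcal{F},\mathcal{R}_\mathcal{F},\mathcal{A}_\mathcal{F})$. *)

theory Defs
  imports Complex_Main "HOL-Library.Poly_Mapping" "HOL-Library.Function_Algebras"
begin

section \<open>Tensor powers of a module over a commutative ring\<close>

text \<open>
  \<open>H \<otimes> H\<close> and \<open>H \<otimes> H \<otimes> H\<close> are the quotients of the free modules on \<open>H \<times> H\<close> and
  \<open>H \<times> H \<times> H\<close> by the submodules spanned by the multilinearity relations. Since the quotient
  depends on the scalar multiplication of \<open>H\<close>, it is not available as a type; a tensor is
  represented by an element of the free module (a formal linear combination of pure tensors, as in
  Sweedler notation), and equality of tensors is equality modulo the relation submodule.
\<close>

type_synonym ('k, 'h) tensor2 = "('h \<times> 'h) \<Rightarrow>\<^sub>0 'k"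
type_synonym ('k, 'h) tensor3 = "('h \<times> 'h \<times> 'h) \<Rightarrow>\<^sub>0 'k"

definition free_scale :: "'k::comm_ring_1 \<Rightarrow> ('i \<Rightarrow>\<^sub>0 'k) \<Rightarrow> ('i \<Rightarrow>\<^sub>0 'k)" where
  "free_scale c t = Poly_Mapping.map ((*) c) t"

abbreviation pure :: "'i \<Rightarrow> ('i \<Rightarrow>\<^sub>0 'k::comm_ring_1)" where
  "pure i \<equiv> Poly_Mapping.single i 1"

definition relations2 ::
    "('k::comm_ring_1 \<Rightarrow> 'h::ab_group_add \<Rightarrow> 'h) \<Rightarrow> ('k, 'h) tensor2 set" where
  "relations2 s =
     {pure (x + x', y) - pure (x, y) - pure (x', y) | x x' y. True}
   \<union> {pure (x, y + y') - pure (x, y) - pure (x, y') | x y y'. True}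
   \<union> {pure (s c x, y) - free_scale c (pure (x, y)) | c x y. True}
   \<union> {pure (x, s c y) - free_scale c (pure (x, y)) | c x y. True}"

definition relations3 ::
    "('k::comm_ring_1 \<Rightarrow> 'h::ab_group_add \<Rightarrow> 'h) \<Rightarrow> ('k, 'h) tensor3 set" where
  "relations3 s =
     {pure (x + x', y, z) - pure (x, y, z) - pure (x', y, z) | x x' y z. True}
   \<union> {pure (x, y + y', z) - pure (x, y, z) - pure (x, y', z) | x y y' z. True}
   \<union> {pure (x, y, z + z') - pure (x, y, z) - pure (x, y, z') | x y z z'. True}
   \<union> {pure (s c x, y, z) - free_scale c (pure (x, y, z)) | c x y z. True}
   \<union> {pure (x, s c y, z) - free_scale c (pure (x, y, z)) | c x y z. True}
   \<union> {pure (x, y, s c z) - free_scale c (pure (x, y, z)) | c x y z. True}"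

definition tensor_eq2 ::
    "('k::comm_ring_1 \<Rightarrow> 'h::ab_group_add \<Rightarrow> 'h) \<Rightarrow> ('k, 'h) tensor2 \<Rightarrow> ('k, 'h) tensor2 \<Rightarrow> bool" where
  "tensor_eq2 s t u \<longleftrightarrow> t - u \<in> module.span free_scale (relations2 s)"

definition tensor_eq3 ::
    "('k::comm_ring_1 \<Rightarrow> 'h::ab_group_add \<Rightarrow> 'h) \<Rightarrow> ('k, 'h) tensor3 \<Rightarrow> ('k, 'h) tensor3 \<Rightarrow> bool" where
  "tensor_eq3 s t u \<longleftrightarrow> t - u \<in> module.span free_scale (relations3 s)"

text \<open>
  \<open>tensor_sum s t f\<close> is the Sweedler sum \<open>f t\<^sub>1 t\<^sub>2\<close> (summation suppressed), i.e. the linear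
  extension of \<open>f\<close> evaluated at \<open>t\<close>, with values in a module with scalar multiplication \<open>s\<close>.
  By \<open>tensor_sum_cong\<close> below it is well defined on tensors whenever \<open>f\<close> is bilinear.
\<close>

definition tensor_sum ::
    "('k::comm_ring_1 \<Rightarrow> 'm::ab_group_add \<Rightarrow> 'm) \<Rightarrow> ('k, 'h) tensor2 \<Rightarrow> ('h \<Rightarrow> 'h \<Rightarrow> 'm) \<Rightarrow> 'm" where
  "tensor_sum s t f = (\<Sum>(x, y)\<in>Poly_Mapping.keys t. s (Poly_Mapping.lookup t (x, y)) (f x y))"

definition free_mult :: "('i \<Rightarrow> 'i \<Rightarrow> 'i) \<Rightarrow> ('i \<Rightarrow>\<^sub>0 'k::comm_ring_1) \<Rightarrow> ('i \<Rightarrow>\<^sub>0 'k) \<Rightarrow> ('i \<Rightarrow>\<^sub>0 'k)" where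
  "free_mult m t u = (\<Sum>i\<in>Poly_Mapping.keys t. \<Sum>j\<in>Poly_Mapping.keys u.
     Poly_Mapping.single (m i j) (Poly_Mapping.lookup t i * Poly_Mapping.lookup u j))"

definition mult2 ::
    "('k::comm_ring_1, 'h::ring_1) tensor2 \<Rightarrow> ('k, 'h) tensor2 \<Rightarrow> ('k, 'h) tensor2"
    (infixl \<open>\<odot>\<^sub>2\<close> 70) where
  "t \<odot>\<^sub>2 u = free_mult (\<lambda>(x, y) (x', y'). (x * x', y * y')) t u"

definition mult3 ::
    "('k::comm_ring_1, 'h::ring_1) tensor3 \<Rightarrow> ('k, 'h) tensor3 \<Rightarrow> ('k, 'h) tensor3"
    (infixl \<open>\<odot>\<^sub>3\<close> 70) where
  "t \<odot>\<^sub>3 u = free_mult (\<lambda>(x, y, z) (x', y', z'). (x * x', y * y', z * z')) t u"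

definition flip :: "('k::comm_ring_1, 'h) tensor2 \<Rightarrow> ('k, 'h) tensor2" where
  "flip t = tensor_sum free_scale t (\<lambda>x y. pure (y, x))"

definition leg12 :: "('k::comm_ring_1, 'h::ring_1) tensor2 \<Rightarrow> ('k, 'h) tensor3" where
  "leg12 t = tensor_sum free_scale t (\<lambda>x y. pure (x, y, 1))"

definition leg13 :: "('k::comm_ring_1, 'h::ring_1) tensor2 \<Rightarrow> ('k, 'h) tensor3" where
  "leg13 t = tensor_sum free_scale t (\<lambda>x y. pure (x, 1, y))"

definition leg23 :: "('k::comm_ring_1, 'h::ring_1) tensor2 \<Rightarrow> ('k, 'h) tensor3" where
  "leg23 t = tensor_sum free_scale t (\<lambda>x y. pure (1, x, y))"

definition is_tensor_inverse ::
    "('k::comm_ring_1 \<Rightarrow> 'h::ring_1 \<Rightarrow> 'h) \<Rightarrow> ('k, 'h) tensor2 \<Rightarrow> ('k, 'h) tensor2 \<Rightarrow> bool" where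
  "is_tensor_inverse s t u \<longleftrightarrow>
     tensor_eq2 s (t \<odot>\<^sub>2 u) (pure (1, 1)) \<and> tensor_eq2 s (u \<odot>\<^sub>2 t) (pure (1, 1))"

text \<open>A representative of the inverse; as a tensor it is unique whenever it exists.\<close>

definition tensor_inv ::
    "('k::comm_ring_1 \<Rightarrow> 'h::ring_1 \<Rightarrow> 'h) \<Rightarrow> ('k, 'h) tensor2 \<Rightarrow> ('k, 'h) tensor2" where
  "tensor_inv s t = (SOME u. is_tensor_inverse s t u)"

definition ring_inv :: "'h::ring_1 \<Rightarrow> 'h" where
  "ring_inv b = (THE c. b * c = 1 \<and> c * b = 1)"

lemma lookup_free_scale [simp]:
  "Poly_Mapping.lookup (free_scale c t) i = c * Poly_Mapping.lookup t i"
  by (simp add: free_scale_def map.rep_eq when_def)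

lemma module_free_scale: "module (free_scale :: 'k::comm_ring_1 \<Rightarrow> ('i \<Rightarrow>\<^sub>0 'k) \<Rightarrow> _)"
  by unfold_locales (auto intro!: poly_mapping_eqI simp: lookup_add algebra_simps)

lemma tensor_sum_superset:
  assumes "module s" "finite K" "Poly_Mapping.keys t \<subseteq> K"
  shows "tensor_sum s t f = (\<Sum>(x, y)\<in>K. s (Poly_Mapping.lookup t (x, y)) (f x y))"
  unfolding tensor_sum_def using assms(2,3)
  by (rule sum.mono_neutral_left)
    (auto simp: in_keys_iff module.scale_zero_left[OF assms(1)])

lemma tensor_sum_cong:
  assumes "module sM" "tensor_eq2 s t u"
    and f: "\<And>x. module_hom s sM (f x)" "\<And>y. module_hom s sM (\<lambda>x. f x y)"
  shows "tensor_sum sM t f = tensor_sum sM u f"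
proof -
  interpret M: module sM by fact
  have add: "tensor_sum sM (v + w) f = tensor_sum sM v f + tensor_sum sM w f" for v w
  proof -
    let ?K = "Poly_Mapping.keys v \<union> Poly_Mapping.keys w"
    have "tensor_sum sM (v + w) f =
        (\<Sum>(x, y)\<in>?K. sM (Poly_Mapping.lookup (v + w) (x, y)) (f x y))"
      by (rule tensor_sum_superset[OF assms(1)]) (use Poly_Mapping.keys_add[of v w] in auto)
    also have "\<dots> = (\<Sum>(x, y)\<in>?K. sM (Poly_Mapping.lookup v (x, y)) (f x y)) +
        (\<Sum>(x, y)\<in>?K. sM (Poly_Mapping.lookup w (x, y)) (f x y))"
      by (simp add: lookup_add M.scale_left_distrib case_prod_unfold sum.distrib)
    also have "\<dots> = tensor_sum sM v f + tensor_sum sM w f"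
      by (subst (1 2) tensor_sum_superset[OF assms(1), where K = ?K]) auto
    finally show ?thesis .
  qed
  have scale: "tensor_sum sM (free_scale c v) f = sM c (tensor_sum sM v f)" for c v
    by (subst tensor_sum_superset[OF assms(1), where K = "Poly_Mapping.keys v"])
      (auto simp: in_keys_iff tensor_sum_def case_prod_unfold M.scale_sum_right)
  interpret T: module_hom free_scale sM "\<lambda>v. tensor_sum sM v f"
    by (intro module_hom.intro module_hom_axioms.intro module_free_scale assms(1) add scale)
  have pure: "tensor_sum sM (pure (x, y)) f = f x y" for x y
    by (simp add: tensor_sum_def)
  have "tensor_sum sM v f = 0" if "v \<in> relations2 s" for v
    using that unfolding relations2_def
    by (elim UnE CollectE exE conjE)
      (simp_all only: T.diff T.scale pure f[THEN module_hom.add] f[THEN module_hom.scale],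
        simp_all)
  then have "tensor_sum sM (t - u) f = 0"
    using assms(2) unfolding tensor_eq2_def by (rule T.eq_0_on_span)
  then show ?thesis by (simp add: T.diff)
qed


section \<open>Triangular Hopf algebras and Drinfel'd twists\<close>

text \<open>
  The ring structure of the Hopf algebra is that of the type \<open>'h\<close>; it is not changed by twisting.
\<close>

record (overloaded) ('k, 'h) hopf_data =
  hscale :: "'k \<Rightarrow> 'h \<Rightarrow> 'h"
  coprod :: "'h \<Rightarrow> ('k, 'h) tensor2"
  counit :: "'h \<Rightarrow> 'k"
  antipode :: "'h \<Rightarrow> 'h"
  rmat :: "('k, 'h) tensor2"

abbreviation rmat_inv :: "('k::comm_ring_1, 'h::ring_1) hopf_data \<Rightarrow> ('k, 'h) tensor2" where
  "rmat_inv H \<equiv> tensor_inv (hscale H) (rmat H)"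

definition coprod_left :: "('k::comm_ring_1, 'h::ring_1) hopf_data \<Rightarrow> ('k, 'h) tensor2 \<Rightarrow> ('k, 'h) tensor3" where
  "coprod_left H t = tensor_sum free_scale t
     (\<lambda>x y. tensor_sum free_scale (coprod H x) (\<lambda>x\<^sub>1 x\<^sub>2. pure (x\<^sub>1, x\<^sub>2, y)))"

definition coprod_right :: "('k::comm_ring_1, 'h::ring_1) hopf_data \<Rightarrow> ('k, 'h) tensor2 \<Rightarrow> ('k, 'h) tensor3" where
  "coprod_right H t = tensor_sum free_scale t
     (\<lambda>x y. tensor_sum free_scale (coprod H y) (\<lambda>y\<^sub>1 y\<^sub>2. pure (x, y\<^sub>1, y\<^sub>2)))"

locale hopf_algebra =
  fixes H :: "('k::comm_ring_1, 'h::ring_1) hopf_data"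
  assumes module: "module (hscale H)"
    and scale_mult_left: "hscale H c x * y = hscale H c (x * y)"
    and scale_mult_right: "x * hscale H c y = hscale H c (x * y)"
    and coprod_add: "tensor_eq2 (hscale H) (coprod H (x + y)) (coprod H x + coprod H y)"
    and coprod_scale: "tensor_eq2 (hscale H) (coprod H (hscale H c x)) (free_scale c (coprod H x))"
    and coprod_mult: "tensor_eq2 (hscale H) (coprod H (x * y)) (coprod H x \<odot>\<^sub>2 coprod H y)"
    and coprod_one: "tensor_eq2 (hscale H) (coprod H 1) (pure (1, 1))"
    and counit_add: "counit H (x + y) = counit H x + counit H y"
    and counit_scale: "counit H (hscale H c x) = c * counit H x"
    and counit_mult: "counit H (x * y) = counit H x * counit H y"
    and counit_one: "counit H 1 = 1"
    and coassoc:
      "tensor_eq3 (hscale H) (coprod_left H (coprod H x)) (coprod_right H (coprod H x))"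
    and counit_left: "tensor_sum (hscale H) (coprod H x) (\<lambda>x\<^sub>1 x\<^sub>2. hscale H (counit H x\<^sub>1) x\<^sub>2) = x"
    and counit_right: "tensor_sum (hscale H) (coprod H x) (\<lambda>x\<^sub>1 x\<^sub>2. hscale H (counit H x\<^sub>2) x\<^sub>1) = x"
    and antipode_linear: "module_hom (hscale H) (hscale H) (antipode H)"
    and antipode_left:
      "tensor_sum (hscale H) (coprod H x) (\<lambda>x\<^sub>1 x\<^sub>2. antipode H x\<^sub>1 * x\<^sub>2) = hscale H (counit H x) 1"
    and antipode_right:
      "tensor_sum (hscale H) (coprod H x) (\<lambda>x\<^sub>1 x\<^sub>2. x\<^sub>1 * antipode H x\<^sub>2) = hscale H (counit H x) 1"
    and antipode_bij: "bij (antipode H)"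

locale triangular_hopf_algebra = hopf_algebra +
  assumes rmat_invertible: "\<exists>u. is_tensor_inverse (hscale H) (rmat H) u"
    and rmat_inv_flip: "tensor_eq2 (hscale H) (rmat_inv H) (flip (rmat H))"
    and rmat_coprod:
      "tensor_eq2 (hscale H) (flip (coprod H x)) (rmat H \<odot>\<^sub>2 coprod H x \<odot>\<^sub>2 rmat_inv H)"
    and rmat_left:
      "tensor_eq3 (hscale H) (coprod_left H (rmat H)) (leg13 (rmat H) \<odot>\<^sub>3 leg23 (rmat H))"
    and rmat_right:
      "tensor_eq3 (hscale H) (coprod_right H (rmat H)) (leg13 (rmat H) \<odot>\<^sub>3 leg12 (rmat H))"

definition drinfeld_twist ::
    "('k::comm_ring_1, 'h::ring_1) hopf_data \<Rightarrow> ('k, 'h) tensor2 \<Rightarrow> bool" where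
  "drinfeld_twist H F \<longleftrightarrow>
     (\<exists>u. is_tensor_inverse (hscale H) F u) \<and>
     tensor_eq3 (hscale H) (leg12 F \<odot>\<^sub>3 coprod_left H F) (leg23 F \<odot>\<^sub>3 coprod_right H F) \<and>
     tensor_sum (hscale H) F (\<lambda>x y. hscale H (counit H x) y) = 1 \<and>
     tensor_sum (hscale H) F (\<lambda>x y. hscale H (counit H y) x) = 1"

definition twist_beta :: "('k::comm_ring_1, 'h::ring_1) hopf_data \<Rightarrow> ('k, 'h) tensor2 \<Rightarrow> 'h" where
  "twist_beta H F = tensor_sum (hscale H) F (\<lambda>x y. x * antipode H y)"

definition twist_hopf ::
    "('k::comm_ring_1, 'h::ring_1) hopf_data \<Rightarrow> ('k, 'h) tensor2 \<Rightarrow> ('k, 'h) hopf_data" where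
  "twist_hopf H F = \<lparr>
     hscale = hscale H,
     coprod = (\<lambda>x. F \<odot>\<^sub>2 coprod H x \<odot>\<^sub>2 tensor_inv (hscale H) F),
     counit = counit H,
     antipode = (\<lambda>x. twist_beta H F * antipode H x * ring_inv (twist_beta H F)),
     rmat = flip F \<odot>\<^sub>2 rmat H \<odot>\<^sub>2 tensor_inv (hscale H) F\<rparr>"


section \<open>Braided commutative module algebras\<close>

text \<open>
  The product of \<open>\<A>\<close> is a record component rather than the type class multiplication because
  \<open>\<A>\<close> and its twist have the same underlying module.
\<close>

record (overloaded) ('k, 'h, 'a) algebra_data =
  ascale :: "'k \<Rightarrow> 'a \<Rightarrow> 'a"
  amult :: "'a \<Rightarrow> 'a \<Rightarrow> 'a"
  aone :: 'a
  act :: "'h \<Rightarrow> 'a \<Rightarrow> 'a"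

locale module_algebra =
  fixes H :: "('k::comm_ring_1, 'h::ring_1) hopf_data"
    and A :: "('k, 'h, 'a::ab_group_add) algebra_data"
  assumes amodule: "module (ascale A)"
    and amult_linear_left: "module_hom (ascale A) (ascale A) (\<lambda>a. amult A a b)"
    and amult_linear_right: "module_hom (ascale A) (ascale A) (amult A a)"
    and amult_assoc: "amult A (amult A a b) c = amult A a (amult A b c)"
    and aone_left: "amult A (aone A) a = a"
    and aone_right: "amult A a (aone A) = a"
    and act_linear_left: "module_hom (hscale H) (ascale A) (\<lambda>x. act A x a)"
    and act_linear_right: "module_hom (ascale A) (ascale A) (act A x)"
    and act_mult: "act A (x * y) a = act A x (act A y a)"
    and act_one: "act A 1 a = a"
    and act_amult:
      "act A x (amult A a b) =
         tensor_sum (ascale A) (coprod H x) (\<lambda>x\<^sub>1 x\<^sub>2. amult A (act A x\<^sub>1 a) (act A x\<^sub>2 b))"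
    and act_aone: "act A x (aone A) = ascale A (counit H x) (aone A)"

locale braided_commutative_algebra = module_algebra +
  assumes braided_commutative:
    "amult A b a = tensor_sum (ascale A) (rmat_inv H) (\<lambda>r\<^sub>1 r\<^sub>2. amult A (act A r\<^sub>1 a) (act A r\<^sub>2 b))"

definition twist_algebra ::
    "('k::comm_ring_1, 'h::ring_1) hopf_data \<Rightarrow> ('k, 'h) tensor2 \<Rightarrow>
     ('k, 'h, 'a::ab_group_add) algebra_data \<Rightarrow> ('k, 'h, 'a) algebra_data" where
  "twist_algebra H F A = A\<lparr>amult := (\<lambda>a b. tensor_sum (ascale A) (tensor_inv (hscale H) F)
     (\<lambda>f\<^sub>1 f\<^sub>2. amult A (act A f\<^sub>1 a) (act A f\<^sub>2 b)))\<rparr>"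


section \<open>Braided vector fields\<close>

definition vscale :: "('k, 'h, 'a) algebra_data \<Rightarrow> 'k \<Rightarrow> ('a \<Rightarrow> 'a) \<Rightarrow> 'a \<Rightarrow> 'a" where
  "vscale A c X = (\<lambda>a. ascale A c (X a))"

definition vact ::
    "('k::comm_ring_1, 'h::ring_1) hopf_data \<Rightarrow> ('k, 'h, 'a::ab_group_add) algebra_data \<Rightarrow>
     'h \<Rightarrow> ('a \<Rightarrow> 'a) \<Rightarrow> 'a \<Rightarrow> 'a" where
  "vact H A x X =
     (\<lambda>a. tensor_sum (ascale A) (coprod H x) (\<lambda>x\<^sub>1 x\<^sub>2. act A x\<^sub>1 (X (act A (antipode H x\<^sub>2) a))))"

definition vector_fields ::
    "('k::comm_ring_1, 'h::ring_1) hopf_data \<Rightarrow> ('k, 'h, 'a::ab_group_add) algebra_data \<Rightarrow>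
     ('a \<Rightarrow> 'a) set" where
  "vector_fields H A = {X. module_hom (ascale A) (ascale A) X \<and>
     (\<forall>a b. X (amult A a b) = amult A (X a) b +
        tensor_sum (ascale A) (rmat_inv H) (\<lambda>r\<^sub>1 r\<^sub>2. amult A (act A r\<^sub>1 a) (vact H A r\<^sub>2 X b)))}"

definition lmul :: "('k, 'h, 'a) algebra_data \<Rightarrow> 'a \<Rightarrow> ('a \<Rightarrow> 'a) \<Rightarrow> 'a \<Rightarrow> 'a" where
  "lmul A a X = (\<lambda>b. amult A a (X b))"

definition rmul ::
    "('k::comm_ring_1, 'h::ring_1) hopf_data \<Rightarrow> ('k, 'h, 'a::ab_group_add) algebra_data \<Rightarrow>
     ('a \<Rightarrow> 'a) \<Rightarrow> 'a \<Rightarrow> 'a \<Rightarrow> 'a" where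
  "rmul H A X a =
     tensor_sum (vscale A) (rmat_inv H) (\<lambda>r\<^sub>1 r\<^sub>2. lmul A (act A r\<^sub>1 a) (vact H A r\<^sub>2 X))"

definition braided_commutator ::
    "('k::comm_ring_1, 'h::ring_1) hopf_data \<Rightarrow> ('k, 'h, 'a::ab_group_add) algebra_data \<Rightarrow>
     ('a \<Rightarrow> 'a) \<Rightarrow> ('a \<Rightarrow> 'a) \<Rightarrow> 'a \<Rightarrow> 'a" where
  "braided_commutator H A X Y =
     (X \<circ> Y) - tensor_sum (vscale A) (rmat_inv H) (\<lambda>r\<^sub>1 r\<^sub>2. vact H A r\<^sub>1 Y \<circ> vact H A r\<^sub>2 X)"

text \<open>
  A linear map out of a tensor product of vector fields over the base ring is a bilinear map, and one out of
  the tensor product over \<open>\<A>\<close> is a bilinear map that is moreover \<open>\<A>\<close>-balanced. Only the values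
  on vector fields are meaningful.
\<close>

definition bilinear_on_vector_fields ::
    "('k::comm_ring_1, 'h::ring_1) hopf_data \<Rightarrow> ('k, 'h, 'a::ab_group_add) algebra_data \<Rightarrow>
     ('k \<Rightarrow> 'm::ab_group_add \<Rightarrow> 'm) \<Rightarrow> (('a \<Rightarrow> 'a) \<Rightarrow> ('a \<Rightarrow> 'a) \<Rightarrow> 'm) \<Rightarrow> bool" where
  "bilinear_on_vector_fields H A sM f \<longleftrightarrow>
     (\<forall>X \<in> vector_fields H A. \<forall>Y \<in> vector_fields H A. \<forall>Z \<in> vector_fields H A. \<forall>c.
        f (X + Y) Z = f X Z + f Y Z \<and> f (vscale A c X) Z = sM c (f X Z) \<and>
        f X (Y + Z) = f X Y + f X Z \<and> f X (vscale A c Z) = sM c (f X Z))"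


section \<open>Equivariant covariant derivatives and metrics\<close>

locale equivariant_covariant_derivative =
  fixes H :: "('k::comm_ring_1, 'h::ring_1) hopf_data"
    and A :: "('k, 'h, 'a::ab_group_add) algebra_data"
    and D :: "('a \<Rightarrow> 'a) \<Rightarrow> ('a \<Rightarrow> 'a) \<Rightarrow> 'a \<Rightarrow> 'a"
  assumes D_closed:
      "\<lbrakk>X \<in> vector_fields H A; Y \<in> vector_fields H A\<rbrakk> \<Longrightarrow> D X Y \<in> vector_fields H A"
    and D_bilinear: "bilinear_on_vector_fields H A (vscale A) D"
    and D_equivariant:
      "\<lbrakk>X \<in> vector_fields H A; Y \<in> vector_fields H A\<rbrakk> \<Longrightarrow>
       vact H A x (D X Y) =
         tensor_sum (vscale A) (coprod H x) (\<lambda>x\<^sub>1 x\<^sub>2. D (vact H A x\<^sub>1 X) (vact H A x\<^sub>2 Y))"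
    and D_lmul_left:
      "\<lbrakk>X \<in> vector_fields H A; Y \<in> vector_fields H A\<rbrakk> \<Longrightarrow>
       D (lmul A a X) Y = lmul A a (D X Y)"
    and D_lmul_right:
      "\<lbrakk>X \<in> vector_fields H A; Y \<in> vector_fields H A\<rbrakk> \<Longrightarrow>
       D X (lmul A a Y) = lmul A (X a) Y +
         tensor_sum (vscale A) (rmat_inv H) (\<lambda>r\<^sub>1 r\<^sub>2. lmul A (act A r\<^sub>1 a) (D (vact H A r\<^sub>2 X) Y))"

definition torsion_free ::
    "('k::comm_ring_1, 'h::ring_1) hopf_data \<Rightarrow> ('k, 'h, 'a::ab_group_add) algebra_data \<Rightarrow>
     (('a \<Rightarrow> 'a) \<Rightarrow> ('a \<Rightarrow> 'a) \<Rightarrow> 'a \<Rightarrow> 'a) \<Rightarrow> bool" where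
  "torsion_free H A D \<longleftrightarrow>
     (\<forall>X \<in> vector_fields H A. \<forall>Y \<in> vector_fields H A.
        D X Y - tensor_sum (vscale A) (rmat_inv H) (\<lambda>r\<^sub>1 r\<^sub>2. D (vact H A r\<^sub>1 Y) (vact H A r\<^sub>2 X))
          - braided_commutator H A X Y = 0)"

locale equivariant_metric =
  fixes H :: "('k::comm_ring_1, 'h::ring_1) hopf_data"
    and A :: "('k, 'h, 'a::ab_group_add) algebra_data"
    and g :: "('a \<Rightarrow> 'a) \<Rightarrow> ('a \<Rightarrow> 'a) \<Rightarrow> 'a"
  assumes g_bilinear: "bilinear_on_vector_fields H A (ascale A) g"
    and g_balanced:
      "\<lbrakk>X \<in> vector_fields H A; Y \<in> vector_fields H A\<rbrakk> \<Longrightarrow> g (rmul H A X a) Y = g X (lmul A a Y)"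
    and g_lmul:
      "\<lbrakk>X \<in> vector_fields H A; Y \<in> vector_fields H A\<rbrakk> \<Longrightarrow> g (lmul A a X) Y = amult A a (g X Y)"
    and g_equivariant:
      "\<lbrakk>X \<in> vector_fields H A; Y \<in> vector_fields H A\<rbrakk> \<Longrightarrow>
       act A x (g X Y) =
         tensor_sum (ascale A) (coprod H x) (\<lambda>x\<^sub>1 x\<^sub>2. g (vact H A x\<^sub>1 X) (vact H A x\<^sub>2 Y))"
    and g_braided_symmetric:
      "\<lbrakk>X \<in> vector_fields H A; Y \<in> vector_fields H A\<rbrakk> \<Longrightarrow>
       g Y X = tensor_sum (ascale A) (rmat_inv H) (\<lambda>r\<^sub>1 r\<^sub>2. g (vact H A r\<^sub>1 X) (vact H A r\<^sub>2 Y))"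

definition non_degenerate ::
    "('k::comm_ring_1, 'h::ring_1) hopf_data \<Rightarrow> ('k, 'h, 'a::ab_group_add) algebra_data \<Rightarrow>
     (('a \<Rightarrow> 'a) \<Rightarrow> ('a \<Rightarrow> 'a) \<Rightarrow> 'a) \<Rightarrow> bool" where
  "non_degenerate H A g \<longleftrightarrow>
     (\<forall>X \<in> vector_fields H A. (\<forall>Y \<in> vector_fields H A. g X Y = 0) \<longrightarrow> X = 0)"

definition metric_derivative ::
    "('k::comm_ring_1, 'h::ring_1) hopf_data \<Rightarrow> ('k, 'h, 'a::ab_group_add) algebra_data \<Rightarrow>
     (('a \<Rightarrow> 'a) \<Rightarrow> ('a \<Rightarrow> 'a) \<Rightarrow> 'a) \<Rightarrow> (('a \<Rightarrow> 'a) \<Rightarrow> ('a \<Rightarrow> 'a) \<Rightarrow> 'a \<Rightarrow> 'a) \<Rightarrow> bool" where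
  "metric_derivative H A g D \<longleftrightarrow>
     (\<forall>X \<in> vector_fields H A. \<forall>Y \<in> vector_fields H A. \<forall>Z \<in> vector_fields H A.
        X (g Y Z) = g (D X Y) Z +
          tensor_sum (ascale A) (rmat_inv H) (\<lambda>r\<^sub>1 r\<^sub>2. g (vact H A r\<^sub>1 Y) (D (vact H A r\<^sub>2 X) Z)))"

definition torsion_free_metric_derivative ::
    "('k::comm_ring_1, 'h::ring_1) hopf_data \<Rightarrow> ('k, 'h, 'a::ab_group_add) algebra_data \<Rightarrow>
     (('a \<Rightarrow> 'a) \<Rightarrow> ('a \<Rightarrow> 'a) \<Rightarrow> 'a) \<Rightarrow> (('a \<Rightarrow> 'a) \<Rightarrow> ('a \<Rightarrow> 'a) \<Rightarrow> 'a \<Rightarrow> 'a) \<Rightarrow> bool" where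
  "torsion_free_metric_derivative H A g D \<longleftrightarrow>
     equivariant_covariant_derivative H A D \<and> torsion_free H A D \<and> metric_derivative H A g D"

text \<open>Uniqueness refers to values on vector fields only; values elsewhere are junk.\<close>

definition levi_civita ::
    "('k::comm_ring_1, 'h::ring_1) hopf_data \<Rightarrow> ('k, 'h, 'a::ab_group_add) algebra_data \<Rightarrow>
     (('a \<Rightarrow> 'a) \<Rightarrow> ('a \<Rightarrow> 'a) \<Rightarrow> 'a) \<Rightarrow> (('a \<Rightarrow> 'a) \<Rightarrow> ('a \<Rightarrow> 'a) \<Rightarrow> 'a \<Rightarrow> 'a) \<Rightarrow> bool" where
  "levi_civita H A g D \<longleftrightarrow>
     torsion_free_metric_derivative H A g D \<and>
     (\<forall>D'. torsion_free_metric_derivative H A g D' \<longrightarrow>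
        (\<forall>X \<in> vector_fields H A. \<forall>Y \<in> vector_fields H A. D' X Y = D X Y))"


section \<open>Twisting metrics and covariant derivatives\<close>

definition twist_metric ::
    "('k::comm_ring_1, 'h::ring_1) hopf_data \<Rightarrow> ('k, 'h) tensor2 \<Rightarrow>
     ('k, 'h, 'a::ab_group_add) algebra_data \<Rightarrow>
     (('a \<Rightarrow> 'a) \<Rightarrow> ('a \<Rightarrow> 'a) \<Rightarrow> 'a) \<Rightarrow> ('a \<Rightarrow> 'a) \<Rightarrow> ('a \<Rightarrow> 'a) \<Rightarrow> 'a" where
  "twist_metric H F A g X Y =
     tensor_sum (ascale A) (tensor_inv (hscale H) F) (\<lambda>f\<^sub>1 f\<^sub>2. g (vact H A f\<^sub>1 X) (vact H A f\<^sub>2 Y))"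

definition twist_derivative ::
    "('k::comm_ring_1, 'h::ring_1) hopf_data \<Rightarrow> ('k, 'h) tensor2 \<Rightarrow>
     ('k, 'h, 'a::ab_group_add) algebra_data \<Rightarrow>
     (('a \<Rightarrow> 'a) \<Rightarrow> ('a \<Rightarrow> 'a) \<Rightarrow> 'a \<Rightarrow> 'a) \<Rightarrow> ('a \<Rightarrow> 'a) \<Rightarrow> ('a \<Rightarrow> 'a) \<Rightarrow> 'a \<Rightarrow> 'a" where
  "twist_derivative H F A D X Y =
     tensor_sum (vscale A) (tensor_inv (hscale H) F) (\<lambda>f\<^sub>1 f\<^sub>2. D (vact H A f\<^sub>1 X) (vact H A f\<^sub>2 Y))"

text \<open>
  The isomorphism \<open>X \<mapsto> X\<^sup>\<F>\<close> from the vector fields of \<open>\<A>\<close> onto those of the twisted algebra,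
  its inverse, and the transport of metrics and covariant derivatives along it.
\<close>

definition twist_field ::
    "('k::comm_ring_1, 'h::ring_1) hopf_data \<Rightarrow> ('k, 'h) tensor2 \<Rightarrow>
     ('k, 'h, 'a::ab_group_add) algebra_data \<Rightarrow> ('a \<Rightarrow> 'a) \<Rightarrow> 'a \<Rightarrow> 'a" where
  "twist_field H F A X =
     (\<lambda>a. tensor_sum (ascale A) (tensor_inv (hscale H) F) (\<lambda>f\<^sub>1 f\<^sub>2. vact H A f\<^sub>1 X (act A f\<^sub>2 a)))"

definition untwist_field ::
    "('k::comm_ring_1, 'h::ring_1) hopf_data \<Rightarrow> ('k, 'h) tensor2 \<Rightarrow>
     ('k, 'h, 'a::ab_group_add) algebra_data \<Rightarrow> ('a \<Rightarrow> 'a) \<Rightarrow> 'a \<Rightarrow> 'a" where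
  "untwist_field H F A = inv_into (vector_fields H A) (twist_field H F A)"

definition transport_metric ::
    "('k::comm_ring_1, 'h::ring_1) hopf_data \<Rightarrow> ('k, 'h) tensor2 \<Rightarrow>
     ('k, 'h, 'a::ab_group_add) algebra_data \<Rightarrow>
     (('a \<Rightarrow> 'a) \<Rightarrow> ('a \<Rightarrow> 'a) \<Rightarrow> 'a) \<Rightarrow> ('a \<Rightarrow> 'a) \<Rightarrow> ('a \<Rightarrow> 'a) \<Rightarrow> 'a" where
  "transport_metric H F A g U V = g (untwist_field H F A U) (untwist_field H F A V)"

definition transport_derivative ::
    "('k::comm_ring_1, 'h::ring_1) hopf_data \<Rightarrow> ('k, 'h) tensor2 \<Rightarrow>
     ('k, 'h, 'a::ab_group_add) algebra_data \<Rightarrow>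
     (('a \<Rightarrow> 'a) \<Rightarrow> ('a \<Rightarrow> 'a) \<Rightarrow> 'a \<Rightarrow> 'a) \<Rightarrow> ('a \<Rightarrow> 'a) \<Rightarrow> ('a \<Rightarrow> 'a) \<Rightarrow> 'a \<Rightarrow> 'a" where
  "transport_derivative H F A D U V =
     twist_field H F A (D (untwist_field H F A U) (untwist_field H F A V))"

end

theory Submission
  imports Defs
begin

text \<open>
  Twisting is a monoidal equivalence. Write \<open>\<phi>\<^sub>\<F>(v, w) = \<phi>(\<F>\<^sub>1\<^sup>-\<^sup>1 v, \<F>\<^sub>2\<^sup>-\<^sup>1 w)\<close> for a bilinear map
  \<open>\<phi>\<close> of \<open>H\<close>-modules. Every axiom for the metric and the covariant derivative is an identity between
  trilinear maps of the form \<open>\<psi>(\<phi>(v, w), z)\<close> or \<open>\<psi>(v, \<phi>(w, z))\<close> with equivariant \<open>\<phi>\<close>, up to a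
  braiding of \<open>v\<close> and \<open>w\<close>. By the cocycle condition both \<open>\<psi>\<^sub>\<F>(\<phi>\<^sub>\<F>(v, w), z)\<close> and
  \<open>\<psi>\<^sub>\<F>(v, \<phi>\<^sub>\<F>(w, z))\<close> arise by acting with the inverse of \<open>(\<F> \<otimes> 1) (\<Delta> \<otimes> id)(\<F>)\<close> on the three
  arguments, and the braidings match since \<open>\<R>\<^sub>\<F>\<^sup>-\<^sup>1 = \<F> \<R>\<^sup>-\<^sup>1 \<F>\<^sub>2\<^sub>1\<^sup>-\<^sup>1\<close>. As that action is
  invertible, an identity holds if and only if the twisted one does; the \<open>if\<close> part transports a competitor
  for the twisted Levi-Civita derivative back to \<open>\<A>\<close>, where uniqueness applies.

  The map \<open>X \<mapsto> X\<^sup>\<F>\<close> is \<open>X\<^sup>\<F>(a) = \<F>\<^sub>1 X(S(\<F>\<^sub>2) \<beta>\<^sup>-\<^sup>1 a)\<close>, with inverse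
  \<open>Z \<mapsto> (a \<mapsto> \<F>\<^sub>1\<^sup>-\<^sup>1 Z(\<beta> S(\<F>\<^sub>2\<^sup>-\<^sup>1) a))\<close>.
\<close>

section \<open>Sweedler sums\<close>

text \<open>Tensors are representatives, equal only modulo a span of relations. A Sweedler identity
  can therefore be used under a sum only when the summand is multilinear in the elements of H
  involved, and most rewriting steps leave such linearity goals.

  Merging two nested twists needs equivariance of the inner map. A covariant derivative is itself an
  inner map in its own axioms and in metricity, so a competitor for the twisted Levi-Civita
  derivative is pulled back as a merely bilinear map. Its equivariance has to be deduced from the
  twisted one before the other axioms can be compared.

  Vector fields raise a further obstacle: the twist of a map at (X, a) involves all fields x X,
  whereas being a derivation is a property of X alone. The formula for X^F removes this mixing. It
  arises from phi(x v, w) = x_1 phi(v, S(x_2) w), which takes the action off the field, and from an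
  identity that turns the resulting sum over F^-1 into F_1 and S(F_2) beta^-1. It is used for the
  evaluation of fields and for the defect of the Leibniz rule.\<close>

definition fsum :: "('k::comm_ring_1 \<Rightarrow> 'm::ab_group_add \<Rightarrow> 'm) \<Rightarrow> ('i \<Rightarrow>\<^sub>0 'k) \<Rightarrow> ('i \<Rightarrow> 'm) \<Rightarrow> 'm" where
  "fsum s t f = (\<Sum>i\<in>Poly_Mapping.keys t. s (Poly_Mapping.lookup t i) (f i))"

lemma tensor_sum_eq_fsum: "tensor_sum s t f = fsum s t (\<lambda>(x, y). f x y)"
  by (simp add: tensor_sum_def fsum_def case_prod_unfold)

lemma fsum_superset:
  assumes "module s" "finite K" "Poly_Mapping.keys t \<subseteq> K"
  shows "fsum s t f = (\<Sum>i\<in>K. s (Poly_Mapping.lookup t i) (f i))"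
  unfolding fsum_def using assms(2,3)
  by (rule sum.mono_neutral_left) (auto simp: in_keys_iff module.scale_zero_left[OF assms(1)])

lemma module_hom_fsum:
  assumes "module s"
  shows "module_hom free_scale s (\<lambda>t. fsum s t f)"
proof -
  interpret module s by fact
  have add: "fsum s (v + w) f = fsum s v f + fsum s w f" for v w
  proof -
    let ?K = "Poly_Mapping.keys v \<union> Poly_Mapping.keys w"
    have "fsum s (v + w) f = (\<Sum>i\<in>?K. s (Poly_Mapping.lookup (v + w) i) (f i))"
      by (rule fsum_superset[OF assms]) (use Poly_Mapping.keys_add[of v w] in auto)
    also have "\<dots> = (\<Sum>i\<in>?K. s (Poly_Mapping.lookup v i) (f i)) + (\<Sum>i\<in>?K. s (Poly_Mapping.lookup w i) (f i))"
      by (simp add: lookup_add scale_left_distrib sum.distrib)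
    also have "\<dots> = fsum s v f + fsum s w f"
      by (subst (1 2) fsum_superset[OF assms, where K = ?K]) auto
    finally show ?thesis .
  qed
  have scale: "fsum s (free_scale c v) f = s c (fsum s v f)" for c v
    by (subst fsum_superset[OF assms, where K = "Poly_Mapping.keys v"])
      (auto simp: in_keys_iff fsum_def scale_sum_right)
  show ?thesis
    by (intro module_hom.intro module_hom_axioms.intro module_free_scale assms add scale)
qed

lemma fsum_single: "module s \<Longrightarrow> fsum s (Poly_Mapping.single i c) f = s c (f i)"
  by (simp add: fsum_superset[of s "{i}"] module.scale_zero_left)

lemma fsum_pure [simp]: "module s \<Longrightarrow> fsum s (pure i) f = f i"
  by (simp add: fsum_single module.scale_one)

lemma fsum_sum: "module s \<Longrightarrow> fsum s (sum t I) f = (\<Sum>i\<in>I. fsum s (t i) f)"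
  by (rule module_hom.sum[OF module_hom_fsum])

lemma fsum_fsum:
  assumes "module s"
  shows "fsum s (fsum free_scale t g) f = fsum s t (\<lambda>i. fsum s (g i) f)"
  by (simp add: fsum_def[of free_scale] fsum_def[of s t] fsum_sum[OF assms]
      module_hom.scale[OF module_hom_fsum[OF assms]])

lemma fsum_free_mult:
  assumes "module s"
  shows "fsum s (free_mult m t u) f = fsum s t (\<lambda>i. fsum s u (\<lambda>j. f (m i j)))"
proof -
  interpret module s by fact
  show ?thesis
    by (simp add: free_mult_def fsum_sum[OF assms] fsum_single[OF assms] fsum_def[of s t]
        fsum_def[of s u] scale_sum_right)
qed

text \<open>Evaluation at \<open>pure\<close> loses nothing, so two formal combinations can be
  proved equal by computing \<open>fsum free_scale _ pure\<close> on both sides. Associativity of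
  products and their compatibility with \<open>flip\<close> are obtained this way and hold for
  representatives, not merely modulo relations.\<close>

lemma fsum_reconstruct: "fsum free_scale t pure = t"
  by (rule poly_mapping_eqI)
    (auto simp: fsum_def lookup_sum lookup_single when_def in_keys_iff if_distrib[of "(*) _"]
      sum.delta cong: if_cong)

lemma fsum_swap:
  assumes "module s"
  shows "fsum s t (\<lambda>i. fsum s u (\<lambda>j. f i j)) = fsum s u (\<lambda>j. fsum s t (\<lambda>i. f i j))"
proof -
  interpret module s by fact
  show ?thesis
    unfolding fsum_def scale_sum_right
    by (subst sum.swap) (simp add: scale_scale mult.commute)
qed

lemma free_mult_assoc:
  assumes "\<And>i j l. m (m i j) l = m i (m j l)"
  shows "free_mult m (free_mult m t u) v = free_mult m t (free_mult m u v)"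
proof -
  have "fsum free_scale (free_mult m (free_mult m t u) v) pure
      = fsum free_scale (free_mult m t (free_mult m u v)) pure"
    by (simp add: fsum_free_mult[OF module_free_scale] assms)
  then show ?thesis by (simp add: fsum_reconstruct)
qed

lemma mult2_assoc: "(t \<odot>\<^sub>2 u) \<odot>\<^sub>2 v = t \<odot>\<^sub>2 (u \<odot>\<^sub>2 v)"
  unfolding mult2_def by (rule free_mult_assoc) (auto simp: mult.assoc)

lemma tensor_sum_mult2:
  assumes "module s"
  shows "tensor_sum s (t \<odot>\<^sub>2 u) f = tensor_sum s t (\<lambda>x y. tensor_sum s u (\<lambda>x' y'. f (x * x') (y * y')))"
  by (simp add: tensor_sum_eq_fsum mult2_def fsum_free_mult[OF assms] case_prod_unfold)

lemma tensor_sum_pure [simp]: "module s \<Longrightarrow> tensor_sum s (pure (x, y)) f = f x y"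
  by (simp add: tensor_sum_eq_fsum)

lemma tensor_sum_flip:
  assumes "module s"
  shows "tensor_sum s (flip t) f = tensor_sum s t (\<lambda>x y. f y x)"
  by (simp add: tensor_sum_eq_fsum flip_def fsum_fsum[OF assms] case_prod_unfold assms)

lemma tensor_sum_swap:
  assumes "module s"
  shows "tensor_sum s t (\<lambda>x y. tensor_sum s u (\<lambda>z w. f x y z w))
    = tensor_sum s u (\<lambda>z w. tensor_sum s t (\<lambda>x y. f x y z w))"
  using fsum_swap[OF assms, of t u "\<lambda>i j. f (fst i) (snd i) (fst j) (snd j)"]
  by (simp add: tensor_sum_eq_fsum case_prod_unfold)

lemma tensor_sum_add:
  "module s \<Longrightarrow> tensor_sum s t (\<lambda>x y. f x y + g x y) = tensor_sum s t f + tensor_sum s t g"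
  by (simp add: tensor_sum_def case_prod_unfold module.scale_right_distrib sum.distrib)

lemma tensor_sum_diff:
  "module s \<Longrightarrow> tensor_sum s t (\<lambda>x y. f x y - g x y) = tensor_sum s t f - tensor_sum s t g"
  by (simp add: tensor_sum_def case_prod_unfold module.scale_right_diff_distrib sum_subtractf)

lemma tensor_sum_scale:
  "module s \<Longrightarrow> tensor_sum s t (\<lambda>x y. s c (f x y)) = s c (tensor_sum s t f)"
  by (simp add: tensor_sum_def case_prod_unfold module.scale_sum_right module.scale_scale mult.commute)

lemma tensor_sum_zero [simp]: "module s \<Longrightarrow> tensor_sum s t (\<lambda>x y. 0) = 0"
  by (simp add: tensor_sum_def case_prod_unfold module.scale_zero_right)

lemma tensor_sum_plus_tensor:
  "module s \<Longrightarrow> tensor_sum s (t + u) f = tensor_sum s t f + tensor_sum s u f"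
  using module_hom.add[OF module_hom_fsum] by (force simp: tensor_sum_eq_fsum)

lemma tensor_sum_free_scale:
  "module s \<Longrightarrow> tensor_sum s (free_scale c t) f = s c (tensor_sum s t f)"
  using module_hom.scale[OF module_hom_fsum] by (force simp: tensor_sum_eq_fsum)

lemma tensor_sum_closed:
  assumes "module.subspace s V" "module s" "\<And>x y. f x y \<in> V"
  shows "tensor_sum s t f \<in> V"
  unfolding tensor_sum_def case_prod_unfold
  by (intro module.subspace_sum[OF assms(2,1)] module.subspace_scale[OF assms(2,1)] assms(3))

text \<open>Metrics and covariant derivatives are linear on vector fields and arbitrary elsewhere,
  so linearity is asked for only on a submodule \<open>V\<close> that contains every term.\<close>

lemma hom_tensor_sum_on:
  assumes "module s" "module s'" "module.subspace s V"
    and "\<And>v w. v \<in> V \<Longrightarrow> w \<in> V \<Longrightarrow> \<phi> (v + w) = \<phi> v + \<phi> w"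
    and "\<And>c v. v \<in> V \<Longrightarrow> \<phi> (s c v) = s' c (\<phi> v)"
    and f: "\<And>x y. f x y \<in> V"
  shows "\<phi> (tensor_sum s t f) = tensor_sum s' t (\<lambda>x y. \<phi> (f x y))"
proof -
  interpret S: module s by fact
  interpret S': module s' by fact
  have 0: "\<phi> 0 = 0" using assms(5)[of 0 0] S.subspace_0[OF assms(3)] by simp
  have "\<phi> (\<Sum>p\<in>K. s (c p) (f (fst p) (snd p))) = (\<Sum>p\<in>K. s' (c p) (\<phi> (f (fst p) (snd p))))"
    if "finite K" for K c
    using that
  proof induction
    case (insert p K)
    have "s (c q) (f (fst q) (snd q)) \<in> V" for q
      by (rule S.subspace_scale[OF assms(3) f])
    with insert show ?case
      by (simp add: assms(4,5) f S.subspace_sum[OF assms(3)])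
  qed (simp add: 0)
  then show ?thesis by (simp add: tensor_sum_def case_prod_unfold)
qed

lemma hom_tensor_sum:
  "module_hom s s' \<phi> \<Longrightarrow> \<phi> (tensor_sum s t f) = tensor_sum s' t (\<lambda>x y. \<phi> (f x y))"
  by (rule hom_tensor_sum_on[where V = UNIV])
    (auto simp: module_hom.add module_hom.scale module_hom_def module.subspace_UNIV)

section \<open>Sums over threefold tensors\<close>

definition tensor_sum3 ::
    "('k::comm_ring_1 \<Rightarrow> 'm::ab_group_add \<Rightarrow> 'm) \<Rightarrow> ('k, 'h) tensor3 \<Rightarrow> ('h \<Rightarrow> 'h \<Rightarrow> 'h \<Rightarrow> 'm) \<Rightarrow> 'm" where
  "tensor_sum3 s t f = fsum s t (\<lambda>(x, y, z). f x y z)"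

lemma tensor_sum3_cong:
  assumes "module sM" "tensor_eq3 s t u"
    and f: "\<And>y z. module_hom s sM (\<lambda>x. f x y z)" "\<And>x z. module_hom s sM (\<lambda>y. f x y z)"
      "\<And>x y. module_hom s sM (\<lambda>z. f x y z)"
  shows "tensor_sum3 sM t f = tensor_sum3 sM u f"
proof -
  interpret T: module_hom free_scale sM "\<lambda>v. tensor_sum3 sM v f"
    unfolding tensor_sum3_def by (rule module_hom_fsum[OF assms(1)])
  have pure: "tensor_sum3 sM (pure (x, y, z)) f = f x y z" for x y z
    by (simp add: tensor_sum3_def assms(1))
  have "tensor_sum3 sM v f = 0" if "v \<in> relations3 s" for v
    using that unfolding relations3_def
    by (elim UnE CollectE exE conjE)
      (simp_all only: T.diff T.scale pure f[THEN module_hom.add] f[THEN module_hom.scale],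
        simp_all)
  then have "tensor_sum3 sM (t - u) f = 0"
    using assms(2) unfolding tensor_eq3_def by (rule T.eq_0_on_span)
  then show ?thesis by (simp add: T.diff)
qed

lemma tensor_sum3_mult3:
  "module s \<Longrightarrow> tensor_sum3 s (t \<odot>\<^sub>3 u) f =
    tensor_sum3 s t (\<lambda>x y z. tensor_sum3 s u (\<lambda>x' y' z'. f (x * x') (y * y') (z * z')))"
  by (simp add: tensor_sum3_def mult3_def fsum_free_mult case_prod_unfold)

lemma tensor_sum3_leg:
  assumes "module s"
  shows "tensor_sum3 s (leg12 t) f = tensor_sum s t (\<lambda>x y. f x y 1)"
    "tensor_sum3 s (leg13 t) f = tensor_sum s t (\<lambda>x y. f x 1 y)"
    "tensor_sum3 s (leg23 t) f = tensor_sum s t (\<lambda>x y. f 1 x y)"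
  by (simp_all add: tensor_sum3_def leg12_def leg13_def leg23_def tensor_sum_eq_fsum
      fsum_fsum[OF assms] case_prod_unfold assms)

lemma tensor_sum3_coprod:
  assumes "module s"
  shows "tensor_sum3 s (coprod_left H t) f =
      tensor_sum s t (\<lambda>x y. tensor_sum s (coprod H x) (\<lambda>x\<^sub>1 x\<^sub>2. f x\<^sub>1 x\<^sub>2 y))"
    "tensor_sum3 s (coprod_right H t) f =
      tensor_sum s t (\<lambda>x y. tensor_sum s (coprod H y) (\<lambda>y\<^sub>1 y\<^sub>2. f x y\<^sub>1 y\<^sub>2))"
  by (simp_all add: tensor_sum3_def coprod_left_def coprod_right_def tensor_sum_eq_fsum
      fsum_fsum[OF assms] case_prod_unfold assms)

section \<open>Equality of tensors\<close>

lemma tensor_eq2_refl: "tensor_eq2 s t t"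
  by (simp add: tensor_eq2_def module.span_zero[OF module_free_scale])

lemma tensor_eq2_sym: "tensor_eq2 s t u \<Longrightarrow> tensor_eq2 s u t"
  unfolding tensor_eq2_def using module.span_neg[OF module_free_scale] by fastforce

lemma tensor_eq2_trans [trans]: "tensor_eq2 s t u \<Longrightarrow> tensor_eq2 s u v \<Longrightarrow> tensor_eq2 s t v"
  unfolding tensor_eq2_def using module.span_add[OF module_free_scale] by fastforce

text \<open>The span is reached from its generators by induction, so compatibility of
  \<open>L\<close> with equality of tensors has to be checked on single relations only.\<close>

lemma tensor_eq2_map:
  assumes "module_hom free_scale free_scale L" "tensor_eq2 s t u"
    and "\<And>r. r \<in> relations2 s \<Longrightarrow> L r \<in> module.span free_scale (relations2 s)"
  shows "tensor_eq2 s (L t) (L u)"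
proof -
  interpret L: module_hom free_scale free_scale L by fact
  have "L v \<in> module.span free_scale (relations2 s)" if "v \<in> module.span free_scale (relations2 s)" for v
    using that
  proof (induction rule: L.m1.span_induct_alt)
    case (step c x y)
    then show ?case
      using assms(3) by (simp add: L.add L.scale L.m1.span_add L.m1.span_scale)
  qed (simp add: L.m1.span_zero)
  then show ?thesis
    using assms(2) by (simp add: tensor_eq2_def flip: L.diff)
qed

lemma module_hom_free_mult:
  "module_hom free_scale free_scale (\<lambda>t. free_mult m t u)"
  "module_hom free_scale free_scale (\<lambda>u. free_mult m t u)"
proof -
  note mf = module_free_scale
  have 1: "free_mult m t u = fsum free_scale t (\<lambda>i. fsum free_scale u (\<lambda>j. pure (m i j)))" for t u
    using fsum_free_mult[OF mf, of m t u pure] by (simp add: fsum_reconstruct)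
  show "module_hom free_scale free_scale (\<lambda>t. free_mult m t u)"
    unfolding 1 by (rule module_hom_fsum[OF mf])
  have 2: "free_mult m t u = fsum free_scale u (\<lambda>j. fsum free_scale t (\<lambda>i. pure (m i j)))" for t u
    unfolding 1 by (rule fsum_swap[OF mf])
  show "module_hom free_scale free_scale (\<lambda>u. free_mult m t u)"
    unfolding 2 by (rule module_hom_fsum[OF mf])
qed

lemma flip_mult2: "flip (t \<odot>\<^sub>2 u) = flip t \<odot>\<^sub>2 flip u"
proof -
  note mf = module_free_scale
  have "fsum free_scale (flip (t \<odot>\<^sub>2 u)) pure = fsum free_scale (flip t \<odot>\<^sub>2 flip u) pure"
    by (simp add: mult2_def flip_def tensor_sum_eq_fsum fsum_fsum[OF mf] fsum_free_mult[OF mf]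
        case_prod_unfold mf)
  then show ?thesis by (simp add: fsum_reconstruct)
qed

lemma tensor_eq2_flip:
  fixes t u :: "('x::comm_ring_1, 'y::ab_group_add) tensor2"
  assumes "tensor_eq2 s t u"
  shows "tensor_eq2 s (flip t) (flip u)"
proof (rule tensor_eq2_map[OF _ assms])
  show hom: "module_hom free_scale free_scale (flip :: ('x::comm_ring_1, 'y) tensor2 \<Rightarrow> _)"
    unfolding flip_def[abs_def] tensor_sum_eq_fsum by (rule module_hom_fsum[OF module_free_scale])
  fix r :: "('x, 'y) tensor2"
  assume "r \<in> relations2 s"
  moreover have p: "flip (pure (x, y)) = pure (y, x)" for x y
    by (simp add: flip_def module_free_scale)
  ultimately have "flip r \<in> relations2 s"
    unfolding relations2_def
    by (elim UnE CollectE exE conjE)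
     (simp_all only: module_hom.diff[OF hom] module_hom.scale[OF hom] p, blast+)
  then show "flip r \<in> module.span free_scale (relations2 s)"
    by (rule module.span_base[OF module_free_scale])
qed

context hopf_algebra
begin

text \<open>Multiplication by a pure tensor turns a relation into another relation of the same kind,
  because multiplication in \<open>H\<close> is bilinear. Hence the relations span a two-sided
  ideal.\<close>

lemma relations2_mult_pure:
  assumes r: "r \<in> relations2 (hscale H)"
  shows "r \<odot>\<^sub>2 pure (a, b) \<in> relations2 (hscale H)" "pure (a, b) \<odot>\<^sub>2 r \<in> relations2 (hscale H)"
proof -
  let ?m = "\<lambda>(x::'h, y::'h) (x', y'). (x * x', y * y')"
  interpret L: module_hom free_scale free_scale "\<lambda>t. free_mult ?m t (pure (a, b) :: ('k, 'h) tensor2)"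
    by (rule module_hom_free_mult)
  interpret R: module_hom free_scale free_scale "\<lambda>t. free_mult ?m (pure (a, b) :: ('k, 'h) tensor2) t"
    by (rule module_hom_free_mult)
  have p: "free_mult ?m (pure (x, y)) (pure (x', y')) = pure (x * x', y * y')" for x y x' y'
    by (simp add: free_mult_def)
  show "r \<odot>\<^sub>2 pure (a, b) \<in> relations2 (hscale H)"
    using r unfolding relations2_def mult2_def
    by (elim UnE CollectE exE conjE)
      (simp_all only: L.diff L.scale p distrib_right scale_mult_left, blast+)
  show "pure (a, b) \<odot>\<^sub>2 r \<in> relations2 (hscale H)"
    using r unfolding relations2_def mult2_def
    by (elim UnE CollectE exE conjE)
      (simp_all only: R.diff R.scale p distrib_left scale_mult_right, blast+)
qed

text \<open>Every factor is a combination of pure tensors, so the span of relations absorbs it; the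
  two factors are then replaced one at a time.\<close>

lemma tensor_eq2_mult:
  assumes t: "tensor_eq2 (hscale H) t t'" and u: "tensor_eq2 (hscale H) u u'"
  shows "tensor_eq2 (hscale H) (t \<odot>\<^sub>2 u) (t' \<odot>\<^sub>2 u')"
proof -
  let ?R = "module.span free_scale (relations2 (hscale H))"
  interpret mf: module "free_scale :: 'k \<Rightarrow> ('h \<times> 'h \<Rightarrow>\<^sub>0 'k) \<Rightarrow> _" by (rule module_free_scale)
  have 1: "r \<odot>\<^sub>2 v \<in> ?R" if "r \<in> relations2 (hscale H)" for r v
  proof -
    interpret module_hom free_scale free_scale "\<lambda>t. r \<odot>\<^sub>2 t"
      unfolding mult2_def by (rule module_hom_free_mult)
    have "r \<odot>\<^sub>2 fsum free_scale v pure \<in> ?R"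
      unfolding fsum_def sum scale
      by (intro mf.span_sum mf.span_scale) (metis mf.span_base relations2_mult_pure(1)[OF that] surj_pair)
    then show ?thesis by (simp add: fsum_reconstruct)
  qed
  have 2: "v \<odot>\<^sub>2 r \<in> ?R" if "r \<in> relations2 (hscale H)" for r v
  proof -
    interpret module_hom free_scale free_scale "\<lambda>t. t \<odot>\<^sub>2 r"
      unfolding mult2_def by (rule module_hom_free_mult)
    have "fsum free_scale v pure \<odot>\<^sub>2 r \<in> ?R"
      unfolding fsum_def sum scale
      by (intro mf.span_sum mf.span_scale) (metis mf.span_base relations2_mult_pure(2)[OF that] surj_pair)
    then show ?thesis by (simp add: fsum_reconstruct)
  qed
  have "tensor_eq2 (hscale H) (t \<odot>\<^sub>2 u) (t' \<odot>\<^sub>2 u)"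
    by (rule tensor_eq2_map[OF _ t]) (auto simp: mult2_def intro: module_hom_free_mult 1[unfolded mult2_def])
  also have "tensor_eq2 (hscale H) (t' \<odot>\<^sub>2 u) (t' \<odot>\<^sub>2 u')"
    by (rule tensor_eq2_map[OF _ u]) (auto simp: mult2_def intro: module_hom_free_mult 2[unfolded mult2_def])
  finally show ?thesis .
qed

end

section \<open>Multilinear maps and the antipode\<close>

text \<open>These rules discharge the linearity goals left by each use of a Sweedler identity.
  Proofs about a particular multilinear map add its own linearity locally.\<close>

named_theorems linear_intros

context hopf_algebra
begin

abbreviation lin :: "('k \<Rightarrow> 'm::ab_group_add \<Rightarrow> 'm) \<Rightarrow> ('h \<Rightarrow> 'm) \<Rightarrow> bool" where
  "lin s f \<equiv> module_hom (hscale H) s f"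

definition bilin :: "('k \<Rightarrow> 'm::ab_group_add \<Rightarrow> 'm) \<Rightarrow> ('h \<Rightarrow> 'h \<Rightarrow> 'm) \<Rightarrow> bool" where
  "bilin s B \<longleftrightarrow> (\<forall>x. lin s (\<lambda>y. B x y)) \<and> (\<forall>y. lin s (\<lambda>x. B x y))"

definition trilin :: "('k \<Rightarrow> 'm::ab_group_add \<Rightarrow> 'm) \<Rightarrow> ('h \<Rightarrow> 'h \<Rightarrow> 'h \<Rightarrow> 'm) \<Rightarrow> bool" where
  "trilin s T \<longleftrightarrow> (\<forall>y z. lin s (\<lambda>x. T x y z)) \<and> (\<forall>x z. lin s (\<lambda>y. T x y z)) \<and>
     (\<forall>x y. lin s (\<lambda>z. T x y z))"

lemma bilinI [linear_intros]:
  "(\<And>x. lin s (\<lambda>y. B x y)) \<Longrightarrow> (\<And>y. lin s (\<lambda>x. B x y)) \<Longrightarrow> bilin s B"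
  by (simp add: bilin_def)

lemma trilinI [linear_intros]:
  "(\<And>y z. lin s (\<lambda>x. T x y z)) \<Longrightarrow> (\<And>x z. lin s (\<lambda>y. T x y z)) \<Longrightarrow>
   (\<And>x y. lin s (\<lambda>z. T x y z)) \<Longrightarrow> trilin s T"
  by (simp add: trilin_def)

lemma linI:
  "module s \<Longrightarrow> (\<And>x y. f (x + y) = f x + f y) \<Longrightarrow> (\<And>c x. f (hscale H c x) = s c (f x)) \<Longrightarrow> lin s f"
  by (simp add: module_hom_def module_hom_axioms_def module)

lemma lin_compose:
  "lin s f \<Longrightarrow> lin (hscale H) g \<Longrightarrow> lin s (\<lambda>h. f (g h))"
  using module_hom_compose[of "hscale H" "hscale H" g s f] by (simp add: o_def)

lemma lin_ident [linear_intros]: "lin (hscale H) (\<lambda>h. h)"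
  by (rule linI) (simp_all add: module)

lemma lin_mult_left [linear_intros]: "lin (hscale H) g \<Longrightarrow> lin (hscale H) (\<lambda>h. x * g h)"
  by (rule linI) (simp_all add: module module_hom.add module_hom.scale distrib_left scale_mult_right)

lemma lin_mult_right [linear_intros]: "lin (hscale H) g \<Longrightarrow> lin (hscale H) (\<lambda>h. g h * x)"
  by (rule linI) (simp_all add: module module_hom.add module_hom.scale distrib_right scale_mult_left)

lemma lin_antipode [linear_intros]: "lin (hscale H) g \<Longrightarrow> lin (hscale H) (\<lambda>h. antipode H (g h))"
  by (rule lin_compose[OF antipode_linear])

lemma lin_scale [linear_intros]: "lin s f \<Longrightarrow> lin s (\<lambda>h. s c (f h))"
  by (rule linI) (simp_all add: module_hom_def module_hom_axioms_def module.scale_right_distrib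
      module.scale_scale mult.commute)

lemma lin_counit [linear_intros]:
  "module s \<Longrightarrow> lin (hscale H) g \<Longrightarrow> lin s (\<lambda>h. s (counit H (g h)) v)"
  by (rule linI) (simp_all add: module_hom.add module_hom.scale counit_add counit_scale
      module.scale_left_distrib module.scale_scale)

lemma lin_tensor_sum [linear_intros]:
  assumes "module s" "\<And>x y. lin s (\<lambda>h. f h x y)"
  shows "lin s (\<lambda>h. tensor_sum s t (\<lambda>x y. f h x y))"
  by (rule linI)
    (simp_all add: assms module_hom.add[OF assms(2)] module_hom.scale[OF assms(2)]
      tensor_sum_add tensor_sum_scale)

lemma bilin_cong:
  assumes "module s" "tensor_eq2 (hscale H) t u" "bilin s B"
  shows "tensor_sum s t B = tensor_sum s u B"
  using assms by (intro tensor_sum_cong[where s = "hscale H"]) (auto simp: bilin_def)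

lemma trilin_cong:
  assumes "module s" "tensor_eq3 (hscale H) t u" "trilin s T"
  shows "tensor_sum3 s t T = tensor_sum3 s u T"
  using assms by (intro tensor_sum3_cong[where s = "hscale H"]) (auto simp: trilin_def)

text \<open>The coproduct respects sums and scalars only as a tensor; bilinearity of
  \<open>B\<close> makes the choice of representatives invisible.\<close>

lemma lin_coprod [linear_intros]:
  assumes "module s" "lin (hscale H) g" "bilin s B"
  shows "lin s (\<lambda>h. tensor_sum s (coprod H (g h)) B)"
proof (rule lin_compose[OF _ assms(2)], rule linI)
  show "tensor_sum s (coprod H (x + y)) B = tensor_sum s (coprod H x) B + tensor_sum s (coprod H y) B" for x y
    using bilin_cong[OF assms(1) coprod_add assms(3)] by (simp add: tensor_sum_plus_tensor assms(1))
  show "tensor_sum s (coprod H (hscale H c x)) B = s c (tensor_sum s (coprod H x) B)" for c x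
    using bilin_cong[OF assms(1) coprod_scale assms(3)] by (simp add: tensor_sum_free_scale assms(1))
qed (rule assms(1))

lemma bilin_lin:
  assumes "bilin s B"
  shows "lin (hscale H) g \<Longrightarrow> lin s (\<lambda>h. B (g h) y)" "lin (hscale H) g \<Longrightarrow> lin s (\<lambda>h. B x (g h))"
  using assms lin_compose[of s _ g] by (auto simp: bilin_def)

lemma trilin_lin:
  assumes "trilin s T"
  shows "lin (hscale H) g \<Longrightarrow> lin s (\<lambda>h. T (g h) y z)" "lin (hscale H) g \<Longrightarrow> lin s (\<lambda>h. T x (g h) z)"
     "lin (hscale H) g \<Longrightarrow> lin s (\<lambda>h. T x y (g h))"
  using assms lin_compose[of s "\<lambda>x. T x y z" g] lin_compose[of s "\<lambda>y. T x y z" g]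
    lin_compose[of s "\<lambda>z. T x y z" g] by (auto simp: trilin_def)

lemma sum_coprod_mult:
  assumes "module s" "bilin s B"
  shows "tensor_sum s (coprod H (x * y)) B
    = tensor_sum s (coprod H x) (\<lambda>a b. tensor_sum s (coprod H y) (\<lambda>c d. B (a * c) (b * d)))"
  using bilin_cong[OF assms(1) coprod_mult assms(2)] by (simp add: tensor_sum_mult2 assms)

lemma sum_coprod_one: "module s \<Longrightarrow> bilin s B \<Longrightarrow> tensor_sum s (coprod H 1) B = B 1 1"
  using bilin_cong[OF _ coprod_one] by fastforce

lemma sum_coassoc:
  assumes "module s" "trilin s T"
  shows "tensor_sum s (coprod H x) (\<lambda>a b. tensor_sum s (coprod H a) (\<lambda>c d. T c d b))
    = tensor_sum s (coprod H x) (\<lambda>a b. tensor_sum s (coprod H b) (\<lambda>c d. T a c d))"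
  using trilin_cong[OF assms(1) coassoc assms(2)] by (simp add: tensor_sum3_coprod assms)

text \<open>The counit and antipode axioms speak of sums in \<open>H\<close>. Applying a linear
  \<open>f\<close> carries them into an arbitrary module, which is the form used for rewriting; the
  next three lemmas are of the same kind.\<close>

lemma sum_counit_left:
  assumes "lin s f"
  shows "tensor_sum s (coprod H x) (\<lambda>a b. s (counit H a) (f b)) = f x"
  using hom_tensor_sum[OF assms, of "coprod H x" "\<lambda>a b. hscale H (counit H a) b"]
  by (simp add: counit_left module_hom.scale[OF assms])

lemma sum_counit_right:
  assumes "lin s f"
  shows "tensor_sum s (coprod H x) (\<lambda>a b. s (counit H b) (f a)) = f x"
  using hom_tensor_sum[OF assms, of "coprod H x" "\<lambda>a b. hscale H (counit H b) a"]
  by (simp add: counit_right module_hom.scale[OF assms])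

lemma sum_antipode_left:
  assumes "lin s f"
  shows "tensor_sum s (coprod H x) (\<lambda>a b. f (antipode H a * b)) = s (counit H x) (f 1)"
  using hom_tensor_sum[OF assms, of "coprod H x" "\<lambda>a b. antipode H a * b"]
  by (simp add: antipode_left module_hom.scale[OF assms])

lemma sum_antipode_right:
  assumes "lin s f"
  shows "tensor_sum s (coprod H x) (\<lambda>a b. f (a * antipode H b)) = s (counit H x) (f 1)"
  using hom_tensor_sum[OF assms, of "coprod H x" "\<lambda>a b. a * antipode H b"]
  by (simp add: antipode_right module_hom.scale[OF assms])

lemma antipode_one: "antipode H 1 = 1"
proof -
  have "tensor_sum (hscale H) (coprod H 1) (\<lambda>a b. antipode H a * b) = antipode H 1 * 1"
    by (rule sum_coprod_one[OF module]) (intro linear_intros)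
  then show ?thesis by (simp add: antipode_left counit_one module.scale_one[OF module])
qed

text \<open>
  Both \<open>S (x y)\<close> and \<open>S y S x\<close> are convolution inverses of the multiplication \<open>H \<otimes> H \<rightarrow> H\<close>;
  the sum below collapses to one or the other.
\<close>

lemma antipode_mult: "antipode H (x * y) = antipode H y * antipode H x"
proof -
  let ?s = "hscale H" and ?S = "antipode H" and ?D = "coprod H"
  let ?E = "tensor_sum (hscale H)"
  note m = module
  interpret module ?s by (rule module)
  have "?S y * ?S x = ?E (?D x) (\<lambda>x1 x2. ?s (counit H x2) (?S y * ?S x1))"
    by (rule sum_counit_right[symmetric]) (intro linear_intros)
  also have "\<dots> = ?E (?D x) (\<lambda>x1 x2. ?s (counit H x2) (?E (?D y) (\<lambda>y1 y2. ?s (counit H y2) (?S y1 * ?S x1))))"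
    by (subst sum_counit_right[where f = "\<lambda>y. ?S y * ?S _"]) (intro linear_intros refl)+
  also have "\<dots> = ?E (?D x) (\<lambda>x1 x2. ?E (?D y) (\<lambda>y1 y2. ?s (counit H (x2 * y2)) (?S y1 * ?S x1 * 1)))"
    by (simp add: counit_mult tensor_sum_scale[OF m, symmetric])
  also have "\<dots> = ?E (?D x) (\<lambda>x1 x2. ?E (?D y) (\<lambda>y1 y2. ?E (?D (x2 * y2)) (\<lambda>u v. ?S y1 * ?S x1 * (u * ?S v))))"
    by (subst sum_antipode_right) (intro linear_intros refl)+
  also have "\<dots> = ?E (?D x) (\<lambda>x1 x2. ?E (?D y) (\<lambda>y1 y2. ?E (?D x2) (\<lambda>p q. ?E (?D y2) (\<lambda>r t.
      ?S y1 * ?S x1 * ((p * r) * ?S (q * t))))))"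
    by (subst sum_coprod_mult) (intro linear_intros refl m)+
  also have "\<dots> = ?E (?D x) (\<lambda>x1 x2. ?E (?D x2) (\<lambda>p q. ?E (?D y) (\<lambda>y1 y2. ?E (?D y2) (\<lambda>r t.
      ?S y1 * ?S x1 * ((p * r) * ?S (q * t))))))"
    by (subst tensor_sum_swap[OF m, of "?D y"]) (rule refl)
  also have "\<dots> = ?E (?D x) (\<lambda>x1 x2. ?E (?D x1) (\<lambda>a b. ?E (?D y) (\<lambda>y1 y2. ?E (?D y2) (\<lambda>r t.
      ?S y1 * ?S a * ((b * r) * ?S (x2 * t))))))"
    by (rule sum_coassoc[symmetric, OF m]) (intro linear_intros m)
  also have "\<dots> = ?E (?D x) (\<lambda>x1 x2. ?E (?D x1) (\<lambda>a b. ?E (?D y) (\<lambda>y1 y2. ?E (?D y1) (\<lambda>c d.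
      ?S c * ?S a * ((b * d) * ?S (x2 * y2))))))"
    by (subst (2) sum_coassoc[OF m]) (intro linear_intros m refl)+
  also have "\<dots> = ?E (?D x) (\<lambda>x1 x2. ?E (?D y) (\<lambda>y1 y2. ?E (?D y1) (\<lambda>c d. ?E (?D x1) (\<lambda>a b.
      ?S c * (?S a * b) * (d * ?S (x2 * y2))))))"
    by (subst tensor_sum_swap[OF m], subst (2) tensor_sum_swap[OF m]) (simp add: mult.assoc)
  also have "\<dots> = ?E (?D x) (\<lambda>x1 x2. ?E (?D y) (\<lambda>y1 y2. ?E (?D y1) (\<lambda>c d.
      ?s (counit H x1) (?S c * 1 * (d * ?S (x2 * y2))))))"
    by (subst sum_antipode_left) (intro linear_intros refl)+
  also have "\<dots> = ?E (?D x) (\<lambda>x1 x2. ?s (counit H x1) (?E (?D y) (\<lambda>y1 y2. ?E (?D y1) (\<lambda>c d.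
      ?S c * d * ?S (x2 * y2)))))"
    by (simp add: tensor_sum_scale[OF m] mult.assoc)
  also have "\<dots> = ?E (?D x) (\<lambda>x1 x2. ?s (counit H x1) (?E (?D y) (\<lambda>y1 y2. ?s (counit H y1) (1 * ?S (x2 * y2)))))"
    by (subst sum_antipode_left[where f = "\<lambda>u. u * ?S _"]) (intro linear_intros refl)+
  also have "\<dots> = ?E (?D x) (\<lambda>x1 x2. ?s (counit H x1) (?S (x2 * y)))"
    by (subst sum_counit_left[where f = "\<lambda>y. 1 * ?S (_ * y)"]) (intro linear_intros refl | simp)+
  also have "\<dots> = ?S (x * y)"
    by (rule sum_counit_left) (intro linear_intros)
  finally show ?thesis by simp
qed

end

section \<open>The inverse of a twist\<close>

lemma mult2_one: "t \<odot>\<^sub>2 pure (1, 1) = t" "pure (1, 1) \<odot>\<^sub>2 t = t"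
proof -
  have "fsum free_scale (t \<odot>\<^sub>2 pure (1, 1)) pure = t" "fsum free_scale (pure (1, 1) \<odot>\<^sub>2 t) pure = t"
    unfolding mult2_def fsum_free_mult[OF module_free_scale]
    by (simp_all add: module_free_scale fsum_reconstruct case_prod_unfold)
  then show "t \<odot>\<^sub>2 pure (1, 1) = t" "pure (1, 1) \<odot>\<^sub>2 t = t"
    by (simp_all add: fsum_reconstruct)
qed

lemma is_tensor_inverse_sym: "is_tensor_inverse s t u \<Longrightarrow> is_tensor_inverse s u t"
  by (simp add: is_tensor_inverse_def)

context hopf_algebra
begin

lemma is_tensor_inverse_mult:
  assumes "is_tensor_inverse (hscale H) t u" "is_tensor_inverse (hscale H) t' u'"
  shows "is_tensor_inverse (hscale H) (t \<odot>\<^sub>2 t') (u' \<odot>\<^sub>2 u)"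
proof -
  have *: "tensor_eq2 (hscale H) ((x \<odot>\<^sub>2 y) \<odot>\<^sub>2 (y' \<odot>\<^sub>2 x')) (pure (1, 1))"
    if "tensor_eq2 (hscale H) (x \<odot>\<^sub>2 x') (pure (1, 1))" "tensor_eq2 (hscale H) (y \<odot>\<^sub>2 y') (pure (1, 1))"
    for x x' y y'
  proof -
    have "tensor_eq2 (hscale H) (x \<odot>\<^sub>2 (y \<odot>\<^sub>2 y') \<odot>\<^sub>2 x') (x \<odot>\<^sub>2 pure (1, 1) \<odot>\<^sub>2 x')"
      by (intro tensor_eq2_mult tensor_eq2_refl that)
    then show ?thesis
      using that(1) by (simp add: mult2_assoc mult2_one tensor_eq2_trans)
  qed
  show ?thesis
    using assms by (auto simp: is_tensor_inverse_def intro!: *)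
qed

lemma is_tensor_inverse_flip:
  assumes "is_tensor_inverse (hscale H) t u"
  shows "is_tensor_inverse (hscale H) (flip t) (flip u)"
proof -
  have "flip (pure (1, 1) :: ('k, 'h) tensor2) = pure (1, 1)"
    by (simp add: flip_def module_free_scale)
  then show ?thesis
    using assms tensor_eq2_flip[of "hscale H" _ "pure (1, 1)"]
    by (auto simp: is_tensor_inverse_def simp flip: flip_mult2)
qed

text \<open>The usual uniqueness argument v = v t u = u, carried out modulo relations because
  \<open>tensor_inv\<close> is an arbitrary choice of representative.\<close>

lemma tensor_inv_eq:
  assumes "is_tensor_inverse (hscale H) t u"
  shows "is_tensor_inverse (hscale H) t (tensor_inv (hscale H) t)"
    and "tensor_eq2 (hscale H) (tensor_inv (hscale H) t) u"
proof -
  let ?v = "tensor_inv (hscale H) t"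
  show v: "is_tensor_inverse (hscale H) t ?v"
    unfolding tensor_inv_def using assms by (rule someI)
  have "tensor_eq2 (hscale H) (?v \<odot>\<^sub>2 pure (1, 1)) (?v \<odot>\<^sub>2 (t \<odot>\<^sub>2 u))"
    using assms by (intro tensor_eq2_mult tensor_eq2_refl) (simp add: is_tensor_inverse_def tensor_eq2_sym)
  also have "?v \<odot>\<^sub>2 (t \<odot>\<^sub>2 u) = (?v \<odot>\<^sub>2 t) \<odot>\<^sub>2 u"
    by (simp add: mult2_assoc)
  also have "tensor_eq2 (hscale H) ((?v \<odot>\<^sub>2 t) \<odot>\<^sub>2 u) (pure (1, 1) \<odot>\<^sub>2 u)"
    using v by (intro tensor_eq2_mult tensor_eq2_refl) (simp add: is_tensor_inverse_def)
  finally show "tensor_eq2 (hscale H) ?v u"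
    by (simp add: mult2_one)
qed

lemma sum_tensor_inverse:
  assumes "is_tensor_inverse (hscale H) t u" "module s" "bilin s B"
  shows "tensor_sum s t (\<lambda>x y. tensor_sum s u (\<lambda>x' y'. B (x * x') (y * y'))) = B 1 1"
proof -
  have "tensor_sum s (t \<odot>\<^sub>2 u) B = tensor_sum s (pure (1, 1)) B"
    using assms by (intro bilin_cong) (auto simp: is_tensor_inverse_def)
  then show ?thesis by (simp add: tensor_sum_mult2 assms)
qed

end

section \<open>Identities for the inverse R-matrix\<close>

context triangular_hopf_algebra
begin

lemma rmat_inverse: "is_tensor_inverse (hscale H) (rmat H) (rmat_inv H)"
  using rmat_invertible tensor_inv_eq by blast

text \<open>Multiplying \<open>rmat_coprod\<close> by the inverse R-matrix from the left gives R^-1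
  Delta^op(x) = Delta(x) R^-1. This is what makes braiding commute with the action of
  \<open>H\<close>.\<close>

lemma sum_rmat_inv_coprod_swap:
  assumes m: "module s" and B: "bilin s B"
  shows "tensor_sum s (rmat_inv H) (\<lambda>r q. tensor_sum s (coprod H x) (\<lambda>a b. B (r * b) (q * a)))
    = tensor_sum s (coprod H x) (\<lambda>a b. tensor_sum s (rmat_inv H) (\<lambda>r q. B (a * r) (b * q)))"
proof -
  note [linear_intros] = bilin_lin[OF B]
  let ?B = "\<lambda>u v. tensor_sum s (rmat_inv H) (\<lambda>r q. B (r * u) (q * v))"
  have "tensor_sum s (rmat_inv H) (\<lambda>r q. tensor_sum s (coprod H x) (\<lambda>a b. B (r * b) (q * a)))
     = tensor_sum s (flip (coprod H x)) ?B"
    by (subst tensor_sum_swap[OF m]) (simp add: tensor_sum_flip[OF m])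
  also have "\<dots> = tensor_sum s (rmat H \<odot>\<^sub>2 coprod H x \<odot>\<^sub>2 rmat_inv H) ?B"
    by (intro bilin_cong m rmat_coprod linear_intros)
  also have "\<dots> = tensor_sum s (rmat H) (\<lambda>r' q'. tensor_sum s (coprod H x) (\<lambda>a b.
      tensor_sum s (rmat_inv H) (\<lambda>u v. tensor_sum s (rmat_inv H) (\<lambda>r q. B (r * r' * (a * u)) (q * q' * (b * v))))))"
    by (simp add: tensor_sum_mult2[OF m] mult.assoc)
  also have "\<dots> = tensor_sum s (rmat H) (\<lambda>r' q'. tensor_sum s (coprod H x) (\<lambda>a b.
      tensor_sum s (rmat_inv H) (\<lambda>r q. tensor_sum s (rmat_inv H) (\<lambda>u v. B (r * r' * (a * u)) (q * q' * (b * v))))))"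
    by (subst tensor_sum_swap[OF m, of "rmat_inv H"]) (rule refl)
  also have "\<dots> = tensor_sum s (rmat H) (\<lambda>r' q'. tensor_sum s (rmat_inv H) (\<lambda>r q. tensor_sum s (coprod H x) (\<lambda>a b.
      tensor_sum s (rmat_inv H) (\<lambda>u v. B (r * r' * (a * u)) (q * q' * (b * v))))))"
    by (subst tensor_sum_swap[OF m, of "coprod H x"]) (rule refl)
  also have "\<dots> = tensor_sum s (rmat_inv H) (\<lambda>r q. tensor_sum s (rmat H) (\<lambda>r' q'. tensor_sum s (coprod H x) (\<lambda>a b.
      tensor_sum s (rmat_inv H) (\<lambda>u v. B (r * r' * (a * u)) (q * q' * (b * v))))))"
    by (rule tensor_sum_swap[OF m])
  also have "\<dots> = tensor_sum s (coprod H x) (\<lambda>a b. tensor_sum s (rmat_inv H) (\<lambda>u v. B (1 * (a * u)) (1 * (b * v))))"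
    by (rule sum_tensor_inverse[OF is_tensor_inverse_sym[OF rmat_inverse] m,
          where B = "\<lambda>r q. tensor_sum s (coprod H x) (\<lambda>a b. tensor_sum s (rmat_inv H) (\<lambda>u v. B (r * (a * u)) (q * (b * v))))"])
      (intro linear_intros m)
  finally show ?thesis by simp
qed

text \<open>Since R^-1 = R_21, the hexagon identity \<open>rmat_left\<close> with its legs permuted
  computes the coproduct of the second leg of R^-1.\<close>

lemma sum_rmat_inv_coprod_right:
  assumes m: "module s" and T: "trilin s T"
  shows "tensor_sum s (rmat_inv H) (\<lambda>r q. tensor_sum s (coprod H q) (\<lambda>a b. T r a b))
    = tensor_sum s (rmat_inv H) (\<lambda>r q. tensor_sum s (rmat_inv H) (\<lambda>r' q'. T (r * r') q q'))"
proof -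
  note [linear_intros] = trilin_lin[OF T]
  have flip: "tensor_sum s (rmat_inv H) B = tensor_sum s (rmat H) (\<lambda>x y. B y x)" if "bilin s B" for B
    using bilin_cong[OF m rmat_inv_flip that] by (simp add: tensor_sum_flip m)
  have "tensor_sum s (rmat_inv H) (\<lambda>r q. tensor_sum s (coprod H q) (\<lambda>a b. T r a b))
    = tensor_sum3 s (coprod_left H (rmat H)) (\<lambda>x y z. T z x y)"
    by (subst flip) (intro linear_intros m | simp add: tensor_sum3_coprod m)+
  also have "\<dots> = tensor_sum3 s (leg13 (rmat H) \<odot>\<^sub>3 leg23 (rmat H)) (\<lambda>x y z. T z x y)"
    by (intro trilin_cong m rmat_left linear_intros)
  also have "\<dots> = tensor_sum s (rmat_inv H) (\<lambda>r q. tensor_sum s (rmat_inv H) (\<lambda>r' q'. T (r * r') q q'))"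
    by (subst (1 2) flip) (intro linear_intros m | simp add: tensor_sum3_mult3 tensor_sum3_leg m)+
  finally show ?thesis .
qed

end

section \<open>Inverting the cocycle of a twist\<close>

locale twisted_hopf_algebra = triangular_hopf_algebra H for H :: "('k::comm_ring_1, 'h::ring_1) hopf_data" +
  fixes F :: "('k, 'h) tensor2"
  assumes twist: "drinfeld_twist H F"
begin

abbreviation "F_inv \<equiv> tensor_inv (hscale H) F"

lemma F_inverse: "is_tensor_inverse (hscale H) F F_inv"
  using twist tensor_inv_eq by (auto simp: drinfeld_twist_def)

lemmas sum_F_F_inv = sum_tensor_inverse[OF F_inverse]
  and sum_F_inv_F = sum_tensor_inverse[OF is_tensor_inverse_sym[OF F_inverse]]

lemma sum_cocycle:
  assumes "module s" "trilin s T"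
  shows "tensor_sum s F (\<lambda>x y. tensor_sum s F (\<lambda>u v. tensor_sum s (coprod H u) (\<lambda>a b. T (x * a) (y * b) v)))
    = tensor_sum s F (\<lambda>x y. tensor_sum s F (\<lambda>u v. tensor_sum s (coprod H v) (\<lambda>a b. T u (x * a) (y * b))))"
  using trilin_cong[OF assms(1) _ assms(2), of "leg12 F \<odot>\<^sub>3 coprod_left H F" "leg23 F \<odot>\<^sub>3 coprod_right H F"] twist
  by (simp add: drinfeld_twist_def tensor_sum3_mult3 tensor_sum3_leg tensor_sum3_coprod assms)

text \<open>The counit is multiplicative, so applying it to one leg of F F^-1 = 1 separates the two
  factors, and the factor coming from \<open>F\<close> is 1 by normalization.\<close>

lemma sum_counit_F_inv:
  assumes f: "lin s f"
  shows "tensor_sum s F_inv (\<lambda>x y. s (counit H x) (f y)) = f 1"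
    and "tensor_sum s F_inv (\<lambda>x y. s (counit H y) (f x)) = f 1"
proof -
  from f have m: "module s" by (simp add: module_hom_def)
  note [linear_intros] = lin_compose[OF f]
  have F: "tensor_sum s F (\<lambda>x y. s (counit H x) (g y)) = g 1"
    "tensor_sum s F (\<lambda>x y. s (counit H y) (g x)) = g 1" if g: "lin s g" for g
    using hom_tensor_sum[OF g, of F "\<lambda>x y. hscale H (counit H x) y"]
      hom_tensor_sum[OF g, of F "\<lambda>x y. hscale H (counit H y) x"] twist
    by (simp_all add: drinfeld_twist_def module_hom.scale[OF g])
  have "tensor_sum s F (\<lambda>u v. tensor_sum s F_inv (\<lambda>x y. s (counit H (u * x)) (f (v * y))))
      = s (counit H 1) (f 1)"
    by (rule sum_F_F_inv[OF m]) (intro linear_intros m)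
  moreover have "tensor_sum s F (\<lambda>u v. tensor_sum s F_inv (\<lambda>x y. s (counit H (u * x)) (f (v * y))))
      = tensor_sum s F (\<lambda>u v. s (counit H u) (tensor_sum s F_inv (\<lambda>x y. s (counit H x) (f (v * y)))))"
    by (simp add: counit_mult tensor_sum_scale[OF m, symmetric] module.scale_scale[OF m])
  moreover have "\<dots> = tensor_sum s F_inv (\<lambda>x y. s (counit H x) (f (1 * y)))"
    by (rule F) (intro linear_intros m)
  ultimately show "tensor_sum s F_inv (\<lambda>x y. s (counit H x) (f y)) = f 1"
    by (simp add: counit_one module.scale_one[OF m])
  have "tensor_sum s F (\<lambda>u v. tensor_sum s F_inv (\<lambda>x y. s (counit H (v * y)) (f (u * x))))
      = s (counit H 1) (f 1)"
    by (rule sum_F_F_inv[OF m, where B = "\<lambda>x y. s (counit H y) (f x)"]) (intro linear_intros m)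
  moreover have "tensor_sum s F (\<lambda>u v. tensor_sum s F_inv (\<lambda>x y. s (counit H (v * y)) (f (u * x))))
      = tensor_sum s F (\<lambda>u v. s (counit H v) (tensor_sum s F_inv (\<lambda>x y. s (counit H y) (f (u * x)))))"
    by (simp add: counit_mult tensor_sum_scale[OF m, symmetric] module.scale_scale[OF m])
  moreover have "\<dots> = tensor_sum s F_inv (\<lambda>x y. s (counit H y) (f (1 * x)))"
    by (rule F) (intro linear_intros m)
  ultimately show "tensor_sum s F_inv (\<lambda>x y. s (counit H y) (f x)) = f 1"
    by (simp add: counit_one module.scale_one[OF m])
qed

text \<open>The two expressions for the inverse of the cocycle \<open>(\<F> \<otimes> 1) (\<Delta> \<otimes> id)(\<F>)\<close>.\<close>

definition cocycle_inv :: "('k \<Rightarrow> 'm::ab_group_add \<Rightarrow> 'm) \<Rightarrow> ('h \<Rightarrow> 'h \<Rightarrow> 'h \<Rightarrow> 'm) \<Rightarrow> 'm" where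
  "cocycle_inv s T = tensor_sum s F_inv (\<lambda>u v. tensor_sum s (coprod H u) (\<lambda>a b.
     tensor_sum s F_inv (\<lambda>p q. T (a * p) (b * q) v)))"

definition cocycle_inv' :: "('k \<Rightarrow> 'm::ab_group_add \<Rightarrow> 'm) \<Rightarrow> ('h \<Rightarrow> 'h \<Rightarrow> 'h \<Rightarrow> 'm) \<Rightarrow> 'm" where
  "cocycle_inv' s T = tensor_sum s F_inv (\<lambda>u v. tensor_sum s (coprod H v) (\<lambda>a b.
     tensor_sum s F_inv (\<lambda>p q. T u (a * p) (b * q))))"

lemma lin_cocycle_inv' [linear_intros]:
  "module s \<Longrightarrow> (\<And>x y z. lin s (\<lambda>h. f h x y z)) \<Longrightarrow> lin s (\<lambda>h. cocycle_inv' s (\<lambda>x y z. f h x y z))"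
  unfolding cocycle_inv'_def by (intro linear_intros)

text \<open>In the threefold tensor product this is (Delta x id)(F^-1) (F^-1 x 1) (F x 1) (Delta x
  id)(F) = 1. The inner factors cancel; the two coproducts then meet, and multiplicativity merges
  them into the coproduct of a product.\<close>

lemma cocycle_inv_cocycle:
  assumes m: "module s" and T: "trilin s T"
  shows "cocycle_inv s (\<lambda>x' y' z'. tensor_sum s F (\<lambda>x y. tensor_sum s F (\<lambda>u v. tensor_sum s (coprod H u) (\<lambda>a b.
    T (x' * (x * a)) (y' * (y * b)) (z' * v))))) = T 1 1 1"
proof -
  note [linear_intros] = trilin_lin[OF T]
  have "cocycle_inv s (\<lambda>x' y' z'. tensor_sum s F (\<lambda>x y. tensor_sum s F (\<lambda>u v. tensor_sum s (coprod H u) (\<lambda>a b.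
       T (x' * (x * a)) (y' * (y * b)) (z' * v)))))
    = tensor_sum s F_inv (\<lambda>u' v'. tensor_sum s (coprod H u') (\<lambda>a' b'.
       tensor_sum s F_inv (\<lambda>p q. tensor_sum s F (\<lambda>x y. tensor_sum s F (\<lambda>u v. tensor_sum s (coprod H u) (\<lambda>a b.
          T (a' * (p * x) * a) (b' * (q * y) * b) (v' * v)))))))"
    by (simp add: cocycle_inv_def mult.assoc)
  also have "\<dots> = tensor_sum s F_inv (\<lambda>u' v'. tensor_sum s (coprod H u') (\<lambda>a' b'.
       tensor_sum s F (\<lambda>u v. tensor_sum s (coprod H u) (\<lambda>a b. T (a' * 1 * a) (b' * 1 * b) (v' * v)))))"
    by (subst sum_F_inv_F) (intro linear_intros refl m)+
  also have "\<dots> = tensor_sum s F_inv (\<lambda>u' v'. tensor_sum s F (\<lambda>u v. tensor_sum s (coprod H u') (\<lambda>a' b'.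
       tensor_sum s (coprod H u) (\<lambda>a b. T (a' * a) (b' * b) (v' * v)))))"
    by (subst tensor_sum_swap[OF m, of F]) simp
  also have "\<dots> = tensor_sum s F_inv (\<lambda>u' v'. tensor_sum s F (\<lambda>u v.
       tensor_sum s (coprod H (u' * u)) (\<lambda>a b. T a b (v' * v))))"
    by (subst sum_coprod_mult) (intro linear_intros refl m)+
  also have "\<dots> = tensor_sum s (coprod H 1) (\<lambda>a b. T a b 1)"
    by (rule sum_F_inv_F[OF m]) (intro linear_intros m)
  also have "\<dots> = T 1 1 1"
    by (rule sum_coprod_one[OF m]) (intro linear_intros m)
  finally show ?thesis .
qed

text \<open>The same cancellation for (1 x F) (id x Delta)(F), now with the inverse on the right.
  Here the coproducts meet at once, and the outer pair F, F^-1 cancels last.\<close>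

lemma cocycle_cocycle_inv':
  assumes m: "module s" and T: "trilin s T"
  shows "tensor_sum s F (\<lambda>x y. tensor_sum s F (\<lambda>u v. tensor_sum s (coprod H v) (\<lambda>a b.
    cocycle_inv' s (\<lambda>x' y' z'. T (u * x') (x * a * y') (y * b * z'))))) = T 1 1 1"
proof -
  note [linear_intros] = trilin_lin[OF T]
  have "tensor_sum s F (\<lambda>x y. tensor_sum s F (\<lambda>u v. tensor_sum s (coprod H v) (\<lambda>a b.
    cocycle_inv' s (\<lambda>x' y' z'. T (u * x') (x * a * y') (y * b * z')))))
    = tensor_sum s F (\<lambda>x y. tensor_sum s F (\<lambda>u v. tensor_sum s F_inv (\<lambda>u' v'.
        tensor_sum s (coprod H v) (\<lambda>a b. tensor_sum s (coprod H v') (\<lambda>a' b'. tensor_sum s F_inv (\<lambda>p q.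
         T (u * u') (x * (a * a') * p) (y * (b * b') * q)))))))"
    unfolding cocycle_inv'_def
    by (subst tensor_sum_swap[OF m, of "coprod H _" F_inv]) (simp add: mult.assoc)
  also have "\<dots> = tensor_sum s F (\<lambda>x y. tensor_sum s F (\<lambda>u v. tensor_sum s F_inv (\<lambda>u' v'.
        tensor_sum s (coprod H (v * v')) (\<lambda>a b. tensor_sum s F_inv (\<lambda>p q.
         T (u * u') (x * a * p) (y * b * q))))))"
    by (subst sum_coprod_mult) (intro linear_intros refl m)+
  also have "\<dots> = tensor_sum s F (\<lambda>x y. tensor_sum s (coprod H 1) (\<lambda>a b. tensor_sum s F_inv (\<lambda>p q.
         T 1 (x * a * p) (y * b * q))))"
    by (subst sum_F_F_inv[OF m]) (intro linear_intros refl m)+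
  also have "\<dots> = tensor_sum s F (\<lambda>x y. tensor_sum s F_inv (\<lambda>p q. T 1 (x * 1 * p) (y * 1 * q)))"
    by (subst sum_coprod_one[OF m]) (intro linear_intros refl m)+
  also have "\<dots> = tensor_sum s F (\<lambda>x y. tensor_sum s F_inv (\<lambda>p q. T 1 (x * p) (y * q)))"
    by simp
  also have "\<dots> = T 1 1 1"
    by (rule sum_F_F_inv[OF m]) (intro linear_intros m)
  finally show ?thesis .
qed

text \<open>A left inverse of an element agrees with a right inverse of it: l = l c r = r. The
  cocycle condition enters in the middle, where it lets the same c be cancelled from either
  side.\<close>

lemma cocycle_inv_eq:
  assumes m: "module s" and T: "trilin s T"
  shows "cocycle_inv s T = cocycle_inv' s T"
proof -
  note [linear_intros] = trilin_lin[OF T]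
  have "cocycle_inv' s T = cocycle_inv' s (\<lambda>x y z. T (1 * x) (1 * y) (1 * z))"
    by simp
  also have "\<dots> = cocycle_inv s (\<lambda>x' y' z'. tensor_sum s F (\<lambda>x y. tensor_sum s F (\<lambda>u v. tensor_sum s (coprod H u) (\<lambda>a b.
    cocycle_inv' s (\<lambda>x'' y'' z''. T (x' * (x * a) * x'') (y' * (y * b) * y'') (z' * v * z''))))))"
    by (rule cocycle_inv_cocycle[OF m, symmetric]) (intro linear_intros m)
  also have "\<dots> = cocycle_inv s (\<lambda>x' y' z'. tensor_sum s F (\<lambda>x y. tensor_sum s F (\<lambda>u v. tensor_sum s (coprod H v) (\<lambda>a b.
    cocycle_inv' s (\<lambda>x'' y'' z''. T (x' * u * x'') (y' * (x * a) * y'') (z' * (y * b) * z''))))))"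
    by (subst sum_cocycle[OF m]) (intro linear_intros m refl)+
  also have "\<dots> = cocycle_inv s (\<lambda>x' y' z'. tensor_sum s F (\<lambda>x y. tensor_sum s F (\<lambda>u v. tensor_sum s (coprod H v) (\<lambda>a b.
    cocycle_inv' s (\<lambda>x'' y'' z''. T (x' * (u * x'')) (y' * (x * a * y'')) (z' * (y * b * z'')))))))"
    by (simp add: mult.assoc)
  also have "\<dots> = cocycle_inv s (\<lambda>x y z. T (x * 1) (y * 1) (z * 1))"
    by (subst cocycle_cocycle_inv'[OF m]) (intro linear_intros m refl)+
  finally show ?thesis by simp
qed

text \<open>The equality of the two inverses, multiplied by F x 1 from the right to isolate (Delta x
  id)(F^-1). It trades a coproduct of the first leg for one of the second, whose parts can then be
  contracted with the antipode.\<close>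

lemma sum_F_inv_coprod_left:
  assumes m: "module s" and T: "trilin s T"
  shows "tensor_sum s F_inv (\<lambda>u v. tensor_sum s (coprod H u) (\<lambda>a b. T a b v)) =
    tensor_sum s F_inv (\<lambda>u v. tensor_sum s (coprod H v) (\<lambda>a b. tensor_sum s F_inv (\<lambda>p q.
      tensor_sum s F (\<lambda>x y. T (u * x) (a * p * y) (b * q)))))"
proof -
  note [linear_intros] = trilin_lin[OF T]
  have "cocycle_inv s (\<lambda>x y z. tensor_sum s F (\<lambda>p q. T (x * p) (y * q) z))
     = cocycle_inv' s (\<lambda>x y z. tensor_sum s F (\<lambda>p q. T (x * p) (y * q) z))"
    by (rule cocycle_inv_eq[OF m]) (intro linear_intros m)
  moreover have "cocycle_inv s (\<lambda>x y z. tensor_sum s F (\<lambda>p q. T (x * p) (y * q) z))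
    = tensor_sum s F_inv (\<lambda>u v. tensor_sum s (coprod H u) (\<lambda>a b. tensor_sum s F_inv (\<lambda>p q.
       tensor_sum s F (\<lambda>x y. T (a * (p * x)) (b * (q * y)) v))))"
    by (simp add: cocycle_inv_def mult.assoc)
  moreover have "\<dots> = tensor_sum s F_inv (\<lambda>u v. tensor_sum s (coprod H u) (\<lambda>a b. T (a * 1) (b * 1) v))"
    by (subst sum_F_inv_F[OF m]) (intro linear_intros m refl)+
  ultimately show ?thesis by (simp add: cocycle_inv'_def)
qed

lemma sum_F_inv_coprod_right:
  assumes m: "module s" and T: "trilin s T"
  shows "tensor_sum s F_inv (\<lambda>u v. tensor_sum s (coprod H v) (\<lambda>a b. T u a b)) =
    tensor_sum s F_inv (\<lambda>u v. tensor_sum s (coprod H u) (\<lambda>a b. tensor_sum s F_inv (\<lambda>p q.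
      tensor_sum s F (\<lambda>x y. T (a * p) (b * q * x) (v * y)))))"
proof -
  note [linear_intros] = trilin_lin[OF T]
  have "cocycle_inv s (\<lambda>x y z. tensor_sum s F (\<lambda>p q. T x (y * p) (z * q)))
     = cocycle_inv' s (\<lambda>x y z. tensor_sum s F (\<lambda>p q. T x (y * p) (z * q)))"
    by (rule cocycle_inv_eq[OF m]) (intro linear_intros m)
  moreover have "cocycle_inv' s (\<lambda>x y z. tensor_sum s F (\<lambda>p q. T x (y * p) (z * q)))
    = tensor_sum s F_inv (\<lambda>u v. tensor_sum s (coprod H v) (\<lambda>a b. tensor_sum s F_inv (\<lambda>p q.
       tensor_sum s F (\<lambda>x y. T u (a * (p * x)) (b * (q * y))))))"
    by (simp add: cocycle_inv'_def mult.assoc)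
  moreover have "\<dots> = tensor_sum s F_inv (\<lambda>u v. tensor_sum s (coprod H v) (\<lambda>a b. T u (a * 1) (b * 1)))"
    by (subst sum_F_inv_F[OF m]) (intro linear_intros m refl)+
  ultimately show ?thesis by (simp add: cocycle_inv_def)
qed

section \<open>The inverse of the element defining the twisted antipode\<close>

abbreviation "\<beta> \<equiv> twist_beta H F"

text \<open>The inverse of \<open>\<beta>\<close>. It appears below as what is left of one copy of
  F^-1 after an antipode contraction has used up the other.\<close>

definition twist_gamma :: 'h ("\<gamma>") where
  "\<gamma> = tensor_sum (hscale H) F_inv (\<lambda>x y. antipode H x * y)"

text \<open>After \<open>sum_F_inv_coprod_left\<close> the second argument is S(y) S(p) S(a) b q.
  Here S(a) b contracts to a counit, which removes one F^-1 by normalization, and S(p) q sums to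
  \<open>\<gamma>\<close>. This is how F comes to replace F^-1 in the formula for X^F.\<close>

lemma sum_F_inv_antipode:
  assumes m: "module s" and B: "bilin s B"
  shows "tensor_sum s F_inv (\<lambda>u v. tensor_sum s (coprod H u) (\<lambda>a b. B a (antipode H b * v)))
     = tensor_sum s F (\<lambda>x y. B x (antipode H y * \<gamma>))"
proof -
  note [linear_intros] = bilin_lin[OF B]
  let ?S = "antipode H"
  have "tensor_sum s F_inv (\<lambda>u v. tensor_sum s (coprod H u) (\<lambda>a b. B a (?S b * v)))
     = tensor_sum s F_inv (\<lambda>u v. tensor_sum s (coprod H v) (\<lambda>a b. tensor_sum s F_inv (\<lambda>p q.
         tensor_sum s F (\<lambda>x y. B (u * x) (?S (a * p * y) * (b * q))))))"
    by (rule sum_F_inv_coprod_left[OF m]) (intro linear_intros m)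
  also have "\<dots> = tensor_sum s F (\<lambda>x y. tensor_sum s F_inv (\<lambda>p q. tensor_sum s F_inv (\<lambda>u v.
        tensor_sum s (coprod H v) (\<lambda>a b. B (u * x) (?S y * (?S p * (?S a * b) * q))))))"
    by (simp add: tensor_sum_swap[OF m, of _ F] tensor_sum_swap[OF m, of "coprod H _" F_inv]
        antipode_mult mult.assoc)
      (subst tensor_sum_swap[OF m, of F_inv F_inv], rule refl)
  also have "\<dots> = tensor_sum s F (\<lambda>x y. tensor_sum s F_inv (\<lambda>p q. tensor_sum s F_inv (\<lambda>u v.
        s (counit H v) (B (u * x) (?S y * (?S p * 1 * q))))))"
    by (subst sum_antipode_left[where f = "\<lambda>w. B _ (?S _ * (?S _ * w * _))"]) (intro linear_intros m refl)+
  also have "\<dots> = tensor_sum s F (\<lambda>x y. tensor_sum s F_inv (\<lambda>p q. B (1 * x) (?S y * (?S p * 1 * q))))"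
    by (subst sum_counit_F_inv(2)[where f = "\<lambda>u. B (u * _) _"]) (intro linear_intros m refl)+
  also have "\<dots> = tensor_sum s F (\<lambda>x y. B x (?S y * \<gamma>))"
  proof -
    have "B x (?S y * \<gamma>) = tensor_sum s F_inv (\<lambda>p q. B x (?S y * (?S p * q)))" for x y
      unfolding twist_gamma_def
      by (rule hom_tensor_sum[where \<phi> = "\<lambda>w. B x (?S y * w)"]) (intro linear_intros)
    then show ?thesis by simp
  qed
  finally show ?thesis .
qed

text \<open>Take multiplication for \<open>B\<close> in \<open>sum_F_inv_antipode\<close>. The side
  with the coproduct contracts to the sum of the counit of F_1^-1 times F_2^-1, which is 1.\<close>

lemma beta_gamma: "\<beta> * \<gamma> = 1"
proof -
  let ?S = "antipode H"
  have "\<beta> * \<gamma> = tensor_sum (hscale H) F (\<lambda>x y. x * (?S y * \<gamma>))"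
    unfolding twist_beta_def
    by (subst hom_tensor_sum[where \<phi> = "\<lambda>w. w * \<gamma>" and s' = "hscale H"]) (intro linear_intros | simp add: mult.assoc)+
  also have "\<dots> = tensor_sum (hscale H) F_inv (\<lambda>u v. tensor_sum (hscale H) (coprod H u) (\<lambda>a b. a * (?S b * v)))"
    by (rule sum_F_inv_antipode[symmetric, OF module]) (intro linear_intros)
  also have "\<dots> = tensor_sum (hscale H) F_inv (\<lambda>u v. tensor_sum (hscale H) (coprod H u) (\<lambda>a b. (a * ?S b) * v))"
    by (simp add: mult.assoc)
  also have "\<dots> = tensor_sum (hscale H) F_inv (\<lambda>u v. hscale H (counit H u) (1 * v))"
    by (subst sum_antipode_right[where f = "\<lambda>w. w * _"]) (intro linear_intros refl)+
  also have "\<dots> = 1 * 1"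
    by (rule sum_counit_F_inv(1)) (intro linear_intros)
  finally show ?thesis by simp
qed

text \<open>The mirror argument: S(u) v_1 S(v_2), summed over F^-1, is contracted directly to 1, and
  to the product of \<open>\<gamma>\<close> and \<open>\<beta>\<close> after the coproduct has been
  traded to the first leg.\<close>

lemma gamma_beta: "\<gamma> * \<beta> = 1"
proof -
  let ?S = "antipode H"
  let ?E = "tensor_sum (hscale H)"
  note m = module
  have "?E F_inv (\<lambda>u v. ?E (coprod H v) (\<lambda>a b. ?S u * (a * ?S b)))
    = ?E F_inv (\<lambda>u v. ?E (coprod H u) (\<lambda>a b. ?E F_inv (\<lambda>p q. ?E F (\<lambda>x y. ?S (a * p) * ((b * q * x) * ?S (v * y))))))"
    by (rule sum_F_inv_coprod_right[OF m]) (intro linear_intros)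
  also have "\<dots> = ?E F_inv (\<lambda>u v. ?E F_inv (\<lambda>p q. ?E F (\<lambda>x y. ?E (coprod H u) (\<lambda>a b.
       ?S p * (?S a * b) * q * x * ?S y * ?S v))))"
    by (simp add: tensor_sum_swap[OF m, of "coprod H _"] antipode_mult mult.assoc)
  also have "\<dots> = ?E F_inv (\<lambda>u v. ?E F_inv (\<lambda>p q. ?E F (\<lambda>x y.
       hscale H (counit H u) (?S p * 1 * q * x * ?S y * ?S v))))"
    by (subst sum_antipode_left[where f = "\<lambda>w. ?S _ * w * _ * _ * _ * _"]) (intro linear_intros refl)+
  also have "\<dots> = ?E F_inv (\<lambda>u v. hscale H (counit H u) (?E F_inv (\<lambda>p q. ?E F (\<lambda>x y.
       (?S p * q * x * ?S y * ?S v)))))"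
    by (simp add: tensor_sum_scale[OF m])
  also have "\<dots> = ?E F_inv (\<lambda>p q. ?E F (\<lambda>x y. (?S p * q * x * ?S y * ?S 1)))"
    by (rule sum_counit_F_inv(1)) (intro linear_intros m)
  also have "\<dots> = ?E F_inv (\<lambda>p q. (?S p * q) * \<beta>)"
    unfolding twist_beta_def
    by (subst hom_tensor_sum[where \<phi> = "\<lambda>w. _ * w" and s' = "hscale H"]) (intro linear_intros | simp add: mult.assoc antipode_one)+
  also have "\<dots> = \<gamma> * \<beta>"
    unfolding twist_gamma_def
    by (rule hom_tensor_sum[where \<phi> = "\<lambda>w. w * \<beta>", symmetric]) (intro linear_intros)
  finally have "\<gamma> * \<beta> = ?E F_inv (\<lambda>u v. ?E (coprod H v) (\<lambda>a b. ?S u * (a * ?S b)))"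
    by simp
  also have "\<dots> = ?E F_inv (\<lambda>u v. hscale H (counit H v) (?S u * 1))"
    by (subst sum_antipode_right[where f = "\<lambda>w. ?S _ * w"]) (intro linear_intros refl)+
  also have "\<dots> = ?S 1 * 1"
    by (rule sum_counit_F_inv(2)) (intro linear_intros)
  finally show ?thesis by (simp add: antipode_one)
qed

lemma ring_inv_beta: "ring_inv \<beta> = \<gamma>"
  unfolding ring_inv_def
proof (rule the_equality)
  fix c assume "\<beta> * c = 1 \<and> c * \<beta> = 1"
  then show "c = \<gamma>"
    by (metis beta_gamma mult.assoc mult_1_left mult_1_right)
qed (simp add: beta_gamma gamma_beta)

text \<open>The inverse R-matrix of the twisted data is again an arbitrary representative, so the
  explicit inverse can be substituted only under a bilinear \<open>B\<close>. In
  \<open>sum_coprod_twist\<close> the representative is given and the identity holds for every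
  \<open>B\<close>.\<close>

lemma sum_rmat_inv_twist:
  assumes m: "module s" and B: "bilin s B"
  shows "tensor_sum s (rmat_inv (twist_hopf H F)) B =
    tensor_sum s F (\<lambda>x y. tensor_sum s (rmat_inv H) (\<lambda>r q. tensor_sum s F_inv (\<lambda>u v. B (x * r * v) (y * q * u))))"
proof -
  have "is_tensor_inverse (hscale H) (flip F \<odot>\<^sub>2 rmat H \<odot>\<^sub>2 F_inv) (F \<odot>\<^sub>2 (rmat_inv H \<odot>\<^sub>2 flip F_inv))"
    by (intro is_tensor_inverse_mult is_tensor_inverse_flip rmat_inverse F_inverse
        is_tensor_inverse_sym[OF F_inverse])
  from bilin_cong[OF m tensor_inv_eq(2)[OF this] B] show ?thesis
    by (simp add: twist_hopf_def tensor_sum_mult2 m tensor_sum_flip mult.assoc)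
qed

lemma sum_coprod_twist:
  assumes m: "module s"
  shows "tensor_sum s (coprod (twist_hopf H F) h) B =
    tensor_sum s F (\<lambda>x y. tensor_sum s (coprod H h) (\<lambda>a b. tensor_sum s F_inv (\<lambda>u v. B (x * a * u) (y * b * v))))"
  by (simp add: twist_hopf_def tensor_sum_mult2 m)

lemma antipode_twist: "antipode (twist_hopf H F) h = \<beta> * antipode H h * \<gamma>"
  by (simp add: twist_hopf_def ring_inv_beta)

end

section \<open>Twisting bilinear and trilinear maps of modules\<close>

text \<open>The carrier is a set because braided derivations form a submodule of the linear
  endomorphisms inside a single function type, and the maps considered are meaningful on that
  submodule only.\<close>

record ('k, 'h, 'm) hmod =
  mcar :: "'m set"
  mscale :: "'k \<Rightarrow> 'm \<Rightarrow> 'm"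
  mact :: "'h \<Rightarrow> 'm \<Rightarrow> 'm"

definition bimap :: "('k::comm_ring_1, 'h, 'm::ab_group_add) hmod \<Rightarrow> ('k, 'h, 'n::ab_group_add) hmod \<Rightarrow>
    ('k, 'h, 'p::ab_group_add) hmod \<Rightarrow> ('m \<Rightarrow> 'n \<Rightarrow> 'p) \<Rightarrow> bool" where
  "bimap M N P \<phi> \<longleftrightarrow> (\<forall>v\<in>mcar M. \<forall>w\<in>mcar N. \<phi> v w \<in> mcar P) \<and>
     (\<forall>v\<in>mcar M. \<forall>v'\<in>mcar M. \<forall>w\<in>mcar N. \<phi> (v + v') w = \<phi> v w + \<phi> v' w) \<and>
     (\<forall>c. \<forall>v\<in>mcar M. \<forall>w\<in>mcar N. \<phi> (mscale M c v) w = mscale P c (\<phi> v w)) \<and>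
     (\<forall>v\<in>mcar M. \<forall>w\<in>mcar N. \<forall>w'\<in>mcar N. \<phi> v (w + w') = \<phi> v w + \<phi> v w') \<and>
     (\<forall>c. \<forall>v\<in>mcar M. \<forall>w\<in>mcar N. \<phi> v (mscale N c w) = mscale P c (\<phi> v w))"

text \<open>Fixing the first argument gives linearity in the last two; fixing the second supplies
  linearity in the first.\<close>

definition trimap :: "('k::comm_ring_1, 'h, 'm::ab_group_add) hmod \<Rightarrow> ('k, 'h, 'n::ab_group_add) hmod \<Rightarrow>
    ('k, 'h, 'p::ab_group_add) hmod \<Rightarrow> ('k, 'h, 'q::ab_group_add) hmod \<Rightarrow> ('m \<Rightarrow> 'n \<Rightarrow> 'p \<Rightarrow> 'q) \<Rightarrow> bool" where
  "trimap M N P Q T \<longleftrightarrow> (\<forall>v\<in>mcar M. bimap N P Q (T v)) \<and> (\<forall>w\<in>mcar N. bimap M P Q (\<lambda>v z. T v w z))"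

lemma bimapD:
  assumes "bimap M N P \<phi>"
  shows "v \<in> mcar M \<Longrightarrow> w \<in> mcar N \<Longrightarrow> \<phi> v w \<in> mcar P"
    "v \<in> mcar M \<Longrightarrow> v' \<in> mcar M \<Longrightarrow> w \<in> mcar N \<Longrightarrow> \<phi> (v + v') w = \<phi> v w + \<phi> v' w"
    "v \<in> mcar M \<Longrightarrow> w \<in> mcar N \<Longrightarrow> \<phi> (mscale M c v) w = mscale P c (\<phi> v w)"
    "v \<in> mcar M \<Longrightarrow> w \<in> mcar N \<Longrightarrow> w' \<in> mcar N \<Longrightarrow> \<phi> v (w + w') = \<phi> v w + \<phi> v w'"
    "v \<in> mcar M \<Longrightarrow> w \<in> mcar N \<Longrightarrow> \<phi> v (mscale N c w) = mscale P c (\<phi> v w)"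
  using assms unfolding bimap_def by blast+

lemma bimapI:
  assumes "\<And>v w. v \<in> mcar M \<Longrightarrow> w \<in> mcar N \<Longrightarrow> \<phi> v w \<in> mcar P"
    "\<And>v v' w. v \<in> mcar M \<Longrightarrow> v' \<in> mcar M \<Longrightarrow> w \<in> mcar N \<Longrightarrow> \<phi> (v + v') w = \<phi> v w + \<phi> v' w"
    "\<And>c v w. v \<in> mcar M \<Longrightarrow> w \<in> mcar N \<Longrightarrow> \<phi> (mscale M c v) w = mscale P c (\<phi> v w)"
    "\<And>v w w'. v \<in> mcar M \<Longrightarrow> w \<in> mcar N \<Longrightarrow> w' \<in> mcar N \<Longrightarrow> \<phi> v (w + w') = \<phi> v w + \<phi> v w'"
    "\<And>c v w. v \<in> mcar M \<Longrightarrow> w \<in> mcar N \<Longrightarrow> \<phi> v (mscale N c w) = mscale P c (\<phi> v w)"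
  shows "bimap M N P \<phi>"
  using assms unfolding bimap_def by blast

lemma trimapD:
  assumes "trimap M N P Q T"
  shows "v \<in> mcar M \<Longrightarrow> bimap N P Q (T v)" "w \<in> mcar N \<Longrightarrow> bimap M P Q (\<lambda>v z. T v w z)"
  using assms unfolding trimap_def by blast+

lemma trimap_left: "bimap M N P \<phi> \<Longrightarrow> bimap P Q R \<psi> \<Longrightarrow> trimap M N Q R (\<lambda>v w z. \<psi> (\<phi> v w) z)"
  unfolding trimap_def by (intro conjI ballI bimapI) (simp_all add: bimapD)

lemma trimap_right: "bimap N P Q \<phi> \<Longrightarrow> bimap M Q R \<psi> \<Longrightarrow> trimap M N P R (\<lambda>v w z. \<psi> v (\<phi> w z))"
  unfolding trimap_def by (intro conjI ballI bimapI) (simp_all add: bimapD)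

section \<open>Modules over the Hopf algebra and equivariant maps\<close>

context hopf_algebra
begin

definition hmodule :: "('k, 'h, 'm::ab_group_add) hmod \<Rightarrow> bool" where
  "hmodule M \<longleftrightarrow> module (mscale M) \<and> module.subspace (mscale M) (mcar M) \<and>
     (\<forall>x. \<forall>v\<in>mcar M. mact M x v \<in> mcar M) \<and>
     (\<forall>v\<in>mcar M. lin (mscale M) (\<lambda>x. mact M x v)) \<and>
     (\<forall>x. \<forall>v\<in>mcar M. \<forall>w\<in>mcar M. mact M x (v + w) = mact M x v + mact M x w) \<and>
     (\<forall>x c. \<forall>v\<in>mcar M. mact M x (mscale M c v) = mscale M c (mact M x v)) \<and>
     (\<forall>x y. \<forall>v\<in>mcar M. mact M (x * y) v = mact M x (mact M y v)) \<and>
     (\<forall>v\<in>mcar M. mact M 1 v = v)"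

lemma hmoduleD:
  assumes "hmodule M"
  shows "module (mscale M)" "module.subspace (mscale M) (mcar M)"
    "v \<in> mcar M \<Longrightarrow> mact M x v \<in> mcar M"
    "v \<in> mcar M \<Longrightarrow> lin (mscale M) (\<lambda>x. mact M x v)"
    "v \<in> mcar M \<Longrightarrow> w \<in> mcar M \<Longrightarrow> mact M x (v + w) = mact M x v + mact M x w"
    "v \<in> mcar M \<Longrightarrow> mact M x (mscale M c v) = mscale M c (mact M x v)"
    "v \<in> mcar M \<Longrightarrow> mact M (x * y) v = mact M x (mact M y v)"
    "v \<in> mcar M \<Longrightarrow> mact M 1 v = v"
  using assms unfolding hmodule_def by blast+

lemma hmodule_add: "hmodule M \<Longrightarrow> v \<in> mcar M \<Longrightarrow> w \<in> mcar M \<Longrightarrow> v + w \<in> mcar M"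
  using hmoduleD(1,2) module.subspace_add by blast

lemma hmodule_scale: "hmodule M \<Longrightarrow> v \<in> mcar M \<Longrightarrow> mscale M c v \<in> mcar M"
  using hmoduleD(1,2) module.subspace_scale by blast

lemma hmodule_diff: "hmodule M \<Longrightarrow> v \<in> mcar M \<Longrightarrow> w \<in> mcar M \<Longrightarrow> v - w \<in> mcar M"
  using hmoduleD(1,2) module.subspace_diff by blast

lemma hmodule_sum: "hmodule M \<Longrightarrow> (\<And>x y. f x y \<in> mcar M) \<Longrightarrow> tensor_sum (mscale M) t f \<in> mcar M"
  using hmoduleD(1,2) tensor_sum_closed by blast

lemma mact_sum:
  assumes "hmodule M" "\<And>a b. f a b \<in> mcar M"
  shows "mact M x (tensor_sum (mscale M) t f) = tensor_sum (mscale M) t (\<lambda>a b. mact M x (f a b))"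
  using assms(2) by (intro hom_tensor_sum_on[where V = "mcar M"]) (simp_all add: hmoduleD[OF assms(1)])

lemma bimap_sum:
  assumes "hmodule M" "hmodule N" "hmodule P" "bimap M N P \<phi>"
  shows "(\<And>a b. f a b \<in> mcar M) \<Longrightarrow> w \<in> mcar N \<Longrightarrow>
      \<phi> (tensor_sum (mscale M) t f) w = tensor_sum (mscale P) t (\<lambda>a b. \<phi> (f a b) w)"
    and "(\<And>a b. g a b \<in> mcar N) \<Longrightarrow> v \<in> mcar M \<Longrightarrow>
      \<phi> v (tensor_sum (mscale N) t g) = tensor_sum (mscale P) t (\<lambda>a b. \<phi> v (g a b))"
  by (rule hom_tensor_sum_on[where V = "mcar M"]; simp add: hmoduleD assms bimapD[OF assms(4)])
     (rule hom_tensor_sum_on[where V = "mcar N"]; simp add: hmoduleD assms bimapD[OF assms(4)])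

lemma lin_bimap:
  assumes "hmodule M" "hmodule N" "hmodule P" "bimap M N P \<phi>"
  shows "v \<in> mcar M \<Longrightarrow> w \<in> mcar N \<Longrightarrow> lin (mscale P) (\<lambda>h. \<phi> (mact M h v) w)"
    and "v \<in> mcar M \<Longrightarrow> w \<in> mcar N \<Longrightarrow> lin (mscale P) (\<lambda>h. \<phi> v (mact N h w))"
proof -
  show "lin (mscale P) (\<lambda>h. \<phi> (mact M h v) w)" if "v \<in> mcar M" "w \<in> mcar N"
    using that by (intro linI) (simp_all add: hmoduleD assms bimapD[OF assms(4)]
        module_hom.add[OF hmoduleD(4)] module_hom.scale[OF hmoduleD(4)])
  show "lin (mscale P) (\<lambda>h. \<phi> v (mact N h w))" if "v \<in> mcar M" "w \<in> mcar N"
    using that by (intro linI) (simp_all add: hmoduleD assms bimapD[OF assms(4)]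
        module_hom.add[OF hmoduleD(4)] module_hom.scale[OF hmoduleD(4)])
qed

lemma bilin_bimap:
  assumes "hmodule M" "hmodule N" "hmodule P" "bimap M N P \<phi>" "v \<in> mcar M" "w \<in> mcar N"
  shows "bilin (mscale P) (\<lambda>x y. \<phi> (mact M x v) (mact N y w))"
  using assms by (intro bilinI lin_bimap[OF assms(1-4)]) (simp_all add: hmoduleD)

lemma trilin_trimap:
  assumes "hmodule M" "hmodule N" "hmodule P" "hmodule Q" "trimap M N P Q T"
    "v \<in> mcar M" "w \<in> mcar N" "z \<in> mcar P"
  shows "trilin (mscale Q) (\<lambda>x y z'. T (mact M x v) (mact N y w) (mact P z' z))"
proof (rule trilinI)
  show "lin (mscale Q) (\<lambda>x. T (mact M x v) (mact N y w) (mact P z' z))" for y z'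
    by (rule lin_bimap(1)[OF assms(1,3,4) trimapD(2)[OF assms(5)]]) (simp_all add: hmoduleD assms)
  show "lin (mscale Q) (\<lambda>y. T (mact M x v) (mact N y w) (mact P z' z))" for x z'
    by (rule lin_bimap(1)[OF assms(2,3,4) trimapD(1)[OF assms(5)]]) (simp_all add: hmoduleD assms)
  show "lin (mscale Q) (\<lambda>z'. T (mact M x v) (mact N y w) (mact P z' z))" for x y
    by (rule lin_bimap(2)[OF assms(2,3,4) trimapD(1)[OF assms(5)]]) (simp_all add: hmoduleD assms)
qed

definition equivariant :: "('k, 'h, 'm::ab_group_add) hmod \<Rightarrow> ('k, 'h, 'n::ab_group_add) hmod \<Rightarrow>
    ('k, 'h, 'p::ab_group_add) hmod \<Rightarrow> ('m \<Rightarrow> 'n \<Rightarrow> 'p) \<Rightarrow> bool" where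
  "equivariant M N P \<phi> \<longleftrightarrow> bimap M N P \<phi> \<and> (\<forall>x. \<forall>v\<in>mcar M. \<forall>w\<in>mcar N.
     mact P x (\<phi> v w) = tensor_sum (mscale P) (coprod H x) (\<lambda>a b. \<phi> (mact M a v) (mact N b w)))"

lemma equivariantD:
  assumes "equivariant M N P \<phi>"
  shows "bimap M N P \<phi>"
    "v \<in> mcar M \<Longrightarrow> w \<in> mcar N \<Longrightarrow>
     mact P x (\<phi> v w) = tensor_sum (mscale P) (coprod H x) (\<lambda>a b. \<phi> (mact M a v) (mact N b w))"
  using assms unfolding equivariant_def by blast+

lemma bimap_diff:
  assumes "hmodule P" "bimap M N P \<phi>" "bimap M N P \<psi>"
  shows "bimap M N P (\<lambda>v w. \<phi> v w - \<psi> v w)"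
  by (rule bimapI) (simp_all add: bimapD[OF assms(2)] bimapD[OF assms(3)] hmodule_diff assms
     hmoduleD module.scale_right_diff_distrib)

lemma equivariant_diff:
  assumes "hmodule M" "hmodule N" "hmodule P" "equivariant M N P \<phi>" "equivariant M N P \<psi>"
  shows "equivariant M N P (\<lambda>v w. \<phi> v w - \<psi> v w)"
  unfolding equivariant_def
proof (intro conjI allI ballI bimap_diff equivariantD(1) assms)
  note b = bimapD(1)[OF equivariantD(1)[OF assms(4)]] bimapD(1)[OF equivariantD(1)[OF assms(5)]]
  fix x v w assume vw: "v \<in> mcar M" "w \<in> mcar N"
  have "mact P x ((\<phi> v w - \<psi> v w) + \<psi> v w) = mact P x (\<phi> v w - \<psi> v w) + mact P x (\<psi> v w)"
    by (intro hmoduleD(5) hmodule_diff assms b vw)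
  then show "mact P x (\<phi> v w - \<psi> v w) =
      tensor_sum (mscale P) (coprod H x) (\<lambda>a c. \<phi> (mact M a v) (mact N c w) - \<psi> (mact M a v) (mact N c w))"
    using vw by (simp add: tensor_sum_diff hmoduleD assms equivariantD(2)[OF assms(4)] equivariantD(2)[OF assms(5)])
qed

lemma equivariant_restrict:
  assumes e: "equivariant M N P \<phi>" and "mcar M' \<subseteq> mcar M" "mscale M' = mscale M" "mact M' = mact M"
    and "mcar N' \<subseteq> mcar N" "mscale N' = mscale N" "mact N' = mact N"
    and "mscale P' = mscale P" "mact P' = mact P"
    and "\<And>v w. v \<in> mcar M' \<Longrightarrow> w \<in> mcar N' \<Longrightarrow> \<phi> v w \<in> mcar P'"
  shows "equivariant M' N' P' \<phi>"
  unfolding equivariant_def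
proof (intro conjI allI ballI)
  note b = bimapD[OF equivariantD(1)[OF e]]
  have sub: "v \<in> mcar M' \<Longrightarrow> v \<in> mcar M" "w \<in> mcar N' \<Longrightarrow> w \<in> mcar N" for v w
    using assms by auto
  show "bimap M' N' P' \<phi>"
    using assms by (intro bimapI) (simp_all add: sub b)
  show "mact P' x (\<phi> v w) = tensor_sum (mscale P') (coprod H x) (\<lambda>a b. \<phi> (mact M' a v) (mact N' b w))"
    if "v \<in> mcar M'" "w \<in> mcar N'" for x v w
    using equivariantD(2)[OF e sub(1)[OF that(1)] sub(2)[OF that(2)]] assms by simp
qed

lemma trimap_diff_add:
  assumes "hmodule Q" "trimap M N P Q T" "trimap M N P Q T'"
  shows "trimap M N P Q (\<lambda>v w z. T v w z - T' v w z)" "trimap M N P Q (\<lambda>v w z. T v w z + T' v w z)"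
  unfolding trimap_def
  by (intro conjI ballI bimapI; simp add: bimapD[OF trimapD(1)[OF assms(2)]] bimapD[OF trimapD(2)[OF assms(2)]]
    bimapD[OF trimapD(1)[OF assms(3)]] bimapD[OF trimapD(2)[OF assms(3)]] hmodule_diff hmodule_add assms
    module.scale_right_diff_distrib[OF hmoduleD(1)[OF assms(1)]]
    module.scale_right_distrib[OF hmoduleD(1)[OF assms(1)]])+

text \<open>Expanding the right-hand side by equivariance produces x_1 v and x_2 S(x_3) w, which
  contracts. The identity takes the action off the first argument, at the price of an antipode on
  the second and an action on the value.\<close>

lemma equivariant_act_left:
  assumes h: "hmodule M" "hmodule N" "hmodule P" and e: "equivariant M N P \<phi>"
    and vw: "v \<in> mcar M" "w \<in> mcar N"
  shows "\<phi> (mact M x v) w =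
    tensor_sum (mscale P) (coprod H x) (\<lambda>a b. mact P a (\<phi> v (mact N (antipode H b) w)))"
proof -
  note m = hmoduleD(1)[OF h(3)] and be = equivariantD(1)[OF e]
  let ?S = "antipode H"
  have B: "bilin (mscale P) (\<lambda>x y. \<phi> (mact M x v) (mact N y w))"
    by (rule bilin_bimap[OF h be vw])
  note [linear_intros] = bilin_lin[OF B]
  have "tensor_sum (mscale P) (coprod H x) (\<lambda>a b. mact P a (\<phi> v (mact N (?S b) w)))
    = tensor_sum (mscale P) (coprod H x) (\<lambda>a b. tensor_sum (mscale P) (coprod H a) (\<lambda>c d.
        \<phi> (mact M c v) (mact N (d * ?S b) w)))"
    using vw h by (simp add: equivariantD[OF e] hmoduleD)
  also have "\<dots> = tensor_sum (mscale P) (coprod H x) (\<lambda>a b. tensor_sum (mscale P) (coprod H b) (\<lambda>c d.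
        \<phi> (mact M a v) (mact N (c * ?S d) w)))"
    by (rule sum_coassoc[OF m]) (intro linear_intros)
  also have "\<dots> = tensor_sum (mscale P) (coprod H x) (\<lambda>a b. mscale P (counit H b) (\<phi> (mact M a v) (mact N 1 w)))"
    by (subst sum_antipode_right[where f = "\<lambda>u. \<phi> (mact M _ v) (mact N u w)"]) (intro linear_intros refl)+
  also have "\<dots> = \<phi> (mact M x v) (mact N 1 w)"
    by (rule sum_counit_right) (intro linear_intros)
  finally show ?thesis using vw h by (simp add: hmoduleD)
qed

definition tensor_apply :: "('k, 'h) tensor2 \<Rightarrow> ('k, 'h, 'm::ab_group_add) hmod \<Rightarrow> ('k, 'h, 'n::ab_group_add) hmod \<Rightarrow>
    ('k, 'h, 'p::ab_group_add) hmod \<Rightarrow> ('m \<Rightarrow> 'n \<Rightarrow> 'p) \<Rightarrow> ('m \<Rightarrow> 'n \<Rightarrow> 'p)" where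
  "tensor_apply t M N P \<phi> v w = tensor_sum (mscale P) t (\<lambda>x y. \<phi> (mact M x v) (mact N y w))"

lemma bimap_tensor_apply:
  assumes "hmodule M" "hmodule N" "hmodule P" "bimap M N P \<phi>"
  shows "bimap M N P (tensor_apply t M N P \<phi>)"
  unfolding tensor_apply_def
  by (rule bimapI) (simp_all add: hmodule_sum bimapD[OF assms(4)] assms hmoduleD[OF assms(1)]
     hmoduleD[OF assms(2)] hmoduleD(1)[OF assms(3)] tensor_sum_add tensor_sum_scale[OF hmoduleD(1)[OF assms(3)]])

text \<open>Acting on arguments reverses composition: \<open>t\<close> inside and \<open>u\<close>
  outside amount to the action of the product t u.\<close>

lemma tensor_apply_inverse:
  assumes "hmodule M" "hmodule N" "hmodule P" "bimap M N P \<phi>" "is_tensor_inverse (hscale H) t u"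
    and "v \<in> mcar M" "w \<in> mcar N"
  shows "tensor_apply u M N P (tensor_apply t M N P \<phi>) v w = \<phi> v w"
proof -
  note m = hmoduleD(1)[OF assms(3)]
  have "tensor_apply u M N P (tensor_apply t M N P \<phi>) v w =
    tensor_sum (mscale P) t (\<lambda>x' y'. tensor_sum (mscale P) u (\<lambda>x y.
        \<phi> (mact M (x' * x) v) (mact N (y' * y) w)))"
    unfolding tensor_apply_def
    by (subst tensor_sum_swap[OF m]) (simp add: hmoduleD assms)
  also have "\<dots> = \<phi> (mact M 1 v) (mact N 1 w)"
    by (rule sum_tensor_inverse[OF assms(5) m bilin_bimap[OF assms(1-4,6,7)]])
  finally show ?thesis using assms by (simp add: hmoduleD)
qed

end

section \<open>Braiding of bilinear maps\<close>

context triangular_hopf_algebra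
begin

text \<open>Composition with the braiding of the two modules. All braided terms have this form: the
  right action on vector fields is the braid of \<open>lmul\<close>, and the second term of the
  commutator is the braid of composition.\<close>

definition braid :: "('a, 'b, 'm::ab_group_add) hmod \<Rightarrow> ('a, 'b, 'n::ab_group_add) hmod \<Rightarrow>
    ('a, 'b, 'p::ab_group_add) hmod \<Rightarrow> ('m \<Rightarrow> 'n \<Rightarrow> 'p) \<Rightarrow> ('n \<Rightarrow> 'm \<Rightarrow> 'p)" where
  "braid M N P \<phi> w v = tensor_sum (mscale P) (rmat_inv H) (\<lambda>r q. \<phi> (mact M r v) (mact N q w))"

lemma bimap_braid:
  assumes "hmodule M" "hmodule N" "hmodule P" "bimap M N P \<phi>"
  shows "bimap N M P (braid M N P \<phi>)"
  using bimap_tensor_apply[OF assms, of "rmat_inv H"]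
  unfolding bimap_def tensor_apply_def braid_def by simp

text \<open>The exchanged arguments call for the opposite coproduct, and
  \<open>sum_rmat_inv_coprod_swap\<close> supplies it.\<close>

lemma equivariant_braid:
  assumes "hmodule M" "hmodule N" "hmodule P" and e: "equivariant M N P \<phi>"
  shows "equivariant N M P (braid M N P \<phi>)"
  unfolding equivariant_def
proof (intro conjI allI ballI)
  show "bimap N M P (braid M N P \<phi>)"
    using assms by (intro bimap_braid) (simp_all add: equivariantD)
  fix x w v assume w: "w \<in> mcar N" and v: "v \<in> mcar M"
  note m = hmoduleD(1)[OF assms(3)] and b = equivariantD(1)[OF e]
  have B: "bilin (mscale P) (\<lambda>x y. \<phi> (mact M x v) (mact N y w))"
    by (rule bilin_bimap[OF assms(1-3) b v w])
  have "mact P x (braid M N P \<phi> w v) = tensor_sum (mscale P) (rmat_inv H) (\<lambda>r q.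
      tensor_sum (mscale P) (coprod H x) (\<lambda>a c. \<phi> (mact M (a * r) v) (mact N (c * q) w)))"
    unfolding braid_def using v w
    by (subst mact_sum[OF assms(3)]) (simp_all add: equivariantD[OF e] bimapD[OF b] assms hmoduleD)
  also have "\<dots> = tensor_sum (mscale P) (coprod H x) (\<lambda>a c. tensor_sum (mscale P) (rmat_inv H) (\<lambda>r q.
      \<phi> (mact M (a * r) v) (mact N (c * q) w)))"
    by (rule tensor_sum_swap[OF m])
  also have "\<dots> = tensor_sum (mscale P) (rmat_inv H) (\<lambda>r q.
      tensor_sum (mscale P) (coprod H x) (\<lambda>a c. \<phi> (mact M (r * c) v) (mact N (q * a) w)))"
    by (rule sum_rmat_inv_coprod_swap[OF m B, symmetric])
  also have "\<dots> = tensor_sum (mscale P) (coprod H x) (\<lambda>a c. braid M N P \<phi> (mact N a w) (mact M c v))"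
    unfolding braid_def using v w by (subst tensor_sum_swap[OF m]) (simp add: hmoduleD assms)
  finally show "mact P x (braid M N P \<phi> w v) =
    tensor_sum (mscale P) (coprod H x) (\<lambda>a c. braid M N P \<phi> (mact N a w) (mact M c v))" .
qed

lemma trimap_braid:
  assumes "hmodule M" "hmodule N" "hmodule P" "hmodule Q" "trimap M N P Q T"
  shows "trimap N M P Q (\<lambda>w v z. braid M N Q (\<lambda>v w. T v w z) w v)"
  unfolding trimap_def braid_def
  by (intro conjI ballI bimapI)
   (simp_all add: hmodule_sum bimapD[OF trimapD(1)[OF assms(5)]] bimapD[OF trimapD(2)[OF assms(5)]]
    assms hmoduleD[OF assms(1)] hmoduleD[OF assms(2)] hmoduleD(1)[OF assms(4)]
    tensor_sum_add tensor_sum_scale[OF hmoduleD(1)[OF assms(4)]])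

end

section \<open>Twisting bilinear and trilinear maps\<close>

context twisted_hopf_algebra
begin

abbreviation tw where "tw \<equiv> tensor_apply F_inv"

lemma bimap_tw_iff_eq_zero:
  assumes "hmodule M" "hmodule N" "hmodule P" "bimap M N P \<phi>"
  shows "(\<forall>v\<in>mcar M. \<forall>w\<in>mcar N. tw M N P \<phi> v w = 0) \<longleftrightarrow> (\<forall>v\<in>mcar M. \<forall>w\<in>mcar N. \<phi> v w = 0)"
proof
  assume *: "\<forall>v\<in>mcar M. \<forall>w\<in>mcar N. tw M N P \<phi> v w = 0"
  show "\<forall>v\<in>mcar M. \<forall>w\<in>mcar N. \<phi> v w = 0"
  proof (intro ballI)
    fix v w assume "v \<in> mcar M" "w \<in> mcar N"
    with tensor_apply_inverse[OF assms is_tensor_inverse_sym[OF F_inverse] this] *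
    show "\<phi> v w = 0"
      by (simp add: tensor_apply_def[of F] hmoduleD assms)
  qed
qed (simp add: tensor_apply_def hmoduleD assms)

text \<open>The F^-1 brought in by \<open>tw\<close> meets the leading F of the twisted coproduct
  and cancels it. What remains is the original coproduct followed by F^-1.\<close>

lemma tw_coprod:
  assumes "hmodule M" "hmodule N" "hmodule P" "bimap M N P \<phi>" "v \<in> mcar M" "w \<in> mcar N"
  shows "tensor_sum (mscale P) (coprod (twist_hopf H F) x) (\<lambda>a b. tw M N P \<phi> (mact M a v) (mact N b w))
    = tensor_sum (mscale P) (coprod H x) (\<lambda>a b. tw M N P (\<lambda>v w. \<phi> (mact M a v) (mact N b w)) v w)"
proof -
  note m = hmoduleD(1)[OF assms(3)]
  note [linear_intros] = bilin_lin[OF bilin_bimap[OF assms]]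
  have "tensor_sum (mscale P) (coprod (twist_hopf H F) x) (\<lambda>a b. tw M N P \<phi> (mact M a v) (mact N b w))
    = tensor_sum (mscale P) F (\<lambda>x1 y1. tensor_sum (mscale P) (coprod H x) (\<lambda>a b. tensor_sum (mscale P) F_inv (\<lambda>u u'.
        tensor_sum (mscale P) F_inv (\<lambda>p q. \<phi> (mact M (p * x1 * (a * u)) v) (mact N (q * y1 * (b * u')) w)))))"
    using assms by (simp add: sum_coprod_twist[OF m] tensor_apply_def hmoduleD)
  also have "\<dots> = tensor_sum (mscale P) F_inv (\<lambda>p q. tensor_sum (mscale P) F (\<lambda>x1 y1. tensor_sum (mscale P) (coprod H x) (\<lambda>a b.
        tensor_sum (mscale P) F_inv (\<lambda>u u'. \<phi> (mact M (p * x1 * (a * u)) v) (mact N (q * y1 * (b * u')) w)))))"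
    by (subst tensor_sum_swap[OF m, of F_inv F], subst tensor_sum_swap[OF m, of F_inv "coprod H x"],
        subst tensor_sum_swap[OF m, of F_inv F_inv]) (rule refl)
  also have "\<dots> = tensor_sum (mscale P) (coprod H x) (\<lambda>a b. tensor_sum (mscale P) F_inv (\<lambda>u u'.
        \<phi> (mact M (1 * (a * u)) v) (mact N (1 * (b * u')) w)))"
    by (rule sum_F_inv_F[OF m, where B = "\<lambda>x y. tensor_sum (mscale P) (coprod H _) (\<lambda>a b.
        tensor_sum (mscale P) F_inv (\<lambda>u u'. \<phi> (mact M (x * (a * u)) v) (mact N (y * (b * u')) w)))"])
      (intro linear_intros m)
  finally show ?thesis using assms by (simp add: tensor_apply_def hmoduleD)
qed

text \<open>For each x the defect \<open>?\<delta> x\<close> of equivariance is bilinear, and its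
  twist is the defect of the twisted map, so the two vanish together. Assuming only bilinearity of
  the map allows its equivariance to be deduced from the twisted side.\<close>

lemma equivariant_tw_iff:
  assumes "hmodule M" "hmodule N" "hmodule P" "bimap M N P \<phi>"
  shows "(\<forall>x. \<forall>v\<in>mcar M. \<forall>w\<in>mcar N. mact P x (tw M N P \<phi> v w) =
      tensor_sum (mscale P) (coprod (twist_hopf H F) x) (\<lambda>a b. tw M N P \<phi> (mact M a v) (mact N b w)))
    \<longleftrightarrow> equivariant M N P \<phi>"
proof -
  note m = hmoduleD(1)[OF assms(3)]
  let ?\<delta> = "\<lambda>x v w. mact P x (\<phi> v w) - tensor_sum (mscale P) (coprod H x) (\<lambda>a b. \<phi> (mact M a v) (mact N b w))"
  have b: "bimap M N P (?\<delta> x)" for x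
    using bimap_tensor_apply[OF assms, of "coprod H x"]
    unfolding tensor_apply_def bimap_def
    by (simp add: bimapD[OF assms(4)] assms hmoduleD hmodule_diff module.scale_right_diff_distrib)
  have "mact P x (tw M N P \<phi> v w) - tensor_sum (mscale P) (coprod (twist_hopf H F) x) (\<lambda>a b. tw M N P \<phi> (mact M a v) (mact N b w))
      = tw M N P (?\<delta> x) v w" if "v \<in> mcar M" "w \<in> mcar N" for x v w
    using that unfolding tw_coprod[OF assms that] unfolding tensor_apply_def
    by (subst mact_sum, simp_all add: assms bimapD[OF assms(4)] hmoduleD tensor_sum_diff m,
        subst tensor_sum_swap[OF m]) simp
  then have "(\<forall>x. \<forall>v\<in>mcar M. \<forall>w\<in>mcar N. mact P x (tw M N P \<phi> v w) =
      tensor_sum (mscale P) (coprod (twist_hopf H F) x) (\<lambda>a b. tw M N P \<phi> (mact M a v) (mact N b w)))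
    \<longleftrightarrow> (\<forall>x. \<forall>v\<in>mcar M. \<forall>w\<in>mcar N. tw M N P (?\<delta> x) v w = 0)"
    by (metis (no_types, lifting) eq_iff_diff_eq_0)
  also have "\<dots> \<longleftrightarrow> (\<forall>x. \<forall>v\<in>mcar M. \<forall>w\<in>mcar N. ?\<delta> x v w = 0)"
    by (simp only: bimap_tw_iff_eq_zero[OF assms(1-3) b])
  also have "\<dots> \<longleftrightarrow> equivariant M N P \<phi>"
    using assms(4) by (simp add: equivariant_def)
  finally show ?thesis .
qed

text \<open>Of the three factors of the twisted inverse R-matrix, the first cancels against the
  twist of the map. The last has its legs exchanged, and so becomes the twist of the braided map,
  whose arguments come in the opposite order.\<close>

lemma sum_rmat_inv_tw:
  assumes "hmodule M" "hmodule N" "hmodule P" "bimap N M P \<phi>" "v \<in> mcar M" "w \<in> mcar N"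
  shows "tensor_sum (mscale P) (rmat_inv (twist_hopf H F)) (\<lambda>r q. tw N M P \<phi> (mact N r w) (mact M q v))
    = tw M N P (braid N M P \<phi>) v w"
proof -
  note m = hmoduleD(1)[OF assms(3)]
  note [linear_intros] = bilin_lin[OF bilin_bimap[OF assms(2,1,3,4,6,5)]]
  have "tensor_sum (mscale P) (rmat_inv (twist_hopf H F)) (\<lambda>r q. tw N M P \<phi> (mact N r w) (mact M q v))
    = tensor_sum (mscale P) (rmat_inv (twist_hopf H F)) (\<lambda>r q.
        tensor_sum (mscale P) F_inv (\<lambda>a b. \<phi> (mact N (a * r) w) (mact M (b * q) v)))"
    using assms by (simp add: tensor_apply_def hmoduleD)
  also have "\<dots> = tensor_sum (mscale P) F (\<lambda>x y. tensor_sum (mscale P) (rmat_inv H) (\<lambda>r q.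
      tensor_sum (mscale P) F_inv (\<lambda>p q'. tensor_sum (mscale P) F_inv (\<lambda>a b.
        \<phi> (mact N (a * x * (r * q')) w) (mact M (b * y * (q * p)) v)))))"
    by (subst sum_rmat_inv_twist[OF m]) (intro linear_intros m | simp add: mult.assoc)+
  also have "\<dots> = tensor_sum (mscale P) F_inv (\<lambda>a b. tensor_sum (mscale P) F (\<lambda>x y.
      tensor_sum (mscale P) (rmat_inv H) (\<lambda>r q. tensor_sum (mscale P) F_inv (\<lambda>p q'.
        \<phi> (mact N (a * x * (r * q')) w) (mact M (b * y * (q * p)) v)))))"
    by (subst tensor_sum_swap[OF m, of F_inv F], subst tensor_sum_swap[OF m, of F_inv "rmat_inv H"],
        subst tensor_sum_swap[OF m, of F_inv F_inv]) (rule refl)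
  also have "\<dots> = tensor_sum (mscale P) (rmat_inv H) (\<lambda>r q. tensor_sum (mscale P) F_inv (\<lambda>p q'.
        \<phi> (mact N (1 * (r * q')) w) (mact M (1 * (q * p)) v)))"
    by (rule sum_F_inv_F[OF m, where B = "\<lambda>x y. tensor_sum (mscale P) (rmat_inv H) (\<lambda>r q. tensor_sum (mscale P) F_inv (\<lambda>p q'.
        \<phi> (mact N (x * (r * q')) w) (mact M (y * (q * p)) v)))"])
      (intro linear_intros m)
  also have "\<dots> = tw M N P (braid N M P \<phi>) v w"
    using assms by (subst tensor_sum_swap[OF m]) (simp add: tensor_apply_def braid_def hmoduleD)
  finally show ?thesis .
qed

definition tw3 :: "('k, 'h, 'm::ab_group_add) hmod \<Rightarrow> ('k, 'h, 'n::ab_group_add) hmod \<Rightarrow>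
    ('k, 'h, 'p::ab_group_add) hmod \<Rightarrow> ('k, 'h, 'q::ab_group_add) hmod \<Rightarrow>
    ('m \<Rightarrow> 'n \<Rightarrow> 'p \<Rightarrow> 'q) \<Rightarrow> ('m \<Rightarrow> 'n \<Rightarrow> 'p \<Rightarrow> 'q)" where
  "tw3 M N P Q T v w z =
     cocycle_inv (mscale Q) (\<lambda>x y u. T (mact M x v) (mact N y w) (mact P u z))"

lemma cocycle_inv_sum:
  assumes m: "module s"
  shows "cocycle_inv s (\<lambda>x y z. tensor_sum s t (\<lambda>a b. f a b x y z)) =
    tensor_sum s t (\<lambda>a b. cocycle_inv s (f a b))"
  unfolding cocycle_inv_def
  by (subst tensor_sum_swap[OF m, of t F_inv], subst tensor_sum_swap[OF m, of t "coprod H _"],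
        subst tensor_sum_swap[OF m, of t F_inv]) (rule refl)

lemma tw3_add_diff:
  assumes "module (mscale Q)"
  shows "tw3 M N P Q (\<lambda>v w z. T v w z + T' v w z) v w z = tw3 M N P Q T v w z + tw3 M N P Q T' v w z"
    "tw3 M N P Q (\<lambda>v w z. T v w z - T' v w z) v w z = tw3 M N P Q T v w z - tw3 M N P Q T' v w z"
  by (simp_all add: tw3_def cocycle_inv_def tensor_sum_add tensor_sum_diff assms)

text \<open>A twist that vanishes everywhere vanishes in particular at arguments displaced by the
  cocycle. Summing these values returns \<open>T\<close> by
  \<open>cocycle_inv_cocycle\<close>.\<close>

lemma tw3_eq_zero_iff:
  assumes "hmodule M" "hmodule N" "hmodule P" "hmodule Q" "trimap M N P Q T"
  shows "(\<forall>v\<in>mcar M. \<forall>w\<in>mcar N. \<forall>z\<in>mcar P. tw3 M N P Q T v w z = 0) \<longleftrightarrow>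
    (\<forall>v\<in>mcar M. \<forall>w\<in>mcar N. \<forall>z\<in>mcar P. T v w z = 0)"
proof
  note m = hmoduleD(1)[OF assms(4)]
  assume *: "\<forall>v\<in>mcar M. \<forall>w\<in>mcar N. \<forall>z\<in>mcar P. tw3 M N P Q T v w z = 0"
  show "\<forall>v\<in>mcar M. \<forall>w\<in>mcar N. \<forall>z\<in>mcar P. T v w z = 0"
  proof (intro ballI)
    fix v w z assume vwz: "v \<in> mcar M" "w \<in> mcar N" "z \<in> mcar P"
    have **: "cocycle_inv (mscale Q) (\<lambda>x' y' z'. T (mact M (x' * x) v) (mact N (y' * y) w) (mact P (z' * u) z)) = 0" for x y u
      using *[rule_format, of "mact M x v" "mact N y w" "mact P u z"] vwz
      by (simp add: tw3_def hmoduleD assms)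
    have "T v w z = T (mact M 1 v) (mact N 1 w) (mact P 1 z)"
      using vwz assms by (simp add: hmoduleD)
    also have "\<dots> = 0"
      by (subst cocycle_inv_cocycle[OF m trilin_trimap[OF assms vwz], symmetric])
        (simp add: cocycle_inv_sum[OF m] ** m)
    finally show "T v w z = 0" .
  qed
qed (simp add: tw3_def cocycle_inv_def hmoduleD assms)

lemma tw3_eq_iff:
  assumes "hmodule M" "hmodule N" "hmodule P" "hmodule Q" "trimap M N P Q T" "trimap M N P Q T'"
  shows "(\<forall>v\<in>mcar M. \<forall>w\<in>mcar N. \<forall>z\<in>mcar P. tw3 M N P Q T v w z = tw3 M N P Q T' v w z) \<longleftrightarrow>
    (\<forall>v\<in>mcar M. \<forall>w\<in>mcar N. \<forall>z\<in>mcar P. T v w z = T' v w z)"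
  using tw3_eq_zero_iff[OF assms(1-4) trimap_diff_add(1)[OF assms(4-6)]]
  by (simp add: tw3_add_diff hmoduleD assms)

lemma tw3_eq_add_iff:
  assumes "hmodule M" "hmodule N" "hmodule P" "hmodule Q" "trimap M N P Q T" "trimap M N P Q T1" "trimap M N P Q T2"
  shows "(\<forall>v\<in>mcar M. \<forall>w\<in>mcar N. \<forall>z\<in>mcar P. tw3 M N P Q T v w z = tw3 M N P Q T1 v w z + tw3 M N P Q T2 v w z) \<longleftrightarrow>
    (\<forall>v\<in>mcar M. \<forall>w\<in>mcar N. \<forall>z\<in>mcar P. T v w z = T1 v w z + T2 v w z)"
  using tw3_eq_iff[OF assms(1-5) trimap_diff_add(2)[OF assms(4,6,7)]]
  by (simp add: tw3_add_diff hmoduleD assms)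

text \<open>The leg of the outer twist that acts on the value of the inner map is distributed over
  its arguments by equivariance; this is the coproduct in \<open>cocycle_inv\<close>. The outer map
  need only be bilinear.\<close>

lemma tw_tw_left:
  assumes "hmodule M" "hmodule N" "hmodule P" "hmodule Q" "hmodule R"
    and e: "equivariant M N Q \<phi>" and b: "bimap Q P R \<psi>" and vwz: "v \<in> mcar M" "w \<in> mcar N" "z \<in> mcar P"
  shows "tw Q P R \<psi> (tw M N Q \<phi> v w) z = tw3 M N P R (\<lambda>v w z. \<psi> (\<phi> v w) z) v w z"
proof -
  note h = assms(1-5) and be = bimapD[OF equivariantD(1)[OF e]]
  have 1: "mact Q x (tw M N Q \<phi> v w) = tensor_sum (mscale Q) F_inv (\<lambda>p q. tensor_sum (mscale Q) (coprod H x) (\<lambda>a b.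
     \<phi> (mact M (a * p) v) (mact N (b * q) w)))" for x
    unfolding tensor_apply_def
    by (subst mact_sum) (simp_all add: h be vwz hmoduleD equivariantD[OF e])
  have "\<psi> (mact Q x (tw M N Q \<phi> v w)) (mact P y z) = tensor_sum (mscale R) F_inv (\<lambda>p q.
     tensor_sum (mscale R) (coprod H x) (\<lambda>a b. \<psi> (\<phi> (mact M (a * p) v) (mact N (b * q) w)) (mact P y z)))" for x y
    unfolding 1
    by (subst bimap_sum(1)[OF h(4,3,5) b] | intro hmodule_sum h be hmoduleD(3) vwz refl)+
  then show ?thesis
    unfolding tensor_apply_def[of _ Q] tw3_def cocycle_inv_def
    by (simp add: tensor_sum_swap[OF hmoduleD(1)[OF h(5)], of "coprod H _" F_inv])
qed

text \<open>With the inner map on the right the other form \<open>cocycle_inv'\<close> appears. The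
  passage to \<open>tw3\<close> by \<open>cocycle_inv_eq\<close> is where the cocycle condition
  makes both bracketings agree.\<close>

lemma tw_tw_right:
  assumes "hmodule M" "hmodule N" "hmodule P" "hmodule Q" "hmodule R"
    and e: "equivariant N P Q \<phi>" and b: "bimap M Q R \<psi>" and vwz: "v \<in> mcar M" "w \<in> mcar N" "z \<in> mcar P"
  shows "tw M Q R \<psi> v (tw N P Q \<phi> w z) = tw3 M N P R (\<lambda>v w z. \<psi> v (\<phi> w z)) v w z"
proof -
  note h = assms(1-5) and be = bimapD[OF equivariantD(1)[OF e]]
  have 1: "mact Q x (tw N P Q \<phi> w z) = tensor_sum (mscale Q) F_inv (\<lambda>p q. tensor_sum (mscale Q) (coprod H x) (\<lambda>a b.
     \<phi> (mact N (a * p) w) (mact P (b * q) z)))" for x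
    unfolding tensor_apply_def
    by (subst mact_sum) (simp_all add: h be vwz hmoduleD equivariantD[OF e])
  have "\<psi> (mact M y v) (mact Q x (tw N P Q \<phi> w z)) = tensor_sum (mscale R) F_inv (\<lambda>p q.
     tensor_sum (mscale R) (coprod H x) (\<lambda>a b. \<psi> (mact M y v) (\<phi> (mact N (a * p) w) (mact P (b * q) z))))" for x y
    unfolding 1
    by (subst bimap_sum(2)[OF h(1,4,5) b] | intro hmodule_sum h be hmoduleD(3) vwz refl)+
  then have "tw M Q R \<psi> v (tw N P Q \<phi> w z) =
    cocycle_inv' (mscale R) (\<lambda>x y u. \<psi> (mact M x v) (\<phi> (mact N y w) (mact P u z)))"
    unfolding tensor_apply_def[of _ M] cocycle_inv'_def
    by (simp add: tensor_sum_swap[OF hmoduleD(1)[OF h(5)], of "coprod H _" F_inv])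
  also have "\<dots> = tw3 M N P R (\<lambda>v w z. \<psi> v (\<phi> w z)) v w z"
    unfolding tw3_def
    by (intro cocycle_inv_eq[symmetric] hmoduleD h
        trilin_trimap[OF h(1-3,5) trimap_right[OF equivariantD(1)[OF e] b] vwz])
  finally show ?thesis .
qed

text \<open>The F of the twisted inverse R-matrix cancels as in \<open>sum_rmat_inv_tw\<close>, but
  a coproduct coming from the cocycle still stands in front of R^-1. It is carried across by
  \<open>sum_rmat_inv_coprod_swap\<close>, which exchanges its legs together with the
  arguments.\<close>

lemma sum_rmat_inv_tw3:
  assumes "hmodule M" "hmodule N" "hmodule P" "hmodule Q" "trimap N M P Q T"
    and vwz: "v \<in> mcar M" "w \<in> mcar N" "z \<in> mcar P"
  shows "tensor_sum (mscale Q) (rmat_inv (twist_hopf H F)) (\<lambda>r q. tw3 N M P Q T (mact N r w) (mact M q v) z)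
    = tw3 M N P Q (\<lambda>v w z. braid N M Q (\<lambda>w v. T w v z) v w) v w z"
proof -
  let ?E = "tensor_sum (mscale Q)"
  note m = hmoduleD(1)[OF assms(4)]
  note [linear_intros] = trilin_lin[OF trilin_trimap[OF assms(2,1,3-5) vwz(2,1,3)]]
  have "?E (rmat_inv (twist_hopf H F)) (\<lambda>r q. tw3 N M P Q T (mact N r w) (mact M q v) z)
    = ?E (rmat_inv (twist_hopf H F)) (\<lambda>r q. ?E F_inv (\<lambda>x y. ?E (coprod H x) (\<lambda>a b.
     ?E F_inv (\<lambda>p p'. T (mact N (a * p * r) w) (mact M (b * p' * q) v) (mact P y z)))))"
    using assms by (simp add: tw3_def cocycle_inv_def hmoduleD)
  also have "\<dots> = ?E F (\<lambda>f f'. ?E (rmat_inv H) (\<lambda>r q. ?E F_inv (\<lambda>g g'.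
      ?E F_inv (\<lambda>x y. ?E (coprod H x) (\<lambda>a b. ?E F_inv (\<lambda>p p'.
        T (mact N (a * (p * f) * (r * g')) w) (mact M (b * (p' * f') * (q * g)) v) (mact P y z)))))))"
    by (subst sum_rmat_inv_twist[OF m]) (intro linear_intros m | simp add: mult.assoc)+
  also have "\<dots> = ?E (rmat_inv H) (\<lambda>r q. ?E F_inv (\<lambda>g g'.
      ?E F_inv (\<lambda>x y. ?E (coprod H x) (\<lambda>a b. ?E F_inv (\<lambda>p p'. ?E F (\<lambda>f f'.
        T (mact N (a * (p * f) * (r * g')) w) (mact M (b * (p' * f') * (q * g)) v) (mact P y z)))))))"
    by (simp add: tensor_sum_swap[OF m, of F])
  also have "\<dots> = ?E (rmat_inv H) (\<lambda>r q. ?E F_inv (\<lambda>g g'.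
      ?E F_inv (\<lambda>x y. ?E (coprod H x) (\<lambda>a b.
        T (mact N (a * 1 * (r * g')) w) (mact M (b * 1 * (q * g)) v) (mact P y z)))))"
    by (subst sum_F_inv_F[OF m, where B = "\<lambda>x y. T (mact N (_ * x * _) w) (mact M (_ * y * _) v) (mact P _ z)"])
      (intro linear_intros refl)+
  also have "\<dots> = ?E F_inv (\<lambda>x y. ?E F_inv (\<lambda>g g'. ?E (coprod H x) (\<lambda>a b. ?E (rmat_inv H) (\<lambda>r q.
        T (mact N (a * r * g') w) (mact M (b * q * g) v) (mact P y z)))))"
    by (subst tensor_sum_swap[OF m, of F_inv F_inv])
      (simp add: mult.assoc tensor_sum_swap[OF m, of "rmat_inv H"])
  also have "\<dots> = ?E F_inv (\<lambda>x y. ?E F_inv (\<lambda>g g'. ?E (rmat_inv H) (\<lambda>r q. ?E (coprod H x) (\<lambda>a b.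
        T (mact N (r * b * g') w) (mact M (q * a * g) v) (mact P y z)))))"
    by (subst sum_rmat_inv_coprod_swap[OF m, where B = "\<lambda>x y. T (mact N (x * _) w) (mact M (y * _) v) (mact P _ z)"])
      (intro linear_intros refl)+
  also have "\<dots> = ?E F_inv (\<lambda>x y. ?E (coprod H x) (\<lambda>a b. ?E F_inv (\<lambda>g g'. ?E (rmat_inv H) (\<lambda>r q.
        T (mact N (r * b * g') w) (mact M (q * a * g) v) (mact P y z)))))"
    by (simp add: tensor_sum_swap[OF m, of _ "coprod H _"])
  also have "\<dots> = tw3 M N P Q (\<lambda>v w z. braid N M Q (\<lambda>w v. T w v z) v w) v w z"
    using assms by (simp add: tw3_def cocycle_inv_def braid_def hmoduleD)
  finally show ?thesis .
qed

end

section \<open>Braided derivations\<close>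

lemma module_vscale:
  assumes "module (ascale A)"
  shows "module (vscale A)"
proof -
  interpret module "ascale A" by fact
  show ?thesis
    by unfold_locales (auto simp: vscale_def fun_eq_iff scale_right_distrib scale_left_distrib)
qed

lemma sum_fun_apply: "(\<Sum>i\<in>K. g i) a = (\<Sum>i\<in>K. g i a)"
  for g :: "'i \<Rightarrow> 'j \<Rightarrow> 'l::comm_monoid_add"
  by (induction K rule: infinite_finite_induct) auto

lemma vscale_apply: "vscale A c X a = ascale A c (X a)"
  by (simp add: vscale_def)

lemma tensor_sum_vscale:
  "tensor_sum (vscale A) t f = (\<lambda>a. tensor_sum (ascale A) t (\<lambda>x y. f x y a))"
  by (simp add: tensor_sum_def case_prod_unfold vscale_def fun_eq_iff sum_fun_apply)

context twisted_hopf_algebra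
begin

text \<open>All action on \<open>v\<close> is removed by \<open>equivariant_act_left\<close>, and
  \<open>sum_F_inv_antipode\<close> then evaluates the sum. For fixed \<open>v\<close> the twist
  thus becomes an operation on the single map w to phi(v, w).\<close>

lemma tw_eq_antipode:
  assumes h: "hmodule M" "hmodule N" "hmodule P" and e: "equivariant M N P \<phi>"
    and vw: "v \<in> mcar M" "w \<in> mcar N"
  shows "tw M N P \<phi> v w =
    tensor_sum (mscale P) F (\<lambda>x y. mact P x (\<phi> v (mact N (antipode H y * \<gamma>) w)))"
proof -
  note m = hmoduleD(1)[OF h(3)] and be = bimapD[OF equivariantD(1)[OF e]]
  have B: "bilin (mscale P) (\<lambda>x y. mact P x (\<phi> v (mact N y w)))"
  proof (intro bilinI)
    show "lin (mscale P) (\<lambda>y. mact P x (\<phi> v (mact N y w)))" for x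
      using vw h by (intro linI m)
        (simp_all add: hmoduleD be module_hom.add[OF hmoduleD(4)] module_hom.scale[OF hmoduleD(4)])
    show "lin (mscale P) (\<lambda>x. mact P x (\<phi> v (mact N y w)))" for y
      using vw h by (simp add: hmoduleD be)
  qed
  have "tw M N P \<phi> v w = tensor_sum (mscale P) F_inv (\<lambda>x y. tensor_sum (mscale P) (coprod H x) (\<lambda>a b.
      mact P a (\<phi> v (mact N (antipode H b * y) w))))"
    using vw h by (simp add: tensor_apply_def equivariant_act_left[OF h e] hmoduleD)
  also have "\<dots> = tensor_sum (mscale P) F (\<lambda>x y. mact P x (\<phi> v (mact N (antipode H y * \<gamma>) w)))"
    by (rule sum_F_inv_antipode[OF m B])
  finally show ?thesis .
qed

text \<open>Inside the double sum S(y) \<open>\<gamma>\<close> \<open>\<beta>\<close> S(q) equals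
  S(q y), since the two constants cancel, so F^-1 F = 1 applies.\<close>

lemma tw_left_inverse:
  assumes h: "hmodule M" "hmodule N" "hmodule P" and e: "equivariant M N P \<phi>"
    and vw: "v \<in> mcar M" "w \<in> mcar N"
  shows "tensor_sum (mscale P) F_inv (\<lambda>p q. mact P p (tw M N P \<phi> v (mact N (\<beta> * antipode H q) w))) = \<phi> v w"
proof -
  note m = hmoduleD(1)[OF h(3)] and be = bimapD[OF equivariantD(1)[OF e]]
  have B: "bilin (mscale P) (\<lambda>x y. mact P x (\<phi> v (mact N (antipode H y) w)))"
  proof (intro bilinI)
    show "lin (mscale P) (\<lambda>y. mact P x (\<phi> v (mact N (antipode H y) w)))" for x
      using vw h by (intro linI m)
        (simp_all add: hmoduleD be module_hom.add[OF hmoduleD(4)] module_hom.scale[OF hmoduleD(4)]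
          module_hom.add[OF antipode_linear] module_hom.scale[OF antipode_linear])
    show "lin (mscale P) (\<lambda>x. mact P x (\<phi> v (mact N (antipode H y) w)))" for y
      using vw h by (simp add: hmoduleD be)
  qed
  have "antipode H y * \<gamma> * (\<beta> * antipode H q) = antipode H y * (\<gamma> * \<beta>) * antipode H q" for q y
    by (simp only: mult.assoc)
  then have *: "mact N (antipode H y * \<gamma>) (mact N (\<beta> * antipode H q) w) = mact N (antipode H (q * y)) w" for q y
    using hmoduleD(7)[OF h(2) vw(2), symmetric] by (simp add: gamma_beta antipode_mult)
  have **: "tw M N P \<phi> v (mact N (\<beta> * antipode H q) w) =
     tensor_sum (mscale P) F (\<lambda>x y. mact P x (\<phi> v (mact N (antipode H (q * y)) w)))" for q
    using vw h by (subst tw_eq_antipode[OF h e]) (simp_all add: hmoduleD(3) *)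
  have "tensor_sum (mscale P) F_inv (\<lambda>p q. mact P p (tw M N P \<phi> v (mact N (\<beta> * antipode H q) w)))
    = tensor_sum (mscale P) F_inv (\<lambda>p q. tensor_sum (mscale P) F (\<lambda>x y.
        mact P (p * x) (\<phi> v (mact N (antipode H (q * y)) w))))"
    using vw h unfolding ** by (subst mact_sum[OF h(3)]) (simp_all add: hmoduleD be)
  also have "\<dots> = mact P 1 (\<phi> v (mact N (antipode H 1) w))"
    by (rule sum_F_inv_F[OF m B])
  finally show ?thesis using vw h by (simp add: hmoduleD be antipode_one)
qed

text \<open>In contrast to \<open>bimap_tw_iff_eq_zero\<close>, the first argument is fixed. This is
  what allows the Leibniz rule to be transported for one vector field at a time.\<close>

lemma tw_eq_zero_right_iff:
  assumes h: "hmodule M" "hmodule N" "hmodule P" and e: "equivariant M N P \<phi>" and v: "v \<in> mcar M"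
  shows "(\<forall>w\<in>mcar N. tw M N P \<phi> v w = 0) \<longleftrightarrow> (\<forall>w\<in>mcar N. \<phi> v w = 0)"
proof -
  have 0: "mact P x 0 = 0" for x
    using hmoduleD(6)[OF h(3) module.subspace_0[OF hmoduleD(1,2)[OF h(3)]], of x 0]
    by (simp add: module.scale_zero_left[OF hmoduleD(1)[OF h(3)]])
  have "\<phi> v w = 0" if "\<forall>w\<in>mcar N. tw M N P \<phi> v w = 0" "w \<in> mcar N" for w
    using tw_left_inverse[OF h e v that(2)] that h by (simp add: hmoduleD 0)
  moreover have "tw M N P \<phi> v w = 0" if "\<forall>w\<in>mcar N. \<phi> v w = 0" "w \<in> mcar N" for w
    using tw_eq_antipode[OF h e v that(2)] that h by (simp add: hmoduleD 0)
  ultimately show ?thesis by blast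
qed

end

section \<open>The algebra, its endomorphisms and its braided derivations as modules\<close>

locale twisted_algebra = twisted_hopf_algebra H F + braided_commutative_algebra H A
  for H :: "('k::comm_ring_1, 'h::ring_1) hopf_data" and F and A :: "('k, 'h, 'a::ab_group_add) algebra_data"
begin

definition Alg :: "('k, 'h, 'a) hmod" where
  "Alg = \<lparr>mcar = UNIV, mscale = ascale A, mact = act A\<rparr>"

text \<open>The Leibniz rule itself has to be carried across the twist, so the action and the twist
  are studied on all linear endomorphisms before derivations are singled out.\<close>

definition End :: "('k, 'h, 'a \<Rightarrow> 'a) hmod" where
  "End = \<lparr>mcar = {X. module_hom (ascale A) (ascale A) X}, mscale = vscale A, mact = vact H A\<rparr>"

definition Der :: "('k, 'h, 'a \<Rightarrow> 'a) hmod" where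
  "Der = \<lparr>mcar = vector_fields H A, mscale = vscale A, mact = vact H A\<rparr>"

lemma Alg_simps [simp]: "mcar Alg = UNIV" "mscale Alg = ascale A" "mact Alg = act A"
  by (simp_all add: Alg_def)

lemma End_simps [simp]: "mcar End = {X. module_hom (ascale A) (ascale A) X}" "mscale End = vscale A"
    "mact End = vact H A"
  by (simp_all add: End_def)

lemma Der_simps [simp]: "mcar Der = vector_fields H A" "mscale Der = vscale A" "mact Der = vact H A"
  by (simp_all add: Der_def)

lemmas vmodule = module_vscale[OF amodule]

lemma hom_linI: "module_hom (ascale A) (ascale A) X \<Longrightarrow> lin (ascale A) f \<Longrightarrow> lin (ascale A) (\<lambda>h. X (f h))"
  using module_hom_compose[of "hscale H" "ascale A" f "ascale A" X] by (simp add: o_def)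

lemma lin_act [linear_intros]: "lin (hscale H) g \<Longrightarrow> lin (ascale A) (\<lambda>h. act A (g h) a)"
  by (rule lin_compose[OF act_linear_left])

lemmas [linear_intros] = hom_linI[OF act_linear_right] hom_linI[OF amult_linear_left] hom_linI[OF amult_linear_right]

lemma hmodule_Alg: "hmodule Alg"
  unfolding hmodule_def
  by (auto simp: amodule module.subspace_UNIV act_linear_left act_mult act_one
      module_hom.add[OF act_linear_right] module_hom.scale[OF act_linear_right])

lemma act_sum: "act A x (tensor_sum (ascale A) t f) = tensor_sum (ascale A) t (\<lambda>a b. act A x (f a b))"
  by (rule hom_tensor_sum[OF act_linear_right])

lemma vact_apply: "vact H A x X a = tensor_sum (ascale A) (coprod H x) (\<lambda>b c. act A b (X (act A (antipode H c) a)))"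
  by (simp add: vact_def)

lemma hom_iff: "module_hom (ascale A) (ascale A) X \<longleftrightarrow>
    (\<forall>a b. X (a + b) = X a + X b) \<and> (\<forall>c a. X (ascale A c a) = ascale A c (X a))"
  by (simp add: module_hom_def module_hom_axioms_def amodule)

lemma module_hom_vact:
  assumes "module_hom (ascale A) (ascale A) X"
  shows "module_hom (ascale A) (ascale A) (vact H A x X)"
  using assms unfolding hom_iff vact_apply
  by (simp add: module_hom.add[OF act_linear_right] module_hom.scale[OF act_linear_right]
     tensor_sum_add[OF amodule] tensor_sum_scale[OF amodule])

lemma vact_linear_right: "module_hom (vscale A) (vscale A) (vact H A x)"
  by (simp add: module_hom_def module_hom_axioms_def vmodule fun_eq_iff vact_apply vscale_def
      module_hom.add[OF act_linear_right] module_hom.scale[OF act_linear_right]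
     tensor_sum_add[OF amodule] tensor_sum_scale[OF amodule])

lemma hmodule_End: "hmodule End"
proof -
  have "vact H A (x * y) X = vact H A x (vact H A y X)" if X: "module_hom (ascale A) (ascale A) X" for x y X
    unfolding vact_def[of H A "x * y"]
    by (subst sum_coprod_mult)
     (intro linear_intros hom_linI[OF X] amodule
      | simp add: vact_def[of _ _ x] vact_def[of _ _ y] act_sum act_mult antipode_mult)+
  moreover have "vact H A 1 X = X" if X: "module_hom (ascale A) (ascale A) X" for X
    unfolding vact_def
    by (subst sum_coprod_one)
     (intro linear_intros hom_linI[OF X] amodule | simp add: act_one antipode_one)+
  moreover have "lin (vscale A) (\<lambda>x. vact H A x X)" if X: "module_hom (ascale A) (ascale A) X" for X
  proof -
    have "lin (ascale A) (\<lambda>x. vact H A x X a)" for a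
      unfolding vact_apply by (intro linear_intros hom_linI[OF X] amodule)
    from module_hom.add[OF this] module_hom.scale[OF this] show ?thesis
      by (intro linI vmodule) (simp_all add: fun_eq_iff vscale_def)
  qed
  moreover have "module.subspace (vscale A) {X. module_hom (ascale A) (ascale A) X}"
    unfolding module.subspace_def[OF vmodule]
    by (auto simp: hom_iff vscale_def module.scale_right_distrib[OF amodule]
       module.scale_zero_right[OF amodule]
        module.scale_scale[OF amodule] algebra_simps)
  ultimately show ?thesis
    unfolding hmodule_def using vmodule module_hom_vact
      module_hom.add[OF vact_linear_right] module_hom.scale[OF vact_linear_right]
    by simp
qed

text \<open>In x_1 X(S(x_2) x_3 a) the antipode built into the adjoint action contracts with the
  part of x acting on the argument.\<close>

lemma equivariant_eval: "equivariant End Alg Alg (\<lambda>X a. X a)"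
  unfolding equivariant_def
proof (intro conjI allI ballI)
  show "bimap End Alg Alg (\<lambda>X a. X a)"
    by (rule bimapI) (auto simp: hom_iff vscale_def)
  fix x X a assume "X \<in> mcar End" "a \<in> mcar Alg"
  then have X: "module_hom (ascale A) (ascale A) X" by simp
  note [linear_intros] = hom_linI[OF X]
  have "tensor_sum (ascale A) (coprod H x) (\<lambda>b c. vact H A b X (act A c a))
    = tensor_sum (ascale A) (coprod H x) (\<lambda>b c. tensor_sum (ascale A) (coprod H b) (\<lambda>d e.
         act A d (X (act A (antipode H e * c) a))))"
    by (simp add: vact_apply act_mult)
  also have "\<dots> = tensor_sum (ascale A) (coprod H x) (\<lambda>b c. tensor_sum (ascale A) (coprod H c) (\<lambda>d e.
         act A b (X (act A (antipode H d * e) a))))"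
    by (rule sum_coassoc[OF amodule]) (intro linear_intros amodule)
  also have "\<dots> = tensor_sum (ascale A) (coprod H x) (\<lambda>b c. ascale A (counit H c) (act A b (X (act A 1 a))))"
    by (subst sum_antipode_left[where f = "\<lambda>h. act A _ (X (act A h a))"]) (intro linear_intros amodule refl)+
  also have "\<dots> = act A x (X (act A 1 a))"
    by (rule sum_counit_right) (intro linear_intros)
  finally show "mact Alg x (X a) = tensor_sum (mscale Alg) (coprod H x) (\<lambda>b c. mact End b X (mact Alg c a))"
    by (simp add: act_one)
qed

lemma equivariant_amult: "equivariant Alg Alg Alg (amult A)"
  by (auto simp: equivariant_def act_amult intro!: bimapI module_hom.add[OF amult_linear_left]
     module_hom.add[OF amult_linear_right] module_hom.scale[OF amult_linear_left]
     module_hom.scale[OF amult_linear_right])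

text \<open>Applying an equivariant map after an endomorphism covers two cases at once: the left
  action of the algebra and composition of endomorphisms.\<close>

lemma equivariant_compose:
  assumes h: "hmodule M" and e: "equivariant M Alg Alg \<phi>"
  shows "equivariant M End End (\<lambda>v Y a. \<phi> v (Y a))"
  unfolding equivariant_def
proof (intro conjI allI ballI)
  note be = bimapD[OF equivariantD(1)[OF e], simplified]
  show "bimap M End End (\<lambda>v Y a. \<phi> v (Y a))"
    by (rule bimapI) (simp_all add: fun_eq_iff vscale_def be hom_iff)
  fix x v Y assume v: "v \<in> mcar M" and "Y \<in> mcar End"
  then have Y: "module_hom (ascale A) (ascale A) Y" by simp
  have *: "module_hom (ascale A) (ascale A) (\<phi> v)" if "v \<in> mcar M" for v
    using that by (simp add: hom_iff be)
  show "mact End x (\<lambda>a. \<phi> v (Y a)) =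
    tensor_sum (mscale End) (coprod H x) (\<lambda>b c a. \<phi> (mact M b v) (mact End c Y a))"
  proof
    fix a
    have T: "trilin (ascale A) (\<lambda>b c d. \<phi> (mact M b v) (act A c (Y (act A (antipode H d) a))))"
    proof (rule trilinI)
      show "lin (ascale A) (\<lambda>b. \<phi> (mact M b v) (act A c (Y (act A (antipode H d) a))))" for c d
        using lin_bimap(1)[OF h hmodule_Alg hmodule_Alg equivariantD(1)[OF e] v] by simp
    qed (intro linear_intros hom_linI[OF *[OF hmoduleD(3)[OF h v]]] hom_linI[OF Y])+
    have "mact End x (\<lambda>a. \<phi> v (Y a)) a = tensor_sum (ascale A) (coprod H x) (\<lambda>b c.
       tensor_sum (ascale A) (coprod H b) (\<lambda>d e. \<phi> (mact M d v) (act A e (Y (act A (antipode H c) a)))))"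
      using v by (simp add: vact_apply equivariantD(2)[OF e, simplified])
    also have "\<dots> = tensor_sum (ascale A) (coprod H x) (\<lambda>b c.
       tensor_sum (ascale A) (coprod H c) (\<lambda>d e. \<phi> (mact M b v) (act A d (Y (act A (antipode H e) a)))))"
      by (rule sum_coassoc[OF amodule T])
    also have "\<dots> = tensor_sum (mscale End) (coprod H x) (\<lambda>b c a. \<phi> (mact M b v) (mact End c Y a)) a"
      by (simp add: tensor_sum_vscale vact_apply hom_tensor_sum[OF *[OF hmoduleD(3)[OF h v]]])
    finally show "mact End x (\<lambda>a. \<phi> v (Y a)) a = \<dots>" .
  qed
qed

lemma equivariant_lmul: "equivariant Alg End End (lmul A)"
  using equivariant_compose[OF hmodule_Alg equivariant_amult] by (simp add: lmul_def[abs_def])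

lemma equivariant_comp: "equivariant End End End (\<circ>)"
  using equivariant_compose[OF hmodule_End equivariant_eval] by (simp add: comp_def[abs_def])

lemma amult_End: "amult A a \<in> mcar End"
  by (simp add: amult_linear_right)

text \<open>Equivariance of the product gives the parts (x_1 a) and x_2 S(x_3) c, and the latter
  contract. Multiplication operators can therefore stand for elements of the algebra inside
  \<open>End\<close>.\<close>

lemma vact_amult: "vact H A x (amult A a) = amult A (act A x a)"
proof
  fix c
  have "vact H A x (amult A a) c = tensor_sum (ascale A) (coprod H x) (\<lambda>b d. tensor_sum (ascale A) (coprod H b) (\<lambda>e f.
      amult A (act A e a) (act A (f * antipode H d) c)))"
    by (simp add: vact_apply act_amult act_mult)
  also have "\<dots> = tensor_sum (ascale A) (coprod H x) (\<lambda>b d. tensor_sum (ascale A) (coprod H d) (\<lambda>e f.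
      amult A (act A b a) (act A (e * antipode H f) c)))"
    by (rule sum_coassoc[OF amodule]) (intro linear_intros)
  also have "\<dots> = tensor_sum (ascale A) (coprod H x) (\<lambda>b d. ascale A (counit H d) (amult A (act A b a) (act A 1 c)))"
    by (subst sum_antipode_right[where f = "\<lambda>h. amult A _ (act A h c)"]) (intro linear_intros refl)+
  also have "\<dots> = amult A (act A x a) (act A 1 c)"
    by (rule sum_counit_right) (intro linear_intros)
  finally show "vact H A x (amult A a) c = amult A (act A x a) c"
    by (simp add: act_one)
qed

text \<open>
  The values lie in \<open>End\<close> instead of \<open>\<A>\<close>, so that the defect of the Leibniz rule is an equivariant
  map in only two variables.
\<close>

definition leibniz_defect :: "('a \<Rightarrow> 'a) \<Rightarrow> 'a \<Rightarrow> 'a \<Rightarrow> 'a" where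
  "leibniz_defect X a = (X \<circ> amult A a) - amult A (X a) - braid Alg End End (lmul A) X a"

lemma braid_lmul_apply:
  "braid Alg End End (lmul A) X a b =
     tensor_sum (ascale A) (rmat_inv H) (\<lambda>r q. amult A (act A r a) (vact H A q X b))"
  by (simp add: braid_def tensor_sum_vscale lmul_def)

lemma vector_fields_iff:
  "X \<in> vector_fields H A \<longleftrightarrow> X \<in> mcar End \<and> (\<forall>a. leibniz_defect X a = 0)"
  by (auto simp: vector_fields_def leibniz_defect_def fun_eq_iff braid_lmul_apply algebra_simps)

lemma equivariant_leibniz_defect: "equivariant End Alg End leibniz_defect"
proof -
  have 1: "equivariant End Alg End (\<lambda>X a. X \<circ> amult A a)"
    unfolding equivariant_def
  proof (intro conjI allI ballI)
    show "bimap End Alg End (\<lambda>X a. X \<circ> amult A a)"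
      by (rule bimapI) (auto simp: hom_iff fun_eq_iff vscale_def
         module_hom.add[OF amult_linear_left] module_hom.add[OF amult_linear_right]
         module_hom.scale[OF amult_linear_left] module_hom.scale[OF amult_linear_right])
    show "mact End x (X \<circ> amult A a) = tensor_sum (mscale End) (coprod H x) (\<lambda>b c. mact End b X \<circ> amult A (mact Alg c a))"
      if "X \<in> mcar End" for x X a
      using equivariantD(2)[OF equivariant_comp that amult_End] by (simp add: vact_amult)
  qed
  have 2: "equivariant End Alg End (\<lambda>X a. amult A (X a))"
    unfolding equivariant_def
  proof (intro conjI allI ballI)
    show "bimap End Alg End (\<lambda>X a. amult A (X a))"
      by (rule bimapI) (auto simp: hom_iff fun_eq_iff vscale_def
         module_hom.add[OF amult_linear_left] module_hom.add[OF amult_linear_right]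
         module_hom.scale[OF amult_linear_left] module_hom.scale[OF amult_linear_right])
    show "mact End x (amult A (X a)) = tensor_sum (mscale End) (coprod H x) (\<lambda>b c. amult A (mact End b X (mact Alg c a)))"
      if "X \<in> mcar End" for x X a
      using equivariantD(2)[OF equivariant_eval that]
      by (simp add: vact_amult tensor_sum_vscale fun_eq_iff hom_tensor_sum[OF amult_linear_left])
  qed
  have "equivariant End Alg End (\<lambda>X a. (X \<circ> amult A a) - amult A (X a) - braid Alg End End (lmul A) X a)"
    by (intro equivariant_diff equivariant_braid equivariant_lmul hmodule_Alg hmodule_End 1 2)
  then show ?thesis by (simp add: leibniz_defect_def[abs_def])
qed

text \<open>By \<open>equivariant_act_left\<close> the Leibniz defect of x X at a is a sum of x_1
  applied to the defects of X at S(x_2) a, all of which vanish.\<close>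

lemma hmodule_Der: "hmodule Der"
proof -
  note b = bimapD[OF equivariantD(1)[OF equivariant_leibniz_defect], simplified]
  have act: "vact H A x X \<in> vector_fields H A" if "X \<in> vector_fields H A" for x X
  proof -
    have "leibniz_defect (vact H A x X) a = tensor_sum (vscale A) (coprod H x) (\<lambda>b c.
       vact H A b (leibniz_defect X (act A (antipode H c) a)))" for a
      using equivariant_act_left[OF hmodule_End hmodule_Alg hmodule_End equivariant_leibniz_defect, of X a] that
      by (simp add: vector_fields_iff)
    with that show ?thesis
      by (simp add: vector_fields_iff module_hom_vact module_hom.zero[OF vact_linear_right] vmodule)
  qed
  have "module.subspace (vscale A) (vector_fields H A)"
    unfolding module.subspace_def[OF vmodule]
  proof (intro conjI ballI allI)
    have 0: "0 \<in> mcar End"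
      using module.subspace_0[OF hmoduleD(1,2)[OF hmodule_End]] .
    moreover have "leibniz_defect (vscale A 0 0) a = vscale A 0 (leibniz_defect 0 a)" for a
      using 0 by (intro b(3)) simp
    ultimately show "0 \<in> vector_fields H A"
      by (simp add: vector_fields_iff module.scale_zero_left[OF vmodule])
  qed (use hmodule_add[OF hmodule_End] hmodule_scale[OF hmodule_End] in
      \<open>auto simp: vector_fields_iff b module.scale_zero_right[OF vmodule]\<close>)
  then show ?thesis
    using hmoduleD[OF hmodule_End] act unfolding hmodule_def by (simp add: vector_fields_iff)
qed

lemma Der_subset_End: "mcar Der \<subseteq> mcar End"
  by (auto simp: vector_fields_iff)

text \<open>In the braided term of the Leibniz rule, the action on a X distributes over a and X, and
  \<open>sum_rmat_inv_coprod_right\<close> splits R^-1 into two copies. One copy moves a past b by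
  braided commutativity; the other is the braided term for X.\<close>

lemma lmul_Der:
  assumes X: "X \<in> vector_fields H A"
  shows "lmul A a X \<in> vector_fields H A"
proof -
  have XE: "module_hom (ascale A) (ascale A) X" using X by (simp add: vector_fields_def)
  have L: "X (amult A b c) = amult A (X b) c + tensor_sum (ascale A) (rmat_inv H) (\<lambda>r q. amult A (act A r b) (vact H A q X c))" for b c
    using X by (simp add: vector_fields_def)
  have twist: "tensor_sum (ascale A) (rmat_inv H) (\<lambda>r q. amult A (act A r b) (vact H A q (lmul A a X) c)) =
     amult A a (tensor_sum (ascale A) (rmat_inv H) (\<lambda>r q. amult A (act A r b) (vact H A q X c)))" for b c
  proof -
    have lv: "lin (ascale A) (\<lambda>q. vact H A q X c)"
      unfolding vact_apply by (intro linear_intros hom_linI[OF XE] amodule)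
    note [linear_intros] = lin_compose[OF lv]
    have "vact H A q (lmul A a X) c = tensor_sum (ascale A) (coprod H q) (\<lambda>x y. amult A (act A x a) (vact H A y X c))" for q
      using equivariantD(2)[OF equivariant_lmul, of a X q] XE
      by (simp add: tensor_sum_vscale lmul_def)
    then have "tensor_sum (ascale A) (rmat_inv H) (\<lambda>r q. amult A (act A r b) (vact H A q (lmul A a X) c))
      = tensor_sum (ascale A) (rmat_inv H) (\<lambda>r q. tensor_sum (ascale A) (coprod H q) (\<lambda>x y.
          amult A (amult A (act A r b) (act A x a)) (vact H A y X c)))"
      by (simp add: hom_tensor_sum[OF amult_linear_right] amult_assoc)
    also have "\<dots> = tensor_sum (ascale A) (rmat_inv H) (\<lambda>r q. tensor_sum (ascale A) (rmat_inv H) (\<lambda>r' q'.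
          amult A (amult A (act A (r * r') b) (act A q a)) (vact H A q' X c)))"
      by (rule sum_rmat_inv_coprod_right[OF amodule]) (intro linear_intros)
    also have "\<dots> = tensor_sum (ascale A) (rmat_inv H) (\<lambda>r' q'. tensor_sum (ascale A) (rmat_inv H) (\<lambda>r q.
          amult A (amult A (act A r (act A r' b)) (act A q a)) (vact H A q' X c)))"
      by (subst tensor_sum_swap[OF amodule]) (simp add: act_mult)
    also have "\<dots> = tensor_sum (ascale A) (rmat_inv H) (\<lambda>r' q'. amult A (amult A a (act A r' b)) (vact H A q' X c))"
      \<comment> \<open>The inner sum is the braided form of the product of a with r' b.\<close>
      unfolding braided_commutative[of a] by (simp add: hom_tensor_sum[OF amult_linear_left])
    finally show ?thesis
      by (simp add: hom_tensor_sum[OF amult_linear_right] amult_assoc)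
  qed
  have hom: "module_hom (ascale A) (ascale A) (lmul A a X)"
    using bimapD(1)[OF equivariantD(1)[OF equivariant_lmul], of a X] XE by simp
  have leibniz: "lmul A a X (amult A b c) = amult A (lmul A a X b) c +
      amult A a (tensor_sum (ascale A) (rmat_inv H) (\<lambda>r q. amult A (act A r b) (vact H A q X c)))" for b c
    by (simp only: lmul_def L amult_assoc module_hom.add[OF amult_linear_right])
  show ?thesis
    unfolding vector_fields_def mem_Collect_eq using hom by (simp only: leibniz twist simp_thms)
qed

lemma equivariant_Der:
  "equivariant Alg Der Der (lmul A)" "equivariant Der Der End (\<circ>)" "equivariant Der Alg Alg (\<lambda>X a. X a)"
  using Der_subset_End bimapD(1)[OF equivariantD(1)[OF equivariant_comp]]
  by (auto intro: equivariant_restrict[OF equivariant_lmul] equivariant_restrict[OF equivariant_comp]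
    equivariant_restrict[OF equivariant_eval] simp: lmul_Der subset_iff)

end

section \<open>Vector fields of the twisted algebra\<close>

context twisted_algebra
begin

abbreviation "H\<^sub>F \<equiv> twist_hopf H F"
abbreviation "A\<^sub>F \<equiv> twist_algebra H F A"
abbreviation "\<Phi> \<equiv> twist_field H F A"

lemma twist_simps [simp]: "ascale A\<^sub>F = ascale A" "act A\<^sub>F = act A" "vscale A\<^sub>F = vscale A"
  "amult A\<^sub>F = tw Alg Alg Alg (amult A)" "hscale H\<^sub>F = hscale H"
  by (simp_all add: twist_algebra_def twist_hopf_def vscale_def[abs_def] tensor_apply_def[abs_def])

lemma twist_field_eq: "\<Phi> X a = tw End Alg Alg (\<lambda>X a. X a) X a"
  by (simp add: twist_field_def tensor_apply_def)

lemma twist_field_eq_Der: "\<Phi> X a = tw Der Alg Alg (\<lambda>X a. X a) X a"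
  by (simp add: twist_field_def tensor_apply_def)

lemma twist_field_linear: "module_hom (vscale A) (vscale A) \<Phi>"
proof -
  have "vact H A x (X + Y) a = vact H A x X a + vact H A x Y a"
    "vact H A x (vscale A c X) a = ascale A c (vact H A x X a)" for x X Y a c
    using module_hom.add[OF vact_linear_right] module_hom.scale[OF vact_linear_right]
    by (simp_all add: fun_eq_iff vscale_apply)
  then show ?thesis
    by (simp add: module_hom_def module_hom_axioms_def vmodule twist_field_def fun_eq_iff
      tensor_sum_add[OF amodule] tensor_sum_scale[OF amodule] vscale_apply)
qed

lemma twist_field_End:
  assumes "X \<in> mcar End"
  shows "\<Phi> X \<in> mcar End"
proof -
  note b = bimapD[OF bimap_tensor_apply[where t = F_inv, OF hmodule_End hmodule_Alg hmodule_Alg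
      equivariantD(1)[OF equivariant_eval]]]
  show ?thesis
    using b(4)[OF assms] b(5)[OF assms]
    by (simp add: hom_iff twist_field_eq)
qed

lemma untwist_formula:
  assumes "X \<in> mcar End"
  shows "tensor_sum (ascale A) F_inv (\<lambda>p q. act A p (\<Phi> X (act A (\<beta> * antipode H q) a))) = X a"
  using tw_left_inverse[OF hmodule_End hmodule_Alg hmodule_Alg equivariant_eval assms, of a]
  by (simp add: twist_field_eq)

lemma twist_formula:
  assumes "X \<in> mcar End"
  shows "\<Phi> X a = tensor_sum (ascale A) F (\<lambda>x y. act A x (X (act A (antipode H y * \<gamma>) a)))"
  using tw_eq_antipode[OF hmodule_End hmodule_Alg hmodule_Alg equivariant_eval assms, of a]
  by (simp add: twist_field_eq)

lemma inj_on_twist_field: "inj_on \<Phi> (mcar End)"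
proof (intro inj_onI ext)
  fix X Y a assume "X \<in> mcar End" "Y \<in> mcar End" "\<Phi> X = \<Phi> Y"
  then show "X a = Y a"
    using untwist_formula[of X a] untwist_formula[of Y a] by simp
qed

text \<open>The expression in \<open>untwist_formula\<close> makes sense for every linear
  \<open>Z\<close>. Injectivity of \<open>\<Phi>\<close> used that \<open>\<gamma>\<close> times
  \<open>\<beta>\<close> is 1; here the product in the other order is what disappears.\<close>

lemma twist_field_surj:
  assumes Z: "module_hom (ascale A) (ascale A) Z"
  obtains X where "X \<in> mcar End" "\<Phi> X = Z"
proof
  let ?X = "\<lambda>a. tensor_sum (ascale A) F_inv (\<lambda>p q. act A p (Z (act A (\<beta> * antipode H q) a)))"
  note [linear_intros] = hom_linI[OF Z]
  show X: "?X \<in> mcar End"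
    using Z by (simp add: hom_iff module_hom.add[OF act_linear_right] module_hom.scale[OF act_linear_right]
     tensor_sum_add[OF amodule] tensor_sum_scale[OF amodule])
  show "\<Phi> ?X = Z"
  proof
    fix a
    have "\<Phi> ?X a = tensor_sum (ascale A) F (\<lambda>x y. tensor_sum (ascale A) F_inv (\<lambda>p q.
        act A (x * p) (Z (act A (\<beta> * antipode H (y * q) * \<gamma>) a))))"
      unfolding twist_formula[OF X] by (simp add: act_sum act_mult antipode_mult)
    also have "\<dots> = act A 1 (Z (act A (\<beta> * antipode H 1 * \<gamma>) a))"
      by (rule sum_F_F_inv[OF amodule, where B = "\<lambda>u v. act A u (Z (act A (\<beta> * antipode H v * \<gamma>) a))"])
        (intro linear_intros)
    finally show "\<Phi> ?X a = Z a" by (simp add: act_one antipode_one beta_gamma)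
  qed
qed

text \<open>Written out, the twisted adjoint action consists of three layers. The innermost, with
  F^-1 and \<open>\<beta>\<close>, recovers X by \<open>untwist_formula\<close>; the coproduct of x
  then forms the original action; the outer F and \<open>\<gamma>\<close> form \<open>\<Phi>\<close>
  again.\<close>

lemma vact_twist_field:
  assumes X: "X \<in> mcar End"
  shows "vact H\<^sub>F A\<^sub>F x (\<Phi> X) = \<Phi> (vact H A x X)"
proof
  fix a
  have "vact H\<^sub>F A\<^sub>F x (\<Phi> X) a = tensor_sum (ascale A) F (\<lambda>u v. tensor_sum (ascale A) (coprod H x) (\<lambda>b c.
      act A u (act A b (tensor_sum (ascale A) F_inv (\<lambda>p q. act A p (\<Phi> X (act A (\<beta> * antipode H q)
        (act A (antipode H c) (act A (antipode H v * \<gamma>) a)))))))))"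
    by (simp add: vact_def sum_coprod_twist[OF amodule] antipode_twist antipode_mult act_mult act_sum)
  also have "\<dots> = tensor_sum (ascale A) F (\<lambda>u v. act A u (vact H A x X (act A (antipode H v * \<gamma>) a)))"
    by (simp only: untwist_formula[OF X] vact_apply act_sum)
  also have "\<dots> = \<Phi> (vact H A x X) a"
    using hmoduleD(3)[OF hmodule_End X] by (subst twist_formula) simp_all
  finally show "vact H\<^sub>F A\<^sub>F x (\<Phi> X) a = \<Phi> (vact H A x X) a" .
qed

text \<open>Each term of the twisted Leibniz rule is the \<open>tw3\<close> of the corresponding
  untwisted term, seen as a trilinear map in X, a and b. The left-hand side is the
  \<open>tw3\<close> of their difference.\<close>

lemma twist_field_leibniz_defect:
  assumes X: "X \<in> mcar End"
  shows "\<Phi> (tw End Alg End leibniz_defect X a) b = \<Phi> X (amult A\<^sub>F a b) - amult A\<^sub>F (\<Phi> X a) b -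
     tensor_sum (ascale A) (rmat_inv H\<^sub>F) (\<lambda>r q. amult A\<^sub>F (act A r a) (vact H\<^sub>F A\<^sub>F q (\<Phi> X) b))"
proof -
  note h = hmodule_End hmodule_Alg
  note e = equivariantD(1)[OF equivariant_eval] equivariantD(1)[OF equivariant_amult]
  \<comment> \<open>Here a comes before X because the braiding exchanges these two before the map is
    applied.\<close>
  let ?S = "\<lambda>a X b. amult A a (X b)"
  have S: "trimap Alg End Alg Alg ?S"
    by (rule trimap_right[OF e])
  have 1: "\<Phi> X (amult A\<^sub>F a b) = tw3 End Alg Alg Alg (\<lambda>X a b. X (amult A a b)) X a b"
    using tw_tw_right[OF h(1,2,2,2,2) equivariant_amult e(1) X, of a b] by (simp add: twist_field_eq)
  have 2: "amult A\<^sub>F (\<Phi> X a) b = tw3 End Alg Alg Alg (\<lambda>X a b. amult A (X a) b) X a b"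
    using tw_tw_left[OF h(1,2,2,2,2) equivariant_eval e(2) X, of a b] by (simp add: twist_field_eq)
  have "amult A\<^sub>F (act A r a) (vact H\<^sub>F A\<^sub>F q (\<Phi> X) b) = tw3 Alg End Alg Alg ?S (act A r a) (vact H A q X) b" for r q
    using tw_tw_right[OF h(2,1,2,2,2) equivariant_eval e(2), of "act A r a" "vact H A q X" b] hmoduleD(3)[OF h(1) X, of q]
    by (simp add: twist_field_eq vact_twist_field[OF X])
  then have "tensor_sum (ascale A) (rmat_inv H\<^sub>F) (\<lambda>r q. amult A\<^sub>F (act A r a) (vact H\<^sub>F A\<^sub>F q (\<Phi> X) b))
    = tw3 End Alg Alg Alg (\<lambda>X a b. braid Alg End Alg (\<lambda>a X. amult A a (X b)) X a) X a b"
    using sum_rmat_inv_tw3[OF h(1,2,2,2) S X, of a b] by simp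
  moreover have "\<Phi> (tw End Alg End leibniz_defect X a) b = tw3 End Alg Alg Alg (\<lambda>X a b. leibniz_defect X a b) X a b"
    using tw_tw_left[OF h(1,2,2,1,2) equivariant_leibniz_defect e(1) X, of a b] by (simp add: twist_field_eq)
  moreover have "\<dots> = tw3 End Alg Alg Alg (\<lambda>X a b. X (amult A a b) - amult A (X a) b -
      braid Alg End Alg (\<lambda>a X. amult A a (X b)) X a) X a b"
    by (simp add: leibniz_defect_def braid_lmul_apply) (simp add: braid_def)
  ultimately show ?thesis
    by (simp only: 1 2 tw3_add_diff[OF hmoduleD(1)[OF h(2)]])
qed

text \<open>Every linear endomorphism is some \<open>\<Phi> X\<close>. Its twisted Leibniz rule says
  that the twist of the defect of X is annihilated by the injective map \<open>\<Phi>\<close>, which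
  by \<open>tw_eq_zero_right_iff\<close> means that the defect itself is zero.\<close>

lemma vector_fields_twist: "vector_fields H\<^sub>F A\<^sub>F = \<Phi> ` vector_fields H A"
proof -
  note b = bimapD[OF bimap_tensor_apply[where t = F_inv, OF hmodule_End hmodule_Alg hmodule_End
      equivariantD(1)[OF equivariant_leibniz_defect]]]
  have *: "\<Phi> X \<in> vector_fields H\<^sub>F A\<^sub>F \<longleftrightarrow> X \<in> vector_fields H A" if X: "X \<in> mcar End" for X
  proof -
    have "\<Phi> X \<in> vector_fields H\<^sub>F A\<^sub>F \<longleftrightarrow> (\<forall>a b. \<Phi> (tw End Alg End leibniz_defect X a) b = 0)"
      unfolding vector_fields_def twist_field_leibniz_defect[OF X] using twist_field_End[OF X]
      by (simp add: algebra_simps)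
    also have "\<dots> \<longleftrightarrow> (\<forall>a. \<Phi> (tw End Alg End leibniz_defect X a) = \<Phi> 0)"
      by (simp add: fun_eq_iff module_hom.zero[OF twist_field_linear])
    also have "\<dots> \<longleftrightarrow> (\<forall>a. tw End Alg End leibniz_defect X a = 0)"
      using module.subspace_0[OF hmoduleD(1,2)[OF hmodule_End]] b(1)[OF X]
      by (subst inj_on_eq_iff[OF inj_on_twist_field]) simp_all
    also have "\<dots> \<longleftrightarrow> X \<in> vector_fields H A"
      using tw_eq_zero_right_iff[OF hmodule_End hmodule_Alg hmodule_End equivariant_leibniz_defect X] X
      by (simp add: vector_fields_iff)
    finally show ?thesis .
  qed
  show ?thesis
  proof (intro equalityI subsetI)
    fix Z assume Z: "Z \<in> vector_fields H\<^sub>F A\<^sub>F"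
    then have "module_hom (ascale A) (ascale A) Z"
      by (simp add: vector_fields_def)
    with Z * show "Z \<in> \<Phi> ` vector_fields H A"
      by (metis twist_field_surj imageI)
  qed (use * vector_fields_iff in blast)
qed

lemma Der_imp_End: "X \<in> vector_fields H A \<Longrightarrow> X \<in> mcar End"
  using Der_subset_End by auto

lemma twist_field_eq_iff:
  "X \<in> vector_fields H A \<Longrightarrow> Y \<in> vector_fields H A \<Longrightarrow> \<Phi> X = \<Phi> Y \<longleftrightarrow> X = Y"
  by (simp only: inj_on_eq_iff[OF inj_on_twist_field] Der_imp_End)

lemma untwist_twist_field: "X \<in> vector_fields H A \<Longrightarrow> untwist_field H F A (\<Phi> X) = X"
  unfolding untwist_field_def
  by (rule inv_into_f_f[OF inj_on_subset[OF inj_on_twist_field]]) (use Der_subset_End in auto)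

lemma tw_lmul_Der: "X \<in> vector_fields H A \<Longrightarrow> tw Alg Der Der (lmul A) a X \<in> vector_fields H A"
  using bimapD(1)[OF bimap_tensor_apply[OF hmodule_Alg hmodule_Der hmodule_Der equivariantD(1)[OF equivariant_Der(1)]], of a X F_inv]
  by simp

text \<open>Both sides, evaluated at b, are the twist of a (X b), bracketed in the two possible
  ways.\<close>

lemma lmul_twist_field:
  assumes X: "X \<in> vector_fields H A"
  shows "lmul A\<^sub>F a (\<Phi> X) = \<Phi> (tw Alg Der Der (lmul A) a X)"
proof
  fix b
  note h = hmodule_Alg hmodule_Der
  have "lmul A\<^sub>F a (\<Phi> X) b = tw3 Alg Der Alg Alg (\<lambda>a X b. amult A a (X b)) a X b"
    using tw_tw_right[OF h(1,2,1,1,1) equivariant_Der(3) equivariantD(1)[OF equivariant_amult], of a X b] X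
    by (simp add: lmul_def twist_field_eq_Der)
  also have "\<dots> = \<Phi> (tw Alg Der Der (lmul A) a X) b"
    using tw_tw_left[OF h(1,2,1,2,1) equivariant_Der(1) equivariantD(1)[OF equivariant_Der(3)], of a X b] X
    by (simp add: lmul_def twist_field_eq_Der)
  finally show "lmul A\<^sub>F a (\<Phi> X) b = \<Phi> (tw Alg Der Der (lmul A) a X) b" .
qed

lemma comp_twist_field:
  assumes X: "X \<in> vector_fields H A" and Y: "Y \<in> vector_fields H A"
  shows "\<Phi> X \<circ> \<Phi> Y = \<Phi> (tw Der Der End (\<circ>) X Y)"
proof
  fix a
  note h = hmodule_Alg hmodule_Der hmodule_End
  have "(\<Phi> X \<circ> \<Phi> Y) a = tw3 Der Der Alg Alg (\<lambda>X Y a. X (Y a)) X Y a"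
    using tw_tw_right[OF h(2,2,1,1,1) equivariant_Der(3) equivariantD(1)[OF equivariant_Der(3)], of X Y a] X Y
    by (simp add: twist_field_eq_Der)
  also have "\<dots> = \<Phi> (tw Der Der End (\<circ>) X Y) a"
    using tw_tw_left[OF h(2,2,1,3,1) equivariant_Der(2) equivariantD(1)[OF equivariant_eval], of X Y a] X Y
    by (simp add: twist_field_eq)
  finally show "(\<Phi> X \<circ> \<Phi> Y) a = \<Phi> (tw Der Der End (\<circ>) X Y) a" .
qed

lemma vact_Der: "X \<in> vector_fields H A \<Longrightarrow> vact H A x X \<in> vector_fields H A"
  using hmoduleD(3)[OF hmodule_Der] by simp

lemma twist_field_sum: "tensor_sum (vscale A) t (\<lambda>x y. \<Phi> (f x y)) = \<Phi> (tensor_sum (vscale A) t f)"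
  by (rule hom_tensor_sum[OF twist_field_linear, symmetric])

lemma rmul_eq_braid: "rmul H A X a = braid Alg Der Der (lmul A) X a"
  by (simp add: rmul_def braid_def)

lemma equivariant_rmul: "equivariant Der Alg Der (rmul H A)"
  unfolding rmul_eq_braid[abs_def]
  by (intro equivariant_braid hmodule_Alg hmodule_Der equivariant_Der)

text \<open>The right action is the braid of the left one, so \<open>sum_rmat_inv_tw\<close> applies
  to \<open>lmul\<close>.\<close>

lemma rmul_twist_field:
  assumes X: "X \<in> vector_fields H A"
  shows "rmul H\<^sub>F A\<^sub>F (\<Phi> X) a = \<Phi> (tw Der Alg Der (rmul H A) X a)"
  using sum_rmat_inv_tw[OF hmodule_Der hmodule_Alg hmodule_Der equivariantD(1)[OF equivariant_Der(1)], of X a] X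
  by (simp add: rmul_def[of H\<^sub>F] vact_twist_field[OF Der_imp_End] lmul_twist_field vact_Der twist_field_sum
    rmul_eq_braid[abs_def])

lemma braided_commutator_twist_field:
  assumes X: "X \<in> vector_fields H A" and Y: "Y \<in> vector_fields H A"
  shows "braided_commutator H\<^sub>F A\<^sub>F (\<Phi> X) (\<Phi> Y) = \<Phi> (tw Der Der End (braided_commutator H A) X Y)"
proof -
  have "tensor_sum (vscale A) (rmat_inv H\<^sub>F) (\<lambda>r q. vact H\<^sub>F A\<^sub>F r (\<Phi> Y) \<circ> vact H\<^sub>F A\<^sub>F q (\<Phi> X)) =
     \<Phi> (tw Der Der End (braid Der Der End (\<circ>)) X Y)"
    using sum_rmat_inv_tw[OF hmodule_Der hmodule_Der hmodule_End equivariantD(1)[OF equivariant_Der(2)], of X Y] X Y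
    by (simp only: vact_twist_field[OF Der_imp_End] comp_twist_field vact_Der twist_field_sum End_simps Der_simps)
  moreover have "tw Der Der End (braided_commutator H A) X Y =
      tw Der Der End (\<circ>) X Y - tw Der Der End (braid Der Der End (\<circ>)) X Y"
    by (simp add: tensor_apply_def braided_commutator_def[abs_def] braid_def tensor_sum_diff[OF vmodule])
  ultimately show ?thesis
    by (simp add: braided_commutator_def[of H\<^sub>F] comp_twist_field[OF X Y] module_hom.diff[OF twist_field_linear])
qed

text \<open>Taking values in \<open>End\<close> avoids proving that the braided commutator of two
  derivations is again a derivation.\<close>

lemma bimap_commutator: "bimap Der Der End (braided_commutator H A)"
proof -
  note b = equivariantD(1)[OF equivariant_Der(2)]
  have "bimap Der Der End (\<lambda>X Y. (X \<circ> Y) - braid Der Der End (\<circ>) X Y)"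
    by (intro bimap_diff bimap_braid b hmodule_Der hmodule_End)
  then show ?thesis
    by (simp add: braided_commutator_def[abs_def] braid_def)
qed

lemma bilinear_on_Der_iff:
  "bilinear_on_vector_fields H A (mscale P) f \<and> (\<forall>X\<in>vector_fields H A. \<forall>Y\<in>vector_fields H A. f X Y \<in> mcar P)
    \<longleftrightarrow> bimap Der Der P f"
  unfolding bilinear_on_vector_fields_def bimap_def Der_simps by blast

lemma bilinear_on_twist_iff:
  assumes "\<And>X Y. X \<in> vector_fields H A \<Longrightarrow> Y \<in> vector_fields H A \<Longrightarrow> f' (\<Phi> X) (\<Phi> Y) = f X Y"
  shows "bilinear_on_vector_fields H\<^sub>F A\<^sub>F s f' \<longleftrightarrow> bilinear_on_vector_fields H A s f"
proof -
  have 1: "f' (\<Phi> X + \<Phi> Y) (\<Phi> Z) = f (X + Y) Z" "f' (\<Phi> Z) (\<Phi> X + \<Phi> Y) = f Z (X + Y)"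
    if "X \<in> vector_fields H A" "Y \<in> vector_fields H A" "Z \<in> vector_fields H A" for X Y Z
    using that hmodule_add[OF hmodule_Der] assms by (simp_all flip: module_hom.add[OF twist_field_linear])
  have 2: "f' (vscale A c (\<Phi> X)) (\<Phi> Z) = f (vscale A c X) Z" "f' (\<Phi> Z) (vscale A c (\<Phi> X)) = f Z (vscale A c X)"
    if "X \<in> vector_fields H A" "Z \<in> vector_fields H A" for X Z c
    using that hmodule_scale[OF hmodule_Der] assms by (simp_all flip: module_hom.scale[OF twist_field_linear])
  show ?thesis
    unfolding bilinear_on_vector_fields_def vector_fields_twist by (simp add: 1 2 assms)
qed

end

section \<open>Metrics and covariant derivatives\<close>

text \<open>The axioms are restated with the quantifiers in the order of the arguments of the
  trilinear maps, so that \<open>tw3_eq_iff\<close> and \<open>tw3_eq_add_iff\<close> match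
  them.\<close>

lemma equivariant_covariant_derivative_iff:
  "equivariant_covariant_derivative H A D \<longleftrightarrow>
    (\<forall>X\<in>vector_fields H A. \<forall>Y\<in>vector_fields H A. D X Y \<in> vector_fields H A) \<and>
    bilinear_on_vector_fields H A (vscale A) D \<and>
    (\<forall>x. \<forall>X\<in>vector_fields H A. \<forall>Y\<in>vector_fields H A. vact H A x (D X Y) =
         tensor_sum (vscale A) (coprod H x) (\<lambda>x\<^sub>1 x\<^sub>2. D (vact H A x\<^sub>1 X) (vact H A x\<^sub>2 Y))) \<and>
    (\<forall>a. \<forall>X\<in>vector_fields H A. \<forall>Y\<in>vector_fields H A. D (lmul A a X) Y = lmul A a (D X Y)) \<and>
    (\<forall>X\<in>vector_fields H A. \<forall>a. \<forall>Y\<in>vector_fields H A. D X (lmul A a Y) = lmul A (X a) Y +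
         tensor_sum (vscale A) (rmat_inv H) (\<lambda>r\<^sub>1 r\<^sub>2. lmul A (act A r\<^sub>1 a) (D (vact H A r\<^sub>2 X) Y)))"
proof (rule iffI, goal_cases)
  case 1
  then interpret equivariant_covariant_derivative H A D .
  show ?case
    by (intro conjI ballI allI D_bilinear D_closed D_equivariant D_lmul_left D_lmul_right)
next
  case 2
  then show ?case by unfold_locales blast+
qed

lemma equivariant_metric_iff:
  "equivariant_metric H A g \<longleftrightarrow>
    bilinear_on_vector_fields H A (ascale A) g \<and>
    (\<forall>X\<in>vector_fields H A. \<forall>a. \<forall>Y\<in>vector_fields H A. g (rmul H A X a) Y = g X (lmul A a Y)) \<and>
    (\<forall>a. \<forall>X\<in>vector_fields H A. \<forall>Y\<in>vector_fields H A. g (lmul A a X) Y = amult A a (g X Y)) \<and>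
    (\<forall>x. \<forall>X\<in>vector_fields H A. \<forall>Y\<in>vector_fields H A. act A x (g X Y) =
         tensor_sum (ascale A) (coprod H x) (\<lambda>x\<^sub>1 x\<^sub>2. g (vact H A x\<^sub>1 X) (vact H A x\<^sub>2 Y))) \<and>
    (\<forall>X\<in>vector_fields H A. \<forall>Y\<in>vector_fields H A. g Y X =
         tensor_sum (ascale A) (rmat_inv H) (\<lambda>r\<^sub>1 r\<^sub>2. g (vact H A r\<^sub>1 X) (vact H A r\<^sub>2 Y)))"
proof (rule iffI, goal_cases)
  case 1
  then interpret equivariant_metric H A g .
  show ?case
    by (intro conjI ballI allI g_bilinear g_balanced g_lmul g_equivariant g_braided_symmetric)
next
  case 2
  then show ?case by unfold_locales blast+
qed

context twisted_algebra
begin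

abbreviation "twisted_metric g \<equiv> transport_metric H F A (twist_metric H F A g)"

lemma twisted_metric_twist_field:
  "X \<in> vector_fields H A \<Longrightarrow> Y \<in> vector_fields H A \<Longrightarrow> twisted_metric g (\<Phi> X) (\<Phi> Y) = tw Der Der Alg g X Y"
  by (simp add: transport_metric_def twist_metric_def untwist_twist_field tensor_apply_def)

lemma equivariant_metric_imp_equivariant:
  assumes "equivariant_metric H A g"
  shows "equivariant Der Der Alg g"
  using equivariant_metric.g_bilinear[OF assms] equivariant_metric.g_equivariant[OF assms]
    bilinear_on_Der_iff[of Alg g]
  by (simp add: equivariant_def)

lemma equivariant_metric_twist:
  assumes g: "equivariant_metric H A g"
  shows "equivariant_metric H\<^sub>F A\<^sub>F (twisted_metric g)"
proof -
  note h = hmodule_Der hmodule_Alg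
  note eg = equivariant_metric_imp_equivariant[OF g]
  note bg = equivariantD(1)[OF eg]
  note bt = bimap_tensor_apply[where t = F_inv, OF h(1,1,2) bg]
  note er = equivariant_rmul and el = equivariant_Der(1) and em = equivariant_amult
  note br = bimap_tensor_apply[where t = F_inv, OF h(1,2,1) equivariantD(1)[OF er]]
  note gF = twisted_metric_twist_field
  have rmul: "tw Der Alg Der (rmul H A) X a \<in> vector_fields H A" if "X \<in> vector_fields H A" for X a
    using bimapD(1)[OF br, of X a] that by simp
  have balanced: "tw3 Der Alg Der Alg (\<lambda>X a Y. g (rmul H A X a) Y) X a Y = tw3 Der Alg Der Alg (\<lambda>X a Y. g X (lmul A a Y)) X a Y"
    if "X \<in> vector_fields H A" "Y \<in> vector_fields H A" for X a Y
    using tw3_eq_iff[OF h(1,2,1,2) trimap_left[OF equivariantD(1)[OF er] bg]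
        trimap_right[OF equivariantD(1)[OF el] bg]] equivariant_metric.g_balanced[OF g] that
    by simp
  have linear: "tw3 Alg Der Der Alg (\<lambda>a X Y. g (lmul A a X) Y) a X Y = tw3 Alg Der Der Alg (\<lambda>a X Y. amult A a (g X Y)) a X Y"
    if "X \<in> vector_fields H A" "Y \<in> vector_fields H A" for X a Y
    using tw3_eq_iff[OF h(2,1,1,2) trimap_left[OF equivariantD(1)[OF el] bg]
        trimap_right[OF bg equivariantD(1)[OF em]]] equivariant_metric.g_lmul[OF g] that
    by simp
  \<comment> \<open>No nesting occurs here: g and its braid agree on all pairs of vector fields,
    hence so do their twists.\<close>
  have symmetric: "tw Der Der Alg g X Y = tw Der Der Alg (braid Der Der Alg g) X Y"
    if "X \<in> vector_fields H A" "Y \<in> vector_fields H A" for X Y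
  proof -
    have "g X Y = braid Der Der Alg g X Y" if "X \<in> vector_fields H A" "Y \<in> vector_fields H A" for X Y
      unfolding braid_def using equivariant_metric.g_braided_symmetric[OF g that(2,1)] by simp
    then show ?thesis using that by (simp add: tensor_apply_def vact_Der)
  qed
  show ?thesis
    unfolding equivariant_metric_iff vector_fields_twist ball_simps
  proof (intro conjI ballI allI, goal_cases)
    case 1
    show ?case
      using bilinear_on_twist_iff[of "twisted_metric g" "tw Der Der Alg g" "ascale A", OF gF] bilinear_on_Der_iff[of Alg] bt by simp
  next
    case (2 X a Y)
    with tw_tw_left[OF h(1,2,1,1,2) er bg, of X a Y] tw_tw_right[OF h(1,2,1,1,2) el bg, of X a Y]
    show ?case by (simp add: rmul_twist_field lmul_twist_field gF rmul tw_lmul_Der balanced)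
  next
    case (3 a X Y)
    with tw_tw_left[OF h(2,1,1,1,2) el bg, of a X Y] tw_tw_right[OF h(2,1,1,2,2) eg equivariantD(1)[OF em], of a X Y]
    show ?case by (simp add: lmul_twist_field gF tw_lmul_Der linear)
  next
    case (4 x X Y)
    with equivariant_tw_iff[OF h(1,1,2) bg] eg
    show ?case by (simp add: vact_twist_field[OF Der_imp_End] gF vact_Der)
  next
    case (5 X Y)
    with sum_rmat_inv_tw[OF h(1,1,2) bg, of Y X]
    show ?case by (simp add: vact_twist_field[OF Der_imp_End] gF vact_Der symmetric)
  qed
qed

lemma twist_field_zero_iff: "X \<in> mcar End \<Longrightarrow> \<Phi> X = 0 \<longleftrightarrow> X = 0"
  using inj_on_eq_iff[OF inj_on_twist_field, of X 0] module.subspace_0[OF hmoduleD(1,2)[OF hmodule_End]]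
    module_hom.zero[OF twist_field_linear] by simp

lemma sum_Der: "(\<And>x y. f x y \<in> vector_fields H A) \<Longrightarrow> tensor_sum (vscale A) t f \<in> vector_fields H A"
  using hmodule_sum[OF hmodule_Der, of f t] by simp

section \<open>Axioms of a bilinear map compared with those of its twist\<close>

context
  fixes D D'
  assumes D: "bimap Der Der Der D"
    and D': "\<And>X Y. X \<in> vector_fields H A \<Longrightarrow> Y \<in> vector_fields H A \<Longrightarrow>
      D' (\<Phi> X) (\<Phi> Y) = \<Phi> (tw Der Der Der D X Y)"
begin

lemmas bimap_tw_D = bimap_tensor_apply[where t = F_inv, OF hmodule_Der hmodule_Der hmodule_Der D]

lemma D_Der: "X \<in> vector_fields H A \<Longrightarrow> Y \<in> vector_fields H A \<Longrightarrow> D X Y \<in> vector_fields H A"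
  using bimapD(1)[OF D] by simp

lemma tw_D_Der: "X \<in> vector_fields H A \<Longrightarrow> Y \<in> vector_fields H A \<Longrightarrow> tw Der Der Der D X Y \<in> vector_fields H A"
  using bimapD(1)[OF bimap_tw_D] by simp

text \<open>Applying \<open>\<Phi>\<close> to the values loses nothing, as both sides are values at
  vector fields. The question thus reduces to \<open>equivariant_tw_iff\<close>, where
  \<open>D\<close> need not yet be equivariant.\<close>

lemma twist_equivariance_iff:
  "(\<forall>x. \<forall>X\<in>vector_fields H\<^sub>F A\<^sub>F. \<forall>Y\<in>vector_fields H\<^sub>F A\<^sub>F. vact H\<^sub>F A\<^sub>F x (D' X Y) =
      tensor_sum (vscale A\<^sub>F) (coprod H\<^sub>F x) (\<lambda>x\<^sub>1 x\<^sub>2. D' (vact H\<^sub>F A\<^sub>F x\<^sub>1 X) (vact H\<^sub>F A\<^sub>F x\<^sub>2 Y)))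
   \<longleftrightarrow> equivariant Der Der Der D"
proof -
  have "vact H\<^sub>F A\<^sub>F x (D' (\<Phi> X) (\<Phi> Y)) =
      tensor_sum (vscale A) (coprod H\<^sub>F x) (\<lambda>x\<^sub>1 x\<^sub>2. D' (vact H\<^sub>F A\<^sub>F x\<^sub>1 (\<Phi> X)) (vact H\<^sub>F A\<^sub>F x\<^sub>2 (\<Phi> Y)))
    \<longleftrightarrow> vact H A x (tw Der Der Der D X Y) =
      tensor_sum (vscale A) (coprod H\<^sub>F x) (\<lambda>x\<^sub>1 x\<^sub>2. tw Der Der Der D (vact H A x\<^sub>1 X) (vact H A x\<^sub>2 Y))"
    if XY: "X \<in> vector_fields H A" "Y \<in> vector_fields H A" for x X Y
  proof -
    have "tensor_sum (vscale A) (coprod H\<^sub>F x) (\<lambda>x\<^sub>1 x\<^sub>2. tw Der Der Der D (vact H A x\<^sub>1 X) (vact H A x\<^sub>2 Y)) \<in> vector_fields H A"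
      by (intro sum_Der tw_D_Der vact_Der XY)
    then show ?thesis
      using XY by (simp add: D' vact_twist_field[OF Der_imp_End] vact_Der tw_D_Der twist_field_sum twist_field_eq_iff)
  qed
  then show ?thesis
    unfolding vector_fields_twist using equivariant_tw_iff[OF hmodule_Der hmodule_Der hmodule_Der D] by simp
qed

text \<open>On the left \<open>lmul\<close> is the inner map, on the right \<open>D\<close> is; the
  latter is where equivariance of \<open>D\<close> enters.\<close>

lemma twist_lmul_left_iff:
  assumes e: "equivariant Der Der Der D"
  shows "(\<forall>a. \<forall>X\<in>vector_fields H\<^sub>F A\<^sub>F. \<forall>Y\<in>vector_fields H\<^sub>F A\<^sub>F. D' (lmul A\<^sub>F a X) Y = lmul A\<^sub>F a (D' X Y))
    \<longleftrightarrow> (\<forall>a. \<forall>X\<in>vector_fields H A. \<forall>Y\<in>vector_fields H A. D (lmul A a X) Y = lmul A a (D X Y))"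
proof -
  note h = hmodule_Der hmodule_Alg
  note el = equivariant_Der(1)
  note bl = equivariantD(1)[OF el]
  have "D' (lmul A\<^sub>F a (\<Phi> X)) (\<Phi> Y) = lmul A\<^sub>F a (D' (\<Phi> X) (\<Phi> Y)) \<longleftrightarrow>
     tw3 Alg Der Der Der (\<lambda>a X Y. D (lmul A a X) Y) a X Y = tw3 Alg Der Der Der (\<lambda>a X Y. lmul A a (D X Y)) a X Y"
    if "X \<in> vector_fields H A" "Y \<in> vector_fields H A" for a X Y
  proof -
    have "D' (lmul A\<^sub>F a (\<Phi> X)) (\<Phi> Y) = \<Phi> (tw Der Der Der D (tw Alg Der Der (lmul A) a X) Y)"
      "lmul A\<^sub>F a (D' (\<Phi> X) (\<Phi> Y)) = \<Phi> (tw Alg Der Der (lmul A) a (tw Der Der Der D X Y))"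
      using that by (simp_all add: lmul_twist_field D' tw_lmul_Der tw_D_Der)
    moreover have "tw Der Der Der D (tw Alg Der Der (lmul A) a X) Y \<in> vector_fields H A"
      "tw Alg Der Der (lmul A) a (tw Der Der Der D X Y) \<in> vector_fields H A"
      using that by (simp_all add: tw_lmul_Der tw_D_Der)
    ultimately show ?thesis
      using tw_tw_left[OF h(2,1,1,1,1) el D, of a X Y] tw_tw_right[OF h(2,1,1,1,1) e bl, of a X Y] that
      by (simp only: twist_field_eq_iff Alg_simps Der_simps UNIV_I)
  qed
  then show ?thesis
    unfolding vector_fields_twist using tw3_eq_iff[OF h(2,1,1,1) trimap_left[OF bl D] trimap_right[OF D bl]]
    by simp
qed

lemma twist_lmul_right_iff:
  assumes e: "equivariant Der Der Der D"
  shows "(\<forall>X\<in>vector_fields H\<^sub>F A\<^sub>F. \<forall>a. \<forall>Y\<in>vector_fields H\<^sub>F A\<^sub>F. D' X (lmul A\<^sub>F a Y) = lmul A\<^sub>F (X a) Y +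
         tensor_sum (vscale A\<^sub>F) (rmat_inv H\<^sub>F) (\<lambda>r\<^sub>1 r\<^sub>2. lmul A\<^sub>F (act A\<^sub>F r\<^sub>1 a) (D' (vact H\<^sub>F A\<^sub>F r\<^sub>2 X) Y)))
    \<longleftrightarrow> (\<forall>X\<in>vector_fields H A. \<forall>a. \<forall>Y\<in>vector_fields H A. D X (lmul A a Y) = lmul A (X a) Y +
         tensor_sum (vscale A) (rmat_inv H) (\<lambda>r\<^sub>1 r\<^sub>2. lmul A (act A r\<^sub>1 a) (D (vact H A r\<^sub>2 X) Y)))"
proof -
  note h = hmodule_Der hmodule_Alg
  note el = equivariant_Der(1) and ev = equivariant_Der(3)
  note bl = equivariantD(1)[OF el]
  have T: "trimap Alg Der Der Der (\<lambda>a X Y. lmul A a (D X Y))"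
    by (rule trimap_right[OF D bl])
  let ?B = "\<lambda>X a Y. braid Alg Der Der (\<lambda>a X. lmul A a (D X Y)) X a"
  have "D' (\<Phi> X) (lmul A\<^sub>F a (\<Phi> Y)) = lmul A\<^sub>F (\<Phi> X a) (\<Phi> Y) +
         tensor_sum (vscale A) (rmat_inv H\<^sub>F) (\<lambda>r\<^sub>1 r\<^sub>2. lmul A\<^sub>F (act A r\<^sub>1 a) (D' (vact H\<^sub>F A\<^sub>F r\<^sub>2 (\<Phi> X)) (\<Phi> Y)))
    \<longleftrightarrow> tw3 Der Alg Der Der (\<lambda>X a Y. D X (lmul A a Y)) X a Y =
        tw3 Der Alg Der Der (\<lambda>X a Y. lmul A (X a) Y) X a Y + tw3 Der Alg Der Der ?B X a Y"
    if XY: "X \<in> vector_fields H A" "Y \<in> vector_fields H A" for a X Y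
  proof -
    have 1: "D' (\<Phi> X) (lmul A\<^sub>F a (\<Phi> Y)) = \<Phi> (tw Der Der Der D X (tw Alg Der Der (lmul A) a Y))"
      using XY by (simp add: lmul_twist_field D' tw_lmul_Der)
    have 2: "lmul A\<^sub>F (\<Phi> X a) (\<Phi> Y) = \<Phi> (tw Alg Der Der (lmul A) (tw Der Alg Alg (\<lambda>X a. X a) X a) Y)"
      using XY by (simp add: lmul_twist_field twist_field_eq_Der)
    have "lmul A\<^sub>F (act A r a) (D' (vact H\<^sub>F A\<^sub>F q (\<Phi> X)) (\<Phi> Y)) =
       \<Phi> (tw3 Alg Der Der Der (\<lambda>a X Y. lmul A a (D X Y)) (act A r a) (vact H A q X) Y)" for r q
      using XY tw_tw_right[OF h(2,1,1,1,1) e bl, of "act A r a" "vact H A q X" Y]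
      by (simp add: vact_twist_field[OF Der_imp_End] vact_Der D' lmul_twist_field tw_D_Der)
    then have 3: "tensor_sum (vscale A) (rmat_inv H\<^sub>F) (\<lambda>r\<^sub>1 r\<^sub>2. lmul A\<^sub>F (act A r\<^sub>1 a) (D' (vact H\<^sub>F A\<^sub>F r\<^sub>2 (\<Phi> X)) (\<Phi> Y)))
       = \<Phi> (tw3 Der Alg Der Der ?B X a Y)"
      using sum_rmat_inv_tw3[OF h(1,2,1,1) T, of X a Y] XY by (simp add: twist_field_sum)
    have mem: "tw Der Der Der D X (tw Alg Der Der (lmul A) a Y) \<in> vector_fields H A"
      "tw Alg Der Der (lmul A) (tw Der Alg Alg (\<lambda>X a. X a) X a) Y \<in> vector_fields H A"
      using XY by (simp_all add: tw_D_Der tw_lmul_Der)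
    \<comment> \<open>\<open>\<Phi>\<close> can be cancelled from an equation between vector fields.
      Written as a sum of left multiples of derivations, the braided term is seen to be one.\<close>
    have "tw3 Der Alg Der Der ?B X a Y = tensor_sum (vscale A) (rmat_inv H\<^sub>F) (\<lambda>r q.
        tw Alg Der Der (lmul A) (act A r a) (tw Der Der Der D (vact H A q X) Y))"
      using sum_rmat_inv_tw3[OF h(1,2,1,1) T, of X a Y] XY
        tw_tw_right[OF h(2,1,1,1,1) e bl, of "act A _ a" "vact H A _ X" Y]
      by (simp add: vact_Der)
    also have "\<dots> \<in> vector_fields H A"
      by (intro sum_Der tw_lmul_Der tw_D_Der vact_Der XY)
    finally have mem3: "tw3 Der Alg Der Der ?B X a Y \<in> vector_fields H A" .
    show ?thesis
      unfolding 1 2 3 module_hom.add[OF twist_field_linear, symmetric]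
      using mem hmodule_add[OF hmodule_Der, simplified, OF mem(2) mem3] XY
        tw_tw_right[OF h(1,2,1,1,1) el D, of X a Y] tw_tw_left[OF h(1,2,1,2,1) ev bl, of X a Y]
      by (simp only: twist_field_eq_iff Alg_simps Der_simps UNIV_I)
  qed
  moreover have "tensor_sum (vscale A) (rmat_inv H) (\<lambda>r\<^sub>1 r\<^sub>2. lmul A (act A r\<^sub>1 a) (D (vact H A r\<^sub>2 X) Y)) = ?B X a Y" for a X Y
    by (simp add: braid_def)
  ultimately show ?thesis
    unfolding vector_fields_twist
    using tw3_eq_add_iff[OF h(1,2,1,1) trimap_right[OF bl D] trimap_left[OF equivariantD(1)[OF ev] bl]
      trimap_braid[OF h(2,1,1,1) T]]
    by simp
qed

lemma equivariant_covariant_derivative_twist_iff: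
  "equivariant_covariant_derivative H\<^sub>F A\<^sub>F D' \<longleftrightarrow> equivariant_covariant_derivative H A D"
proof -
  have closed: "\<forall>X\<in>vector_fields H A. \<forall>Y\<in>vector_fields H A. D X Y \<in> vector_fields H A"
    "\<forall>X\<in>vector_fields H\<^sub>F A\<^sub>F. \<forall>Y\<in>vector_fields H\<^sub>F A\<^sub>F. D' X Y \<in> vector_fields H\<^sub>F A\<^sub>F"
    unfolding vector_fields_twist by (auto simp: D' D_Der tw_D_Der)
  have "bilinear_on_vector_fields H A (vscale A) (\<lambda>X Y. \<Phi> (tw Der Der Der D X Y))"
    using bimapD[OF bimap_tw_D] unfolding bilinear_on_vector_fields_def
    by (simp add: module_hom.add[OF twist_field_linear] module_hom.scale[OF twist_field_linear])
  then have bilinear: "bilinear_on_vector_fields H\<^sub>F A\<^sub>F (vscale A\<^sub>F) D'"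
    "bilinear_on_vector_fields H A (vscale A) D"
    using bilinear_on_twist_iff[of D' "\<lambda>X Y. \<Phi> (tw Der Der Der D X Y)" "vscale A", OF D']
      bilinear_on_Der_iff[of Der D] D by simp_all
  have equivariance: "(\<forall>x. \<forall>X\<in>vector_fields H A. \<forall>Y\<in>vector_fields H A. vact H A x (D X Y) =
      tensor_sum (vscale A) (coprod H x) (\<lambda>x\<^sub>1 x\<^sub>2. D (vact H A x\<^sub>1 X) (vact H A x\<^sub>2 Y)))
    \<longleftrightarrow> equivariant Der Der Der D"
    using D by (simp add: equivariant_def)
  show ?thesis
  \<comment> \<open>The module axioms can be compared only for equivariant \<open>D\<close>. For any
    other \<open>D\<close> both sides are false, since equivariance is a conjunct of each.\<close>
  proof (cases "equivariant Der Der Der D")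
    case True
    show ?thesis
      unfolding equivariant_covariant_derivative_iff twist_equivariance_iff equivariance
        twist_lmul_left_iff[OF True] twist_lmul_right_iff[OF True]
      by (simp only: eqTrueI[OF closed(1)] eqTrueI[OF closed(2)] eqTrueI[OF bilinear(1)] eqTrueI[OF bilinear(2)])
  next
    case False
    then show ?thesis
      unfolding equivariant_covariant_derivative_iff twist_equivariance_iff equivariance
      by (simp only: simp_thms)
  qed
qed

lemma torsion_free_twist_iff: "torsion_free H\<^sub>F A\<^sub>F D' \<longleftrightarrow> torsion_free H A D"
proof -
  note h = hmodule_Der hmodule_End
  let ?B = "braid Der Der Der D" and ?C = "braided_commutator H A"
  \<comment> \<open>The whole torsion as one bilinear map into \<open>End\<close>, so that its
    vanishing is transported by \<open>bimap_tw_iff_eq_zero\<close>.\<close>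
  let ?T = "\<lambda>X Y. D X Y - ?B X Y - ?C X Y"
  have Der_End: "bimap Der Der End \<phi>" if "bimap Der Der Der \<phi>" for \<phi>
    using that Der_subset_End unfolding bimap_def by auto
  have T: "bimap Der Der End ?T"
    by (intro bimap_diff h Der_End D bimap_braid bimap_commutator)
  have "D' (\<Phi> X) (\<Phi> Y) - tensor_sum (vscale A) (rmat_inv H\<^sub>F) (\<lambda>r\<^sub>1 r\<^sub>2. D' (vact H\<^sub>F A\<^sub>F r\<^sub>1 (\<Phi> Y)) (vact H\<^sub>F A\<^sub>F r\<^sub>2 (\<Phi> X)))
     - braided_commutator H\<^sub>F A\<^sub>F (\<Phi> X) (\<Phi> Y) = 0 \<longleftrightarrow> tw Der Der End ?T X Y = 0"
    if XY: "X \<in> vector_fields H A" "Y \<in> vector_fields H A" for X Y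
  proof -
    have "tensor_sum (vscale A) (rmat_inv H\<^sub>F) (\<lambda>r\<^sub>1 r\<^sub>2. D' (vact H\<^sub>F A\<^sub>F r\<^sub>1 (\<Phi> Y)) (vact H\<^sub>F A\<^sub>F r\<^sub>2 (\<Phi> X)))
      = \<Phi> (tw Der Der Der ?B X Y)"
      using sum_rmat_inv_tw[OF h(1,1,1) D, of X Y] XY
      by (simp add: vact_twist_field[OF Der_imp_End] vact_Der D' twist_field_sum)
    then have "D' (\<Phi> X) (\<Phi> Y) - tensor_sum (vscale A) (rmat_inv H\<^sub>F) (\<lambda>r\<^sub>1 r\<^sub>2. D' (vact H\<^sub>F A\<^sub>F r\<^sub>1 (\<Phi> Y)) (vact H\<^sub>F A\<^sub>F r\<^sub>2 (\<Phi> X)))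
     - braided_commutator H\<^sub>F A\<^sub>F (\<Phi> X) (\<Phi> Y) = \<Phi> (tw Der Der Der D X Y - tw Der Der Der ?B X Y - tw Der Der End ?C X Y)"
      using XY by (simp add: D' braided_commutator_twist_field module_hom.diff[OF twist_field_linear])
    moreover have "tw Der Der Der D X Y - tw Der Der Der ?B X Y - tw Der Der End ?C X Y = tw Der Der End ?T X Y"
      by (simp add: tensor_apply_def tensor_sum_diff[OF vmodule])
    moreover have "tw Der Der End ?T X Y \<in> mcar End"
      using bimapD(1)[OF bimap_tensor_apply[where t = F_inv, OF h(1,1,2) T], of X Y] XY by simp
    ultimately show ?thesis by (simp only: twist_field_zero_iff)
  qed
  then show ?thesis
    unfolding torsion_free_def vector_fields_twist using bimap_tw_iff_eq_zero[OF h(1,1,2) T]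
    by (simp add: braid_def)
qed

text \<open>The metric is the inner map under a vector field and \<open>D\<close> is the inner map
  under the metric, so both must be equivariant. The trilinear map for the braided term takes Y
  before X, and the braiding restores the order.\<close>

lemma metric_derivative_twist_iff:
  assumes e: "equivariant Der Der Der D" and g: "equivariant_metric H A g"
  shows "metric_derivative H\<^sub>F A\<^sub>F (twisted_metric g) D' \<longleftrightarrow> metric_derivative H A g D"
proof -
  note h = hmodule_Der hmodule_Alg
  note eg = equivariant_metric_imp_equivariant[OF g] and ev = equivariant_Der(3)
  note bg = equivariantD(1)[OF eg] and bv = equivariantD(1)[OF ev]
  note gF = twisted_metric_twist_field
  have T: "trimap Der Der Der Alg (\<lambda>Y X Z. g Y (D X Z))"
    by (rule trimap_right[OF D bg])
  let ?B = "\<lambda>X Y Z. braid Der Der Alg (\<lambda>Y X. g Y (D X Z)) X Y"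
  have "\<Phi> X (twisted_metric g (\<Phi> Y) (\<Phi> Z)) = twisted_metric g (D' (\<Phi> X) (\<Phi> Y)) (\<Phi> Z) +
      tensor_sum (ascale A) (rmat_inv H\<^sub>F) (\<lambda>r\<^sub>1 r\<^sub>2. twisted_metric g (vact H\<^sub>F A\<^sub>F r\<^sub>1 (\<Phi> Y)) (D' (vact H\<^sub>F A\<^sub>F r\<^sub>2 (\<Phi> X)) (\<Phi> Z)))
    \<longleftrightarrow> tw3 Der Der Der Alg (\<lambda>X Y Z. X (g Y Z)) X Y Z =
        tw3 Der Der Der Alg (\<lambda>X Y Z. g (D X Y) Z) X Y Z + tw3 Der Der Der Alg ?B X Y Z"
    if XYZ: "X \<in> vector_fields H A" "Y \<in> vector_fields H A" "Z \<in> vector_fields H A" for X Y Z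
  proof -
    have "twisted_metric g (vact H\<^sub>F A\<^sub>F r (\<Phi> Y)) (D' (vact H\<^sub>F A\<^sub>F q (\<Phi> X)) (\<Phi> Z)) =
        tw3 Der Der Der Alg (\<lambda>Y X Z. g Y (D X Z)) (vact H A r Y) (vact H A q X) Z" for r q
      using XYZ tw_tw_right[OF h(1,1,1,1,2) e bg, of "vact H A r Y" "vact H A q X" Z]
      by (simp add: vact_twist_field[OF Der_imp_End] vact_Der D' gF tw_D_Der)
    then have "tensor_sum (ascale A) (rmat_inv H\<^sub>F) (\<lambda>r\<^sub>1 r\<^sub>2. twisted_metric g (vact H\<^sub>F A\<^sub>F r\<^sub>1 (\<Phi> Y)) (D' (vact H\<^sub>F A\<^sub>F r\<^sub>2 (\<Phi> X)) (\<Phi> Z)))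
      = tw3 Der Der Der Alg ?B X Y Z"
      using sum_rmat_inv_tw3[OF h(1,1,1,2) T, of X Y Z] XYZ by simp
    moreover have "\<Phi> X (twisted_metric g (\<Phi> Y) (\<Phi> Z)) = tw3 Der Der Der Alg (\<lambda>X Y Z. X (g Y Z)) X Y Z"
      using XYZ tw_tw_right[OF h(1,1,1,2,2) eg bv, of X Y Z] by (simp add: gF twist_field_eq_Der)
    moreover have "twisted_metric g (D' (\<Phi> X) (\<Phi> Y)) (\<Phi> Z) = tw3 Der Der Der Alg (\<lambda>X Y Z. g (D X Y) Z) X Y Z"
      using XYZ tw_tw_left[OF h(1,1,1,1,2) e bg, of X Y Z] by (simp add: gF D' tw_D_Der)
    ultimately show ?thesis by (simp only:)
  qed
  moreover have "tensor_sum (ascale A) (rmat_inv H) (\<lambda>r\<^sub>1 r\<^sub>2. g (vact H A r\<^sub>1 Y) (D (vact H A r\<^sub>2 X) Z)) = ?B X Y Z" for X Y Z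
    by (simp add: braid_def)
  ultimately show ?thesis
    unfolding metric_derivative_def vector_fields_twist
    using tw3_eq_add_iff[OF h(1,1,1,2) trimap_right[OF bg bv] trimap_left[OF D bg] trimap_braid[OF h(1,1,1,2) T]]
    by simp
qed

lemma torsion_free_metric_derivative_twist_iff:
  assumes "equivariant_metric H A g"
  shows "torsion_free_metric_derivative H\<^sub>F A\<^sub>F (twisted_metric g) D' \<longleftrightarrow> torsion_free_metric_derivative H A g D"
proof -
  have "equivariant Der Der Der D" if "equivariant_covariant_derivative H A D"
    using that D by (simp add: equivariant_covariant_derivative_iff equivariant_def)
  then show ?thesis
    unfolding torsion_free_metric_derivative_def equivariant_covariant_derivative_twist_iff torsion_free_twist_iff
    using metric_derivative_twist_iff[OF _ assms] by blast
qed

end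

section \<open>The twisted Levi-Civita derivative\<close>

lemma bimap_covariant_derivative:
  "equivariant_covariant_derivative H A D \<Longrightarrow> bimap Der Der Der D"
  using bilinear_on_Der_iff[of Der D] by (simp add: equivariant_covariant_derivative_iff)

lemma transport_derivative_twist_field:
  assumes "X \<in> vector_fields H A" "Y \<in> vector_fields H A"
  shows "transport_derivative H F A (twist_derivative H F A D) (\<Phi> X) (\<Phi> Y) = \<Phi> (tw Der Der Der D X Y)"
  using assms by (simp add: transport_derivative_def twist_derivative_def untwist_twist_field tensor_apply_def)

text \<open>Closure and bilinearity of \<open>D'\<close> already determine a bilinear preimage. Its
  remaining properties are left to the equivalences above, which assume nothing more.\<close>

lemma untwist_derivative:
  assumes "equivariant_covariant_derivative H\<^sub>F A\<^sub>F D'"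
  obtains D where "bimap Der Der Der D"
    "\<And>X Y. X \<in> vector_fields H A \<Longrightarrow> Y \<in> vector_fields H A \<Longrightarrow> D' (\<Phi> X) (\<Phi> Y) = \<Phi> (tw Der Der Der D X Y)"
proof -
  \<comment> \<open>\<open>D'\<close> pulled back along \<open>\<Phi>\<close>, with the twist of the
    arguments not yet undone.\<close>
  define B where "B X Y = untwist_field H F A (D' (\<Phi> X) (\<Phi> Y))" for X Y
  have closed: "D' (\<Phi> X) (\<Phi> Y) \<in> \<Phi> ` vector_fields H A" if "X \<in> vector_fields H A" "Y \<in> vector_fields H A" for X Y
    using assms that unfolding equivariant_covariant_derivative_iff vector_fields_twist by blast
  have B: "B X Y \<in> vector_fields H A" "\<Phi> (B X Y) = D' (\<Phi> X) (\<Phi> Y)"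
    if "X \<in> vector_fields H A" "Y \<in> vector_fields H A" for X Y
    using closed[OF that] by (auto simp: B_def untwist_twist_field)
  have "bilinear_on_vector_fields H A (vscale A) (\<lambda>X Y. D' (\<Phi> X) (\<Phi> Y))"
    using assms bilinear_on_twist_iff[of D' "\<lambda>X Y. D' (\<Phi> X) (\<Phi> Y)" "vscale A"]
    by (simp add: equivariant_covariant_derivative_iff)
  then have bil_add: "D' (\<Phi> (X + Y)) (\<Phi> Z) = D' (\<Phi> X) (\<Phi> Z) + D' (\<Phi> Y) (\<Phi> Z)"
    "D' (\<Phi> Z) (\<Phi> (X + Y)) = D' (\<Phi> Z) (\<Phi> X) + D' (\<Phi> Z) (\<Phi> Y)"
    and bil_scale: "D' (\<Phi> (vscale A c X)) (\<Phi> Z) = vscale A c (D' (\<Phi> X) (\<Phi> Z))"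
    "D' (\<Phi> X) (\<Phi> (vscale A c Z)) = vscale A c (D' (\<Phi> X) (\<Phi> Z))"
    if "X \<in> vector_fields H A" "Y \<in> vector_fields H A" "Z \<in> vector_fields H A" for X Y Z c
    using that unfolding bilinear_on_vector_fields_def by blast+
  note mem = hmodule_add[OF hmodule_Der, simplified] hmodule_scale[OF hmodule_Der, simplified]
  have bB: "bimap Der Der Der B"
  proof (rule bimapI, unfold Der_simps)
    fix X Y Z c assume [simp]: "X \<in> vector_fields H A" "Y \<in> vector_fields H A" "Z \<in> vector_fields H A"
    have inj: "U = V" if "U \<in> vector_fields H A" "V \<in> vector_fields H A" "\<Phi> U = \<Phi> V" for U V
      using that by (simp add: twist_field_eq_iff)
    show "B X Y \<in> vector_fields H A" by (simp add: B)
    show "B (X + Y) Z = B X Z + B Y Z"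
      by (rule inj) (simp_all add: B mem bil_add module_hom.add[OF twist_field_linear, of "B _ _"])
    show "B X (Y + Z) = B X Y + B X Z"
      by (rule inj) (simp_all add: B mem bil_add module_hom.add[OF twist_field_linear, of "B _ _"])
    show "B (vscale A c X) Y = vscale A c (B X Y)"
      by (rule inj) (simp_all add: B mem bil_scale[of _ X] module_hom.scale[OF twist_field_linear, of _ "B _ _"])
    show "B X (vscale A c Y) = vscale A c (B X Y)"
      by (rule inj) (simp_all add: B mem bil_scale[of _ X] module_hom.scale[OF twist_field_linear, of _ "B _ _"])
  qed
  show thesis
  \<comment> \<open>Letting F act on the arguments of \<open>B\<close> is undone by
    \<open>tw\<close>, so the twist of this map is \<open>B\<close>.\<close>
  proof (rule that[of "tensor_apply F Der Der Der B"])
    show "bimap Der Der Der (tensor_apply F Der Der Der B)"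
      by (intro bimap_tensor_apply hmodule_Der bB)
    show "D' (\<Phi> X) (\<Phi> Y) = \<Phi> (tw Der Der Der (tensor_apply F Der Der Der B) X Y)"
      if "X \<in> vector_fields H A" "Y \<in> vector_fields H A" for X Y
      using that tensor_apply_inverse[OF hmodule_Der hmodule_Der hmodule_Der bB F_inverse, of X Y]
      by (simp add: B)
  qed
qed

lemma levi_civita_twist:
  assumes g: "equivariant_metric H A g" and D: "levi_civita H A g D"
  shows "levi_civita H\<^sub>F A\<^sub>F (twisted_metric g) (transport_derivative H F A (twist_derivative H F A D))"
  unfolding levi_civita_def
proof (intro conjI allI impI ballI)
  from D have "torsion_free_metric_derivative H A g D"
    and unique: "\<And>D' X Y. torsion_free_metric_derivative H A g D' \<Longrightarrow> X \<in> vector_fields H A \<Longrightarrow>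
      Y \<in> vector_fields H A \<Longrightarrow> D' X Y = D X Y"
    unfolding levi_civita_def by blast+
  moreover from this(1) have "bimap Der Der Der D"
    by (simp add: torsion_free_metric_derivative_def bimap_covariant_derivative)
  ultimately show "torsion_free_metric_derivative H\<^sub>F A\<^sub>F (twisted_metric g) (transport_derivative H F A (twist_derivative H F A D))"
    using torsion_free_metric_derivative_twist_iff[OF _ transport_derivative_twist_field g] by blast
  fix D'' U V
  assume D'': "torsion_free_metric_derivative H\<^sub>F A\<^sub>F (twisted_metric g) D''"
    and "U \<in> vector_fields H\<^sub>F A\<^sub>F" "V \<in> vector_fields H\<^sub>F A\<^sub>F"
  then obtain X Y where XY: "X \<in> vector_fields H A" "Y \<in> vector_fields H A" and UV: "U = \<Phi> X" "V = \<Phi> Y"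
    unfolding vector_fields_twist by blast
  from D'' have "equivariant_covariant_derivative H\<^sub>F A\<^sub>F D''"
    by (simp add: torsion_free_metric_derivative_def)
  \<comment> \<open>The competitor is written as the twist of some \<open>D'\<close>, to which
    uniqueness over the original algebra can be applied.\<close>
  then obtain D' where D': "bimap Der Der Der D'"
    "\<And>X Y. X \<in> vector_fields H A \<Longrightarrow> Y \<in> vector_fields H A \<Longrightarrow> D'' (\<Phi> X) (\<Phi> Y) = \<Phi> (tw Der Der Der D' X Y)"
    by (rule untwist_derivative) (rule that)
  then have "torsion_free_metric_derivative H A g D'"
    using torsion_free_metric_derivative_twist_iff[OF D' g] D'' by blast
  \<comment> \<open>Agreement on vector fields is enough: the twist evaluates both derivatives only
    at images of vector fields under the action of \<open>H\<close>, and these are vector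
    fields.\<close>
  from unique[OF this] have "tw Der Der Der D' X Y = tw Der Der Der D X Y"
    using XY by (simp add: tensor_apply_def vact_Der)
  then show "D'' U V = transport_derivative H F A (twist_derivative H F A D) U V"
    using XY by (simp add: UV D' transport_derivative_twist_field)
qed

end

theorem corollary3p13:
  fixes H :: "('k::comm_ring_1, 'h::ring_1) hopf_data"
    and A :: "('k, 'h, 'a::ab_group_add) algebra_data"
    and F :: "('k, 'h) tensor2"
    and g :: "('a \<Rightarrow> 'a) \<Rightarrow> ('a \<Rightarrow> 'a) \<Rightarrow> 'a"
  assumes "triangular_hopf_algebra H"
    and "braided_commutative_algebra H A"
    and "drinfeld_twist H F"
    and "equivariant_metric H A g"
  defines "H\<^sub>F \<equiv> twist_hopf H F"
    and "A\<^sub>F \<equiv> twist_algebra H F A"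
    and "g\<^sub>F \<equiv> transport_metric H F A (twist_metric H F A g)"
  shows "equivariant_metric H\<^sub>F A\<^sub>F g\<^sub>F \<and>
    (non_degenerate H A g \<and> non_degenerate H\<^sub>F A\<^sub>F g\<^sub>F \<longrightarrow>
      (\<forall>D. levi_civita H A g D \<longrightarrow>
        levi_civita H\<^sub>F A\<^sub>F g\<^sub>F (transport_derivative H F A (twist_derivative H F A D))))"
proof -
  interpret twisted_algebra H F A
    using assms(1-3) by (simp add: twisted_algebra_def twisted_hopf_algebra_def twisted_hopf_algebra_axioms_def)
  show ?thesis
    unfolding H\<^sub>F_def A\<^sub>F_def g\<^sub>F_def using equivariant_metric_twist levi_civita_twist assms(4) by blast
qed

end
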